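(* Let $G$ be a minimal brace that is not isomorphic to any member of $\{K_2, C_4, K_{3,3}, B_8, B_{10}, Q_{10}^+\}$. Let $n_G:=|V(G)|/2$ and $m_G:=|E(G)|$. Then $m_G\le 5\cdot n_G-10$, and equality holds if and only if $G$ is isomorphic to a member of $\{M_{10},B_{12}\}\cup\mathcal{Q}$.
   Context: Graphs are finite and loopless; parallel edges are allowed. For $X\subseteq V(G)$, $\partial(X)$ is the set of edges with exactly one end in $X$; this cut is trivial if $X$ or $V(G)\setminus X$ is a singleton. A graph is matching covered if it is connected, has at least one edge, and every edge lies in a perfect matching. A cut $\partial(X)$ of a matching covered graph is tight if $|M\cap\partial(X)|=1$ for every perfect matching $M$. A brace is a bipartite matching covered graph with no nontrivial tight cut. A brace $G$ is minimal if, for each $e\in E(G)$, the graph $G-e$ is not a brace. A vertex is noncubic if its degree is at least four. The biwheel $B_{2n}$ ($n\ge 4$) is the simple bipartite graph obtained from the cycle $C_{2n-2}$ by adding two nonadjacent vertices, each of degree exactly $n-1$ (one is joined to all vertices of one color class of the cycle, the other to all vertices of the other color class); $B_8$ is the cube. $M_{10}$ is the Möbius ladder of order ten: a cycle of length 10 together with its 5 chords joining antipodal vertices. $Q_{10}$ is the cubic bipartite graph with vertices $a_1,a_2,w_1,w_2,w_3$ in one color class and $b_1,b_2,u_1,u_2,u_3$ in the other, and edges $a_iu_j$, $b_iw_j$ ($i\in\{1,2\}$, $j\in\{1,2,3\}$) and $u_jw_j$ ($j\in\{1,2,3\}$). $Q_{10}^+$ is obtained from $Q_{10}$ by adding the edge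 $a_1b_1$. If $S=\{a_1,a_2,b_1,b_2\}$ is a stable set of a connected bipartite graph $J[A,B]$ with $a_1,a_2\in A$, $b_1,b_2\in B$ (four distinct vertices), the $S$-extension of $J$ is obtained from $J$ by adding two new vertices $a_0,b_0$ and the five edges $a_0b_1,a_0b_2,b_0a_1,b_0a_2,a_0b_0$. $Q_{12}$ is the $S$-extension of $Q_{10}$ where $S=\{a_1,a_2,b_1,b_2\}$ in the labelling above (the unique stable set of $Q_{10}$ meeting each color class in precisely two vertices). For $n\ge 7$, $Q_{2n}$ is the $S$-extension of $Q_{2n-2}$ where $S$ is the set of (four) noncubic vertices of $Q_{2n-2}$. Finally, $\mathcal{Q}:=\{Q_{2n}: n\ge 6\}$. *)

theory Defs
  imports Complex_Main
begin

section \<open>Finite loopless multigraphs\<close>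

text \<open>Edges are abstract; \<open>ends G e\<close> is the set of the ends of \<open>e\<close>, so that two distinct
  edges with the same set of ends are parallel.\<close>

record ('v, 'e) graph =
  verts :: "'v set"
  edges :: "'e set"
  ends :: "'e \<Rightarrow> 'v set"

definition wf_graph :: "('v, 'e) graph \<Rightarrow> bool" where
  "wf_graph G \<longleftrightarrow> finite (verts G) \<and> finite (edges G) \<and>
     (\<forall>e\<in>edges G. ends G e \<subseteq> verts G \<and> card (ends G e) = 2)"

definition graph_iso :: "('v, 'e) graph \<Rightarrow> ('w, 'f) graph \<Rightarrow> bool"  (infix \<open>\<simeq>\<close> 50) where
  "G \<simeq> H \<longleftrightarrow> (\<exists>f g. bij_betw f (verts G) (verts H) \<and> bij_betw g (edges G) (edges H) \<and>
     (\<forall>e\<in>edges G. ends H (g e) = f ` ends G e))"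

definition del_edge :: "('v, 'e) graph \<Rightarrow> 'e \<Rightarrow> ('v, 'e) graph" where
  "del_edge G e = G\<lparr>edges := edges G - {e}\<rparr>"

text \<open>As there are no loops, the degree of a vertex is the number of edges incident with it.\<close>

definition degree :: "('v, 'e) graph \<Rightarrow> 'v \<Rightarrow> nat" where
  "degree G v = card {e \<in> edges G. v \<in> ends G e}"

definition noncubic :: "('v, 'e) graph \<Rightarrow> 'v set" where
  "noncubic G = {v \<in> verts G. 4 \<le> degree G v}"

definition adj_rel :: "('v, 'e) graph \<Rightarrow> ('v \<times> 'v) set" where
  "adj_rel G = {(u, v). \<exists>e\<in>edges G. ends G e = {u, v}}"

definition connected_graph :: "('v, 'e) graph \<Rightarrow> bool" where
  "connected_graph G \<longleftrightarrow>
     verts G \<noteq> {} \<and> (\<forall>u\<in>verts G. \<forall>v\<in>verts G. (u, v) \<in> (adj_rel G)\<^sup>*)"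

definition bipartite :: "('v, 'e) graph \<Rightarrow> bool" where
  "bipartite G \<longleftrightarrow> (\<exists>A B. A \<union> B = verts G \<and> A \<inter> B = {} \<and>
     (\<forall>e\<in>edges G. \<exists>a\<in>A. \<exists>b\<in>B. ends G e = {a, b}))"


section \<open>Tight cuts and braces\<close>

definition perfect_matching :: "('v, 'e) graph \<Rightarrow> 'e set \<Rightarrow> bool" where
  "perfect_matching G M \<longleftrightarrow> M \<subseteq> edges G \<and> (\<forall>v\<in>verts G. \<exists>!e. e \<in> M \<and> v \<in> ends G e)"

definition matching_covered :: "('v, 'e) graph \<Rightarrow> bool" where
  "matching_covered G \<longleftrightarrow> connected_graph G \<and> edges G \<noteq> {} \<and>
     (\<forall>e\<in>edges G. \<exists>M. perfect_matching G M \<and> e \<in> M)"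

definition cut :: "('v, 'e) graph \<Rightarrow> 'v set \<Rightarrow> 'e set" where
  "cut G X = {e \<in> edges G. card (ends G e \<inter> X) = 1}"

text \<open>Triviality is stated for the shore \<open>X\<close>; in a connected graph the cut determines its two
  shores.\<close>

definition trivial_cut :: "('v, 'e) graph \<Rightarrow> 'v set \<Rightarrow> bool" where
  "trivial_cut G X \<longleftrightarrow> is_singleton X \<or> is_singleton (verts G - X)"

definition tight_cut :: "('v, 'e) graph \<Rightarrow> 'v set \<Rightarrow> bool" where
  "tight_cut G X \<longleftrightarrow> (\<forall>M. perfect_matching G M \<longrightarrow> card (M \<inter> cut G X) = 1)"

definition brace :: "('v, 'e) graph \<Rightarrow> bool" where
  "brace G \<longleftrightarrow> wf_graph G \<and> bipartite G \<and> matching_covered G \<and>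
     \<not> (\<exists>X\<subseteq>verts G. tight_cut G X \<and> \<not> trivial_cut G X)"

definition minimal_brace :: "('v, 'e) graph \<Rightarrow> bool" where
  "minimal_brace G \<longleftrightarrow> brace G \<and> (\<forall>e\<in>edges G. \<not> brace (del_edge G e))"


section \<open>Particular graphs\<close>

text \<open>All the particular graphs below are simple; their edges are the two-element sets of ends.\<close>

definition simple_graph :: "'v set \<Rightarrow> 'v set set \<Rightarrow> ('v, 'v set) graph" where
  "simple_graph V E = \<lparr>verts = V, edges = E, ends = (\<lambda>e. e)\<rparr>"

definition K2 :: "(nat, nat set) graph" where
  "K2 = simple_graph {0, 1} {{0, 1}}"

definition cycle_edges :: "nat \<Rightarrow> nat set set" where
  "cycle_edges k = (\<lambda>i. {i, Suc i mod k}) ` {..<k}"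

definition C4 :: "(nat, nat set) graph" where
  "C4 = simple_graph {..<4} (cycle_edges 4)"

definition K33 :: "(nat, nat set) graph" where
  "K33 = simple_graph {..<6} ((\<lambda>(i, j). {i, j}) ` ({0, 1, 2} \<times> {3, 4, 5}))"

text \<open>\<open>biwheel n\<close> is the biwheel \<open>B\<^sub>2\<^sub>n\<close> of order \<open>2 * n\<close>, meant for \<open>n \<ge> 4\<close>: the cycle has the
  vertices \<open>0, \<dots>, 2n - 3\<close>, with the parity as colour, and the two hubs are \<open>2n - 2\<close> and \<open>2n - 1\<close>.\<close>

definition biwheel :: "nat \<Rightarrow> (nat, nat set) graph" where
  "biwheel n = simple_graph {..<2 * n}
     (cycle_edges (2 * n - 2)
      \<union> (\<lambda>i. {2 * n - 2, i}) ` {i \<in> {..<2 * n - 2}. even i}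
      \<union> (\<lambda>i. {2 * n - 1, i}) ` {i \<in> {..<2 * n - 2}. odd i})"

definition M10 :: "(nat, nat set) graph" where
  "M10 = simple_graph {..<10} (cycle_edges 10 \<union> (\<lambda>i. {i, i + 5}) ` {..<5})"

text \<open>The vertices \<open>a\<^sub>i\<close>, \<open>b\<^sub>i\<close>, \<open>u\<^sub>i\<close>, \<open>w\<^sub>i\<close> of the graphs \<open>Q\<^sub>2\<^sub>n\<close>. One colour class consists of the
  vertices \<open>a\<^sub>i\<close> and \<open>w\<^sub>i\<close>, the other one of the vertices \<open>b\<^sub>i\<close> and \<open>u\<^sub>i\<close>.\<close>

datatype q_vertex = Va nat | Vb nat | Vu nat | Vw nat

fun q_class :: "q_vertex \<Rightarrow> bool" where
  "q_class (Va i) = True"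
| "q_class (Vw i) = True"
| "q_class (Vb i) = False"
| "q_class (Vu i) = False"

definition Q10 :: "(q_vertex, q_vertex set) graph" where
  "Q10 = simple_graph
     (Va ` {1, 2} \<union> Vw ` {1, 2, 3} \<union> Vb ` {1, 2} \<union> Vu ` {1, 2, 3})
     ((\<lambda>(i, j). {Va i, Vu j}) ` ({1, 2} \<times> {1, 2, 3})
      \<union> (\<lambda>(i, j). {Vb i, Vw j}) ` ({1, 2} \<times> {1, 2, 3})
      \<union> (\<lambda>j. {Vu j, Vw j}) ` {1, 2, 3})"

definition Q10_plus :: "(q_vertex, q_vertex set) graph" where
  "Q10_plus = simple_graph (verts Q10) (insert {Va 1, Vb 1} (edges Q10))"

text \<open>\<open>S_extension J A B S a0 b0\<close> is the \<open>S\<close>-extension of the simple bipartite graph \<open>J[A,B]\<close>, with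
  \<open>a0\<close> and \<open>b0\<close> as new vertices. It is meant for distinct \<open>a0, b0 \<notin> verts J\<close> and a stable set \<open>S\<close>
  with exactly two elements \<open>a\<^sub>1, a\<^sub>2\<close> in \<open>A\<close> and exactly two elements \<open>b\<^sub>1, b\<^sub>2\<close> in \<open>B\<close>.\<close>

definition S_extension ::
  "('v, 'v set) graph \<Rightarrow> 'v set \<Rightarrow> 'v set \<Rightarrow> 'v set \<Rightarrow> 'v \<Rightarrow> 'v \<Rightarrow> ('v, 'v set) graph" where
  "S_extension J A B S a0 b0 = simple_graph (verts J \<union> {a0, b0})
     (edges J \<union> (\<lambda>b. {a0, b}) ` (S \<inter> B) \<union> (\<lambda>a. {b0, a}) ` (S \<inter> A) \<union> {{a0, b0}})"

definition Q_step ::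
  "(q_vertex, q_vertex set) graph \<Rightarrow> q_vertex set \<Rightarrow> nat \<Rightarrow> (q_vertex, q_vertex set) graph" where
  "Q_step J S n =
     S_extension J {v \<in> verts J. q_class v} {v \<in> verts J. \<not> q_class v} S (Va n) (Vb n)"

text \<open>\<open>Q n\<close> is the graph \<open>Q\<^sub>2\<^sub>n\<close> of order \<open>2 * n\<close>, for \<open>n \<ge> 6\<close> (for \<open>n \<le> 5\<close> it is the dummy value
  \<open>Q10\<close>). The new vertices \<open>a\<^sub>0\<close>, \<open>b\<^sub>0\<close> in the step from \<open>n - 1\<close> to \<open>n\<close> are named \<open>Va n\<close>, \<open>Vb n\<close>.\<close>

fun Q :: "nat \<Rightarrow> (q_vertex, q_vertex set) graph" where
  "Q n = (if n \<le> 5 then Q10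
          else if n = 6 then Q_step Q10 {Va 1, Va 2, Vb 1, Vb 2} 6
          else Q_step (Q (n - 1)) (noncubic (Q (n - 1))) n)"

declare Q.simps [simp del]

definition Q_family :: "(q_vertex, q_vertex set) graph set" where
  "Q_family = {Q n | n. n \<ge> 6}"

end

theory Submission
  imports Defs
begin

text \<open>
  A bipartite graph with classes \<open>A\<close>, \<open>B\<close> of size \<open>n\<close> is a brace iff \<open>|X| + |Y| \<le> n - 2\<close> for all
  nonempty \<open>X \<subseteq> A\<close>, \<open>Y \<subseteq> B\<close> without an edge in between. In a minimal brace every edge \<open>xy\<close> is
  therefore the only edge between some \<open>P \<ni> x\<close> and \<open>R \<ni> y\<close> with \<open>|P| + |R| = n - 1\<close>. Uncrossing
  these pairs shows that the edges between noncubic vertices form a forest \<open>F\<close>. If the classes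
  have \<open>a, b \<ge> 2\<close> noncubic vertices, then the expansion of the cubic vertices of \<open>A\<close> yields
  \<open>n - a - b + 2 + t\<close> edges between cubic vertices with \<open>t \<ge> 0\<close>, and counting gives
  \<open>m = 5n - 2 - 2(a + b) - t + |F|\<close>. As \<open>|F| < a + b\<close>, the bound \<open>m < 5n - 10\<close> can only fail if
  \<open>a + b + t \<le> 7\<close>; there the pairs \<open>(P, R)\<close> leave only \<open>a = b = 2\<close>, \<open>F = {}\<close>, \<open>t = 0\<close>, which
  forces \<open>Q\<^sub>2\<^sub>n\<close>. With a single noncubic vertex in some class only \<open>n \<in> {5, 6}\<close> matters, and cubic
  braces are settled by \<open>m = 3n\<close>.
\<close>

section \<open>Hall's theorem\<close>

text \<open>With \<open>F\<close> the edges between noncubic vertices, the count turns m \<ge> 5n -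
  10 into |F| + 8 \<ge> 2(a + b) + t, and |F| \<le> a + b - 1 then gives the threshold 7. Up to
  exchanging the classes this leaves the pairs (2,2), (2,3), (2,4), (2,5), (3,3) and (3,4). The
  estimate t \<ge> 0 applies expansion to all cubic vertices of a class at once. That set must have
  at most n - 2 elements, which is why a class with fewer than two noncubic vertices needs a
  separate treatment. The upper bound and the case of equality are not proved one after the other.
  The single hypothesis m \<ge> 5n - 10 already determines the graph up to isomorphism; the excluded
  graphs are discarded, and the remaining ones have exactly 5n - 10 edges. Each isomorphism comes
  from a vertex bijection that preserves edges, together with a comparison of the numbers of
  edges.\<close>

lemma hall:
  fixes E :: "'a \<Rightarrow> 'b \<Rightarrow> bool"
  assumes "finite A" and "finite B"
    and "\<And>X. X \<subseteq> A \<Longrightarrow> card X \<le> card {b \<in> B. \<exists>x\<in>X. E x b}"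
  shows "\<exists>h. inj_on h A \<and> (\<forall>a\<in>A. h a \<in> B \<and> E a (h a))"
  using assms
proof (induction "card A" arbitrary: A B rule: less_induct)
  case less
  note fin = less.prems(1,2) and H = less.prems(3)
  show ?case
  proof (cases "A = {}")
    case True
    then show ?thesis by simp
  next
    case False
    show ?thesis
    \<comment> \<open>A tight proper nonempty set is matched into its own neighbourhood, and the
      rest outside of it. If there is none, every proper nonempty subset has a neighbour to spare,
      so an arbitrary edge can be fixed and its end in \<open>B\<close> removed.\<close>
    proof (cases "\<exists>X. X \<subset> A \<and> X \<noteq> {} \<and> card {b \<in> B. \<exists>x\<in>X. E x b} = card X")
      case True
      then obtain X where X: "X \<subset> A" "X \<noteq> {}" "card {b \<in> B. \<exists>x\<in>X. E x b} = card X"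
        by blast
      define C where "C = {b \<in> B. \<exists>x\<in>X. E x b}"
      have finX: "finite X" "finite C" "finite (B - C)" "finite (A - X)"
        using X(1) fin by (auto simp: C_def intro: finite_subset)
      have "card X < card A" using X(1) fin by (simp add: psubset_card_mono)
      moreover have "card Y \<le> card {b \<in> C. \<exists>x\<in>Y. E x b}" if "Y \<subseteq> X" for Y
      proof -
        have "{b \<in> C. \<exists>x\<in>Y. E x b} = {b \<in> B. \<exists>x\<in>Y. E x b}"
          using that by (auto simp: C_def)
        then show ?thesis using H[of Y] that X(1) by auto
      qed
      ultimately obtain h1 where h1: "inj_on h1 X" "\<forall>a\<in>X. h1 a \<in> C \<and> E a (h1 a)"
        using less.hyps[of X C] finX by blast
      have "card (A - X) < card A"
        using X fin by (intro psubset_card_mono) auto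
      moreover have "card Y \<le> card {b \<in> B - C. \<exists>x\<in>Y. E x b}" if Y: "Y \<subseteq> A - X" for Y
      proof -
        have finY: "finite Y" using Y fin by (meson finite_Diff finite_subset)
        have "card (Y \<union> X) \<le> card {b \<in> B. \<exists>x\<in>Y \<union> X. E x b}"
          using H[of "Y \<union> X"] Y X(1) by auto
        also have "{b \<in> B. \<exists>x\<in>Y \<union> X. E x b} = {b \<in> B - C. \<exists>x\<in>Y. E x b} \<union> C"
          by (auto simp: C_def)
        also have "card \<dots> \<le> card {b \<in> B - C. \<exists>x\<in>Y. E x b} + card C"
          by (rule card_Un_le)
        also have "card C = card X" using X(3) by (simp add: C_def)
        also have "card (Y \<union> X) = card Y + card X"
          using Y finY finX by (intro card_Un_disjoint) auto
        finally show ?thesis by simp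
      qed
      ultimately obtain h2 where h2: "inj_on h2 (A - X)" "\<forall>a\<in>A - X. h2 a \<in> B - C \<and> E a (h2 a)"
        using less.hyps[of "A - X" "B - C"] finX by blast
      define h where "h = (\<lambda>a. if a \<in> X then h1 a else h2 a)"
      have "inj_on h A"
        using h1 h2 unfolding inj_on_def h_def by (metis Diff_iff)
      moreover have "\<forall>a\<in>A. h a \<in> B \<and> E a (h a)"
        using h1 h2 unfolding h_def C_def by auto
      ultimately show ?thesis by blast
    next
      case noX: False
      obtain a where a: "a \<in> A" using False by blast
      have "card {a} \<le> card {b \<in> B. \<exists>x\<in>{a}. E x b}" using H[of "{a}"] a by blast
      then have "{b \<in> B. E a b} \<noteq> {}" by (auto simp del: Collect_empty_eq)
      then obtain b where b: "b \<in> B" "E a b" by blast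
      have "card (A - {a}) < card A" using a fin by (meson card_Diff1_less)
      moreover have "card Y \<le> card {c \<in> B - {b}. \<exists>x\<in>Y. E x c}" if Y: "Y \<subseteq> A - {a}" for Y
      proof (cases "Y = {}")
        case False
        have "Y \<subset> A" using Y a by blast
        then have "card Y < card {c \<in> B. \<exists>x\<in>Y. E x c}"
          using H[of Y] noX False by (metis le_neq_implies_less psubset_imp_subset)
        also have "\<dots> \<le> card (insert b {c \<in> B - {b}. \<exists>x\<in>Y. E x c})"
          using fin by (intro card_mono) auto
        also have "\<dots> \<le> Suc (card {c \<in> B - {b}. \<exists>x\<in>Y. E x c})"
          by (simp add: card_insert_le_m1 card_insert_if fin)
        finally show ?thesis by simp
      qed simp
      ultimately obtain h where h: "inj_on h (A - {a})" "\<forall>x\<in>A - {a}. h x \<in> B - {b} \<and> E x (h x)"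
        using less.hyps[of "A - {a}" "B - {b}"] fin by blast
      have "inj_on (h(a := b)) A"
        using h by (auto simp: inj_on_def)
      moreover have "\<forall>x\<in>A. (h(a := b)) x \<in> B \<and> E x ((h(a := b)) x)"
        using h b by auto
      ultimately show ?thesis by blast
    qed
  qed
qed

section \<open>Braces as expanding bipartite graphs\<close>

text \<open>Independent pairs, unlike neighbourhoods, make the condition symmetric in the classes.
  For classes of equal size it says |N(X)| \<ge> |X| + 2 whenever \<open>X\<close> is nonempty and
  N(X) is not all of \<open>B\<close>.\<close>

definition expanding :: "'a set \<Rightarrow> 'b set \<Rightarrow> ('a \<Rightarrow> 'b \<Rightarrow> bool) \<Rightarrow> bool" where
  "expanding A B E \<longleftrightarrow> (\<forall>X Y. X \<subseteq> A \<longrightarrow> Y \<subseteq> B \<longrightarrow> X \<noteq> {} \<longrightarrow> Y \<noteq> {} \<longrightarrow>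
     (\<forall>x\<in>X. \<forall>y\<in>Y. \<not> E x y) \<longrightarrow> card X + card Y + 2 \<le> card A)"

lemma expandingD:
  assumes "expanding A B E" "X \<subseteq> A" "Y \<subseteq> B" "X \<noteq> {}" "Y \<noteq> {}"
    and "\<And>x y. x \<in> X \<Longrightarrow> y \<in> Y \<Longrightarrow> \<not> E x y"
  shows "card X + card Y + 2 \<le> card A"
  by (rule assms(1)[unfolded expanding_def, rule_format, OF assms(2-6)])

definition adj :: "('v, 'e) graph \<Rightarrow> 'v \<Rightarrow> 'v \<Rightarrow> bool" where
  "adj G a b \<longleftrightarrow> (\<exists>e\<in>edges G. ends G e = {a, b})"

lemma adj_commute: "adj G a b \<longleftrightarrow> adj G b a"
  by (simp add: adj_def insert_commute)

definition meets :: "('v, 'e) graph \<Rightarrow> 'e set \<Rightarrow> 'v set \<Rightarrow> 'e set" where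
  "meets G M X = {e \<in> M. ends G e \<inter> X \<noteq> {}}"

text \<open>The colour classes are parameters, so that \<open>flip\<close> yields every result with
  the classes exchanged.\<close>

locale bip_graph =
  fixes G :: "('v, 'e) graph" and A B :: "'v set"
  assumes wf: "wf_graph G"
    and verts_eq: "A \<union> B = verts G"
    and disj: "A \<inter> B = {}"
    and edge_ends: "e \<in> edges G \<Longrightarrow> \<exists>a\<in>A. \<exists>b\<in>B. ends G e = {a, b}"
begin

lemma finite_classes: "finite A" "finite B"
  using wf verts_eq by (auto simp: wf_graph_def intro: finite_subset)

lemma finite_edges: "finite (edges G)"
  using wf by (simp add: wf_graph_def)

lemma flip: "bip_graph G B A"
proof
  show "wf_graph G" by (rule wf)
  show "B \<union> A = verts G" "B \<inter> A = {}" using verts_eq disj by auto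
  show "\<exists>a\<in>B. \<exists>b\<in>A. ends G e = {a, b}" if "e \<in> edges G" for e
    using edge_ends[OF that] by (metis insert_commute)
qed

text \<open>The matching edge at a vertex is unique, and no edge contains two vertices of one class,
  so \<open>g\<close> is a bijection from \<open>X\<close> onto these edges.\<close>

lemma card_meets:
  assumes M: "perfect_matching G M" and X: "X \<subseteq> A"
  shows "card (meets G M X) = card X"
proof -
  define g where "g v = (THE e. e \<in> M \<and> v \<in> ends G e)" for v
  have g: "g v \<in> M" "v \<in> ends G (g v)" "\<And>e. e \<in> M \<Longrightarrow> v \<in> ends G e \<Longrightarrow> e = g v"
    if "v \<in> X" for v
  proof -
    have ex: "\<exists>!e. e \<in> M \<and> v \<in> ends G e"
      using M X that verts_eq unfolding perfect_matching_def by blast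
    show "g v \<in> M" "v \<in> ends G (g v)"
      using theI'[OF ex] by (auto simp: g_def)
    show "\<And>e. e \<in> M \<Longrightarrow> v \<in> ends G e \<Longrightarrow> e = g v"
      using the1_equality[OF ex] by (auto simp: g_def)
  qed
  have "inj_on g X"
  proof (rule inj_onI)
    fix u v assume uv: "u \<in> X" "v \<in> X" "g u = g v"
    have "g u \<in> edges G" using g(1)[OF uv(1)] M by (auto simp: perfect_matching_def)
    then obtain a b where "a \<in> A" "b \<in> B" "ends G (g u) = {a, b}" using edge_ends by blast
    then show "u = v" using g(2)[OF uv(1)] g(2)[OF uv(2)] uv X disj by auto
  qed
  moreover have "g ` X = meets G M X"
    using g unfolding meets_def by blast
  ultimately show ?thesis using card_image by metis
qed

text \<open>An edge has one end in each class, so it lies in the cut iff exactly one of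
  \<open>X\<close> and \<open>Y\<close> contains an end of it. Hence the symmetric
  difference.\<close>

lemma cut_matching:
  assumes M: "perfect_matching G M" and X: "X \<subseteq> A" and Y: "Y \<subseteq> B"
  shows "M \<inter> cut G (X \<union> Y) = (meets G M X - meets G M Y) \<union> (meets G M Y - meets G M X)"
proof -
  have "card (ends G e \<inter> (X \<union> Y)) = 1 \<longleftrightarrow> (ends G e \<inter> X \<noteq> {}) \<noteq> (ends G e \<inter> Y \<noteq> {})"
    if "e \<in> M" for e
  proof -
    have "e \<in> edges G" using that M by (auto simp: perfect_matching_def)
    then obtain a b where ab: "a \<in> A" "b \<in> B" "ends G e = {a, b}" using edge_ends by blast
    have "a \<notin> Y" "b \<notin> X" "a \<noteq> b" using ab X Y disj by auto
    then show ?thesis using ab(3) by (cases "a \<in> X"; cases "b \<in> Y"; auto simp: Int_insert_left)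
  qed
  moreover have "M \<subseteq> edges G" using M by (simp add: perfect_matching_def)
  ultimately show ?thesis unfolding cut_def meets_def by blast
qed

end

section \<open>Braces are expanding, and conversely\<close>

lemma (in bip_graph) card_classes_eq:
  assumes M: "perfect_matching G M"
  shows "card A = card B"
proof -
  interpret f: bip_graph G B A by (rule flip)
  have "meets G M A = M" "meets G M B = M"
    using M edge_ends unfolding meets_def perfect_matching_def by fast+
  then show ?thesis using card_meets[OF M order_refl] f.card_meets[OF M order_refl] by simp
qed

text \<open>Cuts a pair violating expansion down to total size exactly n - 1, where it defines a
  tight cut; 2 \<le> k lets both parts stay nonempty.\<close>

lemma shrink_pair:
  assumes "finite X" "finite Y" "X \<noteq> {}" "Y \<noteq> {}" "2 \<le> k" "k \<le> card X + card Y"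
  obtains X' Y' where "X' \<subseteq> X" "Y' \<subseteq> Y" "X' \<noteq> {}" "Y' \<noteq> {}" "card X' + card Y' = k"
proof -
  have cX: "card X \<ge> 1" "card Y \<ge> 1" using assms by (simp_all add: Suc_le_eq card_gt_0_iff)
  define i where "i = min (card X) (k - 1)"
  have i: "1 \<le> i" "i \<le> card X" "1 \<le> k - i" "k - i \<le> card Y" "i \<le> k"
    using cX assms(5,6) by (auto simp: i_def min_def)
  obtain X' where X': "X' \<subseteq> X" "card X' = i" using i(2) by (metis obtain_subset_with_card_n)
  obtain Y' where Y': "Y' \<subseteq> Y" "card Y' = k - i" using i(4) by (metis obtain_subset_with_card_n)
  have "X' \<noteq> {}" "Y' \<noteq> {}" using X' Y' i by auto
  then show ?thesis using that[of X' Y'] X' Y' i by simp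
qed

text \<open>A violating pair, shrunk to \<open>X'\<close>, \<open>Y'\<close> of total size n - 1,
  has N(X') inside B - Y', a set of size |X'| + 1. Every perfect matching matches \<open>X'\<close>
  to all but one vertex of B - Y', so X' \<union> (B - Y') is the shore of a tight cut, and both
  shores have at least three vertices.\<close>

lemma (in bip_graph) expanding_if_brace:
  assumes br: "brace G"
  shows "card A = card B \<and> 1 \<le> card A \<and> expanding A B (adj G)"
proof -
  interpret f: bip_graph G B A by (rule flip)
  have mc: "matching_covered G" and nt: "\<And>X. X \<subseteq> verts G \<Longrightarrow> tight_cut G X \<Longrightarrow> trivial_cut G X"
    using br by (auto simp: brace_def)
  obtain e0 where e0: "e0 \<in> edges G" using mc by (auto simp: matching_covered_def)
  then obtain M0 where M0: "perfect_matching G M0" using mc by (auto simp: matching_covered_def)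
  have cAB: "card A = card B" by (rule card_classes_eq[OF M0])
  obtain a0 b0 where ab0: "a0 \<in> A" "b0 \<in> B" "ends G e0 = {a0, b0}" using edge_ends[OF e0] by blast
  have n1: "1 \<le> card A" using ab0 finite_classes by (auto simp: Suc_le_eq card_gt_0_iff)
  have sub: "meets G M X \<subseteq> meets G M Y"
    if M: "perfect_matching G M" and X: "X \<subseteq> A"
      and Y: "\<And>x y. x \<in> X \<Longrightarrow> y \<in> B - Y \<Longrightarrow> \<not> adj G x y" for M X Y
  proof
    fix e assume e: "e \<in> meets G M X"
    then have eG: "e \<in> edges G" using M by (auto simp: perfect_matching_def meets_def)
    then obtain a b where ab: "a \<in> A" "b \<in> B" "ends G e = {a, b}" using edge_ends by blast
    have "a \<in> X" using e ab X disj by (auto simp: meets_def)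
    moreover have "adj G a b" using eG ab by (auto simp: adj_def)
    ultimately have "b \<in> Y" using Y ab by blast
    then show "e \<in> meets G M Y" using e ab by (auto simp: meets_def)
  qed
  have "card X + card Y + 2 \<le> card A"
    if XY: "X \<subseteq> A" "Y \<subseteq> B" "X \<noteq> {}" "Y \<noteq> {}" "\<forall>x\<in>X. \<forall>y\<in>Y. \<not> adj G x y" for X Y
  proof (rule ccontr)
    assume neg: "\<not> ?thesis"
    have fXY: "finite X" "finite Y" using XY finite_classes by (auto intro: finite_subset)
    show False
    proof (cases "3 \<le> card A")
      case True
      obtain X' Y' where s: "X' \<subseteq> X" "Y' \<subseteq> Y" "X' \<noteq> {}" "Y' \<noteq> {}" "card X' + card Y' = card A - 1"
        by (rule shrink_pair[of X Y "card A - 1"]) (use fXY XY True neg in auto)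
      have f': "finite X'" "finite Y'" using s fXY by (auto intro: finite_subset)
      have sA: "X' \<subseteq> A" "Y' \<subseteq> B" using s XY by auto
      define S where "S = X' \<union> (B - Y')"
      have cS: "card (B - Y') = card X' + 1"
        using s sA f' cAB True by (subst card_Diff_subset) auto
      have "card (M \<inter> cut G S) = 1" if M: "perfect_matching G M" for M
      proof -
        have sm: "meets G M X' \<subseteq> meets G M (B - Y')"
          by (rule sub[OF M]) (use s XY in blast)+
        have fm: "finite (meets G M X')"
          using M finite_edges by (auto simp: perfect_matching_def meets_def intro: finite_subset)
        have "M \<inter> cut G S = meets G M (B - Y') - meets G M X'"
          unfolding S_def using cut_matching[OF M, of X' "B - Y'"] sA sm by auto
        then have "card (M \<inter> cut G S) = card (meets G M (B - Y')) - card (meets G M X')"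
          using sm fm by (simp add: card_Diff_subset)
        also have "\<dots> = card (B - Y') - card X'"
          using card_meets[OF M, of X'] f.card_meets[OF M, of "B - Y'"] sA by simp
        finally show ?thesis using cS by simp
      qed
      then have "tight_cut G S" by (simp add: tight_cut_def)
      moreover have "S \<subseteq> verts G" using sA verts_eq by (auto simp: S_def)
      ultimately have tr: "trivial_cut G S" using nt by blast
      have "card S = card X' + card (B - Y')"
        unfolding S_def using f' finite_classes sA disj by (intro card_Un_disjoint) auto
      moreover have cX': "card X' \<ge> 1" "card Y' \<ge> 1" using s f' by (auto simp: Suc_le_eq card_gt_0_iff)
      ultimately have "card S \<ge> 3" using cS by simp
      moreover have "verts G - S = (A - X') \<union> Y'"
        using sA disj verts_eq by (auto simp: S_def)
      moreover have "card ((A - X') \<union> Y') = card (A - X') + card Y'"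
        using f' finite_classes sA disj by (intro card_Un_disjoint) auto
      moreover have "card (A - X') = card A - card X'" using f' sA by (intro card_Diff_subset) auto
      ultimately show False using tr cX' s(5) True
        by (auto simp: trivial_cut_def is_singleton_altdef)
    next
      \<comment> \<open>For n \<le> 2 the total n - 1 cannot be split into two nonempty
        parts.\<close>
      case small: False
      obtain x y where xy: "x \<in> X" "y \<in> Y" using XY by blast
      have xy': "x \<in> A" "y \<in> B" "\<not> adj G x y" using xy XY by auto
      have adj0: "adj G a0 b0" using e0 ab0 by (auto simp: adj_def)
      show False
      proof (cases "card A = 1")
        case True
        then have "A = {x}" "B = {y}" using xy' cAB by (metis card_1_singletonE singletonD)+
        then show False using ab0 xy' adj0 by auto
      next
        case False
        then have two: "card A = 2" "card B = 2" using small n1 cAB by linarith+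
        have other: "\<exists>w'. W = {w, w'} \<and> w' \<noteq> w" if "card W = 2" "w \<in> W" for w and W :: "'v set"
          using that by (auto simp: card_2_iff)
        obtain x' where x': "A = {x, x'}" "x' \<noteq> x" using other[OF two(1) xy'(1)] by blast
        obtain y' where y': "B = {y, y'}" "y' \<noteq> y" using other[OF two(2) xy'(2)] by blast
        \<comment> \<open>As \<open>x\<close> and \<open>y\<close> are not adjacent,
          \<open>x\<close> can only be matched to \<open>y'\<close>, so no perfect matching contains
          an edge between \<open>x'\<close> and \<open>y'\<close>. Then \<open>x\<close> and
          \<open>y'\<close> are separated from \<open>y\<close>, against connectedness.\<close>
        have no: "\<not> adj G x' y'"
        proof
          assume "adj G x' y'"
          then obtain e where e: "e \<in> edges G" "ends G e = {x', y'}" by (auto simp: adj_def)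
          then obtain M where M: "perfect_matching G M" "e \<in> M"
            using mc by (auto simp: matching_covered_def)
          have "x \<in> verts G" using xy' verts_eq by auto
          then obtain e1 where e1: "e1 \<in> M" "x \<in> ends G e1" using M by (auto simp: perfect_matching_def)
          then have e1G: "e1 \<in> edges G" using M by (auto simp: perfect_matching_def)
          then obtain a b where ab: "a \<in> A" "b \<in> B" "ends G e1 = {a, b}" using edge_ends by blast
          have "x = a \<or> x = b" using e1(2) ab(3) by simp
          then have ax: "a = x" using ab(2) xy'(1) disj by blast
          have "adj G a b" using e1G ab(3) by (auto simp: adj_def)
          then have "b \<noteq> y" using xy'(3) ax by blast
          then have "y' \<in> ends G e1" using ab(2,3) y'(1) by simp
          moreover have "y' \<in> ends G e" using e(2) by simp
          moreover have "y' \<in> verts G" using y'(1) verts_eq by blast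
          ultimately have "e = e1" using M e1(1) unfolding perfect_matching_def by blast
          then have "x = x' \<or> x = y'" using e e1 by simp
          then show False using x' y' xy'(1) disj by blast
        qed
        have cl: "v \<in> {x, y'}" if "(x, v) \<in> (adj_rel G)\<^sup>*" for v
          using that
        proof (induction rule: rtrancl_induct)
          case (step u v)
          then have uv: "adj G u v" by (auto simp: adj_rel_def adj_def)
          then obtain e where e: "e \<in> edges G" "ends G e = {u, v}" by (auto simp: adj_def)
          obtain a b where ab: "a \<in> A" "b \<in> B" "ends G e = {a, b}" using edge_ends[OF e(1)] by blast
          have "u = a \<and> v = b \<or> u = b \<and> v = a" using e ab by (auto simp: doubleton_eq_iff)
          then have AB: "u \<in> A \<and> v \<in> B \<or> u \<in> B \<and> v \<in> A" using ab by auto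
          have "u = x \<or> u = y'" using step.IH by simp
          then show ?case
          proof
            assume u: "u = x"
            then have "v \<in> B" using AB xy'(1) disj by blast
            then show ?thesis using y'(1) uv u xy'(3) by blast
          next
            assume u: "u = y'"
            then have "v \<in> A" using AB y'(1) disj by blast
            then show ?thesis using x'(1) uv u no adj_commute[of G x' y'] by blast
          qed
        qed simp
        have "(x, y) \<in> (adj_rel G)\<^sup>*"
          using mc xy' verts_eq by (auto simp: matching_covered_def connected_graph_def)
        then have "y \<in> {x, y'}" by (rule cl)
        then show False using y'(2) xy' disj by blast
      qed
    qed
  qed
  then show ?thesis using cAB n1 unfolding expanding_def by blast
qed

text \<open>Hall's condition for A - {a} and B - {b}: losing \<open>b\<close> costs a set at most
  one neighbour, which the surplus of two absorbs. As matchings consist of abstract edges, an edge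
  \<open>k x\<close> is then chosen for each matched pair, and \<open>e\<close> itself at
  \<open>a\<close>.\<close>

lemma (in bip_graph) perfect_matching_through_edge:
  assumes c: "card A = card B" and ex: "expanding A B (adj G)" and e: "e \<in> edges G"
  shows "\<exists>M. perfect_matching G M \<and> e \<in> M"
proof -
  obtain a b where ab: "a \<in> A" "b \<in> B" "ends G e = {a, b}" using edge_ends[OF e] by blast
  have hallc: "card X \<le> card {y \<in> B - {b}. \<exists>x\<in>X. adj G x y}" if X: "X \<subseteq> A - {a}" for X
  proof (rule ccontr)
    define C where "C = {y \<in> B - {b}. \<exists>x\<in>X. adj G x y}"
    assume "\<not> ?thesis"
    then have neg: "card C < card X" by (simp add: C_def)
    have cX: "card X \<le> card A - 1" using X finite_classes ab card_mono[of "A - {a}" X] by simp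
    have fC: "finite C" "C \<subseteq> B - {b}" using finite_classes by (auto simp: C_def)
    have "card (B - {b} - C) = card B - 1 - card C"
      using fC ab finite_classes by (simp add: card_Diff_subset)
    then have g: "card X + card (B - {b} - C) \<ge> card A" "card (B - {b} - C) > 0"
      using neg cX c by linarith+
    have "card X + card (B - {b} - C) + 2 \<le> card A"
    proof (rule expandingD[OF ex])
      show "X \<noteq> {}" using neg by auto
      show "B - {b} - C \<noteq> {}" using g(2) by (metis card.empty less_irrefl)
    qed (use X in \<open>auto simp: C_def\<close>)
    then show False using g by simp
  qed
  obtain h where h: "inj_on h (A - {a})" "\<And>x. x \<in> A - {a} \<Longrightarrow> h x \<in> B - {b} \<and> adj G x (h x)"
    using hall[of "A - {a}" "B - {b}" "adj G"] hallc finite_classes by auto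
  have "\<exists>k. \<forall>x\<in>A - {a}. k x \<in> edges G \<and> ends G (k x) = {x, h x}"
    using h(2) unfolding adj_def by (intro bchoice) auto
  then obtain k where k: "\<And>x. x \<in> A - {a} \<Longrightarrow> k x \<in> edges G \<and> ends G (k x) = {x, h x}" by blast
  define k' where "k' = k(a := e)"
  define h' where "h' = h(a := b)"
  have k': "k' x \<in> edges G" "ends G (k' x) = {x, h' x}" if "x \<in> A" for x
    using k[of x] that e ab by (auto simp: k'_def h'_def)
  have h': "inj_on h' A" "h' ` A \<subseteq> B"
    using h ab by (auto simp: h'_def inj_on_def)
  have hB: "h' ` A = B"
    using card_subset_eq[OF finite_classes(2) h'(2)] card_image[OF h'(1)] c by simp
  have "perfect_matching G (k' ` A)"
    unfolding perfect_matching_def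
  proof (intro conjI ballI)
    show "k' ` A \<subseteq> edges G" using k' by auto
    fix v assume "v \<in> verts G"
    then consider "v \<in> A" | "v \<in> B" using verts_eq by auto
    then show "\<exists>!e. e \<in> k' ` A \<and> v \<in> ends G e"
    proof cases
      case 1
      show ?thesis
      proof (rule ex1I[of _ "k' v"])
        show "k' v \<in> k' ` A \<and> v \<in> ends G (k' v)" using 1 k' by auto
        fix e' assume "e' \<in> k' ` A \<and> v \<in> ends G e'"
        then obtain x where "x \<in> A" "e' = k' x" "v \<in> {x, h' x}" using k' by auto
        then show "e' = k' v" using 1 h' disj by auto
      qed
    next
      case 2
      then obtain x where x: "x \<in> A" "v = h' x" using hB by auto
      show ?thesis
      proof (rule ex1I[of _ "k' x"])
        show "k' x \<in> k' ` A \<and> v \<in> ends G (k' x)" using x k' by auto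
        fix e' assume "e' \<in> k' ` A \<and> v \<in> ends G e'"
        then obtain x' where "x' \<in> A" "e' = k' x'" "v \<in> {x', h' x'}" using k' by auto
        then show "e' = k' x" using 2 x h' disj by (auto simp: inj_on_def)
      qed
    qed
  qed
  moreover have "e \<in> k' ` A" using ab by (auto simp: k'_def)
  ultimately show ?thesis by blast
qed

text \<open>No edge leaves the reachable part, so (X, B - Y) and (A - X, Y) are independent. If all
  four sets were nonempty, expansion would give both |Y| \<ge> |X| + 2 and |X| \<ge> |Y| +
  2.\<close>

lemma (in bip_graph) reachable_if_expanding:
  assumes c: "card A = card B" and ex: "expanding A B (adj G)" and a: "a \<in> A" and v: "v \<in> verts G"
  shows "(a, v) \<in> (adj_rel G)\<^sup>*"
proof -
  define X where "X = {x \<in> A. (a, x) \<in> (adj_rel G)\<^sup>*}"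
  define Y where "Y = {y \<in> B. (a, y) \<in> (adj_rel G)\<^sup>*}"
  have st: "(a, w) \<in> (adj_rel G)\<^sup>*" if "(a, u) \<in> (adj_rel G)\<^sup>*" "adj G u w" for u w
  proof -
    have "(u, w) \<in> adj_rel G" using that(2) by (simp add: adj_def adj_rel_def)
    then show ?thesis using that(1) by (rule rtrancl_into_rtrancl[rotated])
  qed
  have fX: "finite X" "finite Y" "X \<subseteq> A" "Y \<subseteq> B" using finite_classes by (auto simp: X_def Y_def)
  have aX: "a \<in> X" using a by (auto simp: X_def)
  have 1: "\<not> adj G x y" if "x \<in> X" "y \<in> B - Y" for x y
    using st[of x y] that unfolding X_def Y_def by blast
  have 2: "\<not> adj G x y" if "x \<in> A - X" "y \<in> Y" for x y
    using st[of y x] that adj_commute[of G x y] unfolding X_def Y_def by blast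
  have cB: "card (B - Y) = card B - card Y" "card (A - X) = card A - card X"
    using fX by (auto intro: card_Diff_subset)
  have le: "card Y \<le> card B" "card X \<le> card A" using fX finite_classes by (auto intro: card_mono)
  have i1: "card X + card (B - Y) + 2 \<le> card A" if "Y \<noteq> B"
    using that fX aX by (intro expandingD[OF ex _ _ _ _ 1]) auto
  have i2: "card (A - X) + card Y + 2 \<le> card A" if "X \<noteq> A" "Y \<noteq> {}"
    using that fX by (intro expandingD[OF ex _ _ _ _ 2]) auto
  have "Y = B"
  proof (rule ccontr)
    assume Y: "Y \<noteq> B"
    then have "card Y \<ge> card X + 2" using i1 cB le c by linarith
    moreover from this have "Y \<noteq> {}" by auto
    ultimately show False using i2 cB le c by (cases "X = A") auto
  qed
  moreover have "X = A"
  proof (rule ccontr)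
    assume X: "X \<noteq> A"
    have "card A > 0" using a finite_classes by (auto simp: card_gt_0_iff)
    then have "Y \<noteq> {}" using \<open>Y = B\<close> c by auto
    then show False using i2 X \<open>Y = B\<close> c by auto
  qed
  ultimately have "v \<in> X \<or> v \<in> Y" using v verts_eq by blast
  then show ?thesis unfolding X_def Y_def by blast
qed

text \<open>In a perfect matching the edges at S \<inter> B outnumber those at S \<inter> A by one,
  and their symmetric difference has one element. So the edges at S \<inter> A all end in S \<inter>
  B. As every edge lies in a perfect matching, S \<inter> A and B - S are independent; their total
  size n - 1 is too large unless one is empty.\<close>

lemma (in bip_graph) tight_cut_shore:
  assumes ex: "expanding A B (adj G)"
    and mc: "\<And>e. e \<in> edges G \<Longrightarrow> \<exists>M. perfect_matching G M \<and> e \<in> M"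
    and S: "S \<subseteq> verts G" "tight_cut G S" and c: "card A = card B"
    and cS: "card (S \<inter> B) = card (S \<inter> A) + 1"
  shows "trivial_cut G S"
proof (rule ccontr)
  interpret f: bip_graph G B A by (rule flip)
  assume nt: "\<not> trivial_cut G S"
  have fS: "finite (S \<inter> A)" "finite (S \<inter> B)" using finite_classes by auto
  have Seq: "(S \<inter> A) \<union> (S \<inter> B) = S" using S(1) verts_eq by blast
  have "(S \<inter> A) \<inter> (S \<inter> B) = {}" using disj by blast
  then have cc: "card S = card (S \<inter> A) + card (S \<inter> B)"
    using card_Un_disjoint[OF fS] Seq by simp
  have ind: "\<not> adj G x y" if "x \<in> S \<inter> A" "y \<in> B - (S \<inter> B)" for x y
  proof
    assume "adj G x y"
    then obtain e where e: "e \<in> edges G" "ends G e = {x, y}" by (auto simp: adj_def)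
    then obtain M where M: "perfect_matching G M" "e \<in> M" using mc by blast
    let ?a = "meets G M (S \<inter> A)" and ?b = "meets G M (S \<inter> B)"
    have fm: "finite ?a" "finite ?b"
      using M finite_edges by (auto simp: perfect_matching_def meets_def intro: finite_subset)
    have "M \<inter> cut G S = (?a - ?b) \<union> (?b - ?a)"
      using cut_matching[OF M(1), of "S \<inter> A" "S \<inter> B"] by (simp add: Seq)
    moreover have "card (M \<inter> cut G S) = 1" using S M by (auto simp: tight_cut_def)
    moreover have "card ((?a - ?b) \<union> (?b - ?a)) = card (?a - ?b) + card (?b - ?a)"
      using fm by (intro card_Un_disjoint) auto
    ultimately have one: "card (?a - ?b) + card (?b - ?a) = 1" by simp
    have "card ?b = card ?a + 1"
      using card_meets[OF M(1), of "S \<inter> A"] f.card_meets[OF M(1), of "S \<inter> B"] cS by auto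
    moreover have "card ?a = card (?a - ?b) + card (?a \<inter> ?b)" "card ?b = card (?b - ?a) + card (?a \<inter> ?b)"
      using card_Int_Diff[OF fm(1), of ?b] card_Int_Diff[OF fm(2), of ?a] by (simp_all add: Int_commute)
    ultimately have "card (?a - ?b) = 0" using one by linarith
    then have "?a \<subseteq> ?b" using fm by auto
    moreover have "e \<in> ?a" using e M(2) that(1) by (simp add: meets_def)
    ultimately have "ends G e \<inter> (S \<inter> B) \<noteq> {}" by (auto simp: meets_def)
    then show False using e(2) that disj by auto
  qed
  have "S \<inter> A \<noteq> {}"
  proof
    assume "S \<inter> A = {}"
    then have "card S = 1" using cc cS by simp
    then show False using nt by (simp add: trivial_cut_def is_singleton_altdef)
  qed
  moreover have "B - S \<inter> B \<noteq> {}"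
  proof
    assume "B - S \<inter> B = {}"
    then have SB: "S \<inter> B = B" by blast
    then have "card (S \<inter> A) + 1 = card A" using cS c SB by simp
    moreover have "verts G - S = A - S \<inter> A" using SB verts_eq by blast
    moreover have "card (A - S \<inter> A) = card A - card (S \<inter> A)" using fS by (intro card_Diff_subset) auto
    ultimately have "card (verts G - S) = 1" by simp
    then show False using nt by (simp add: trivial_cut_def is_singleton_altdef)
  qed
  ultimately have "card (S \<inter> A) + card (B - S \<inter> B) + 2 \<le> card A"
    using ind by (intro expandingD[OF ex]) auto
  moreover have "card (B - S \<inter> B) = card B - card (S \<inter> B)" using fS by (intro card_Diff_subset) auto
  ultimately show False using cS c by linarith
qed

lemma expanding_flip:
  assumes "expanding A B E" "card A = card B"
  shows "expanding B A (\<lambda>y x. E x y)"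
  using assms unfolding expanding_def by (metis add.commute)

text \<open>For a tight cut, any single perfect matching shows that the shore contains exactly one
  vertex more of one class than of the other, so \<open>tight_cut_shore\<close> applies directly or
  after \<open>flip\<close>.\<close>

lemma (in bip_graph) brace_if_expanding:
  assumes c: "card A = card B" and n1: "1 \<le> card A" and ex: "expanding A B (adj G)"
    and ne: "edges G \<noteq> {}"
  shows "brace G"
proof -
  interpret f: bip_graph G B A by (rule flip)
  have exf: "expanding B A (adj G)"
    using expanding_flip[OF ex c] by (simp add: adj_commute)
  have pm: "\<exists>M. perfect_matching G M \<and> e \<in> M" if "e \<in> edges G" for e
    by (rule perfect_matching_through_edge[OF c ex that])
  have "connected_graph G"
    unfolding connected_graph_def
  proof (intro conjI ballI)
    show "verts G \<noteq> {}" using n1 verts_eq by auto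
    fix u v assume "u \<in> verts G" "v \<in> verts G"
    then show "(u, v) \<in> (adj_rel G)\<^sup>*"
      using reachable_if_expanding[OF c ex] f.reachable_if_expanding[OF c[symmetric] exf] verts_eq
      by blast
  qed
  moreover have "bipartite G"
    unfolding bipartite_def
    by (rule exI[of _ A], rule exI[of _ B]) (simp add: verts_eq disj edge_ends)
  moreover have "trivial_cut G S" if S: "S \<subseteq> verts G" "tight_cut G S" for S
  proof -
    obtain M where M: "perfect_matching G M" using pm ne by blast
    let ?a = "meets G M (S \<inter> A)" and ?b = "meets G M (S \<inter> B)"
    have fm: "finite ?a" "finite ?b"
      using M finite_edges by (auto simp: perfect_matching_def meets_def intro: finite_subset)
    have Seq: "(S \<inter> A) \<union> (S \<inter> B) = S" using S(1) verts_eq by blast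
    have "M \<inter> cut G S = (?a - ?b) \<union> (?b - ?a)"
      using cut_matching[OF M, of "S \<inter> A" "S \<inter> B"] by (simp add: Seq)
    moreover have "card (M \<inter> cut G S) = 1" using S M by (auto simp: tight_cut_def)
    moreover have "card ((?a - ?b) \<union> (?b - ?a)) = card (?a - ?b) + card (?b - ?a)"
      using fm by (intro card_Un_disjoint) auto
    ultimately have "card (?a - ?b) + card (?b - ?a) = 1" by simp
    moreover have "card ?a = card (?a - ?b) + card (?a \<inter> ?b)" "card ?b = card (?b - ?a) + card (?a \<inter> ?b)"
      using card_Int_Diff[OF fm(1), of ?b] card_Int_Diff[OF fm(2), of ?a] by (simp_all add: Int_commute)
    ultimately have "card ?b = card ?a + 1 \<or> card ?a = card ?b + 1" by arith
    then have "card (S \<inter> B) = card (S \<inter> A) + 1 \<or> card (S \<inter> A) = card (S \<inter> B) + 1"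
      using card_meets[OF M, of "S \<inter> A"] f.card_meets[OF M, of "S \<inter> B"] by auto
    then show ?thesis
    proof
      assume h: "card (S \<inter> B) = card (S \<inter> A) + 1"
      show ?thesis by (rule tight_cut_shore[OF ex _ S c h]) (rule pm)
    next
      assume h: "card (S \<inter> A) = card (S \<inter> B) + 1"
      show ?thesis by (rule f.tight_cut_shore[OF exf _ S c[symmetric] h]) (rule pm)
    qed
  qed
  ultimately show ?thesis
    using wf ne pm unfolding brace_def matching_covered_def by blast
qed


section \<open>Minimality expressed by witnesses\<close>

lemma expanding_cong:
  assumes "\<And>a b. a \<in> A \<Longrightarrow> b \<in> B \<Longrightarrow> E a b \<longleftrightarrow> E' a b"
  shows "expanding A B E \<longleftrightarrow> expanding A B E'"
proof -
  have "(\<forall>x\<in>X. \<forall>y\<in>Y. \<not> E x y) \<longleftrightarrow> (\<forall>x\<in>X. \<forall>y\<in>Y. \<not> E' x y)" if "X \<subseteq> A" "Y \<subseteq> B" for X Y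
    using assms that by blast
  then show ?thesis unfolding expanding_def by metis
qed

text \<open>Deleting one of two parallel edges leaves \<open>adj\<close> unchanged, so minimality
  excludes them. Deleting an edge then removes exactly one pair from the relation, which must
  destroy expansion.\<close>

lemma (in bip_graph) minimal_brace_expanding:
  assumes "minimal_brace G"
  shows "card A = card B" "1 \<le> card A" "expanding A B (adj G)" "inj_on (ends G) (edges G)"
    and "\<And>x y. x \<in> A \<Longrightarrow> y \<in> B \<Longrightarrow> adj G x y \<Longrightarrow>
      \<not> expanding A B (\<lambda>a b. adj G a b \<and> \<not> (a = x \<and> b = y))"
proof -
  have br: "brace G" and min: "\<And>e. e \<in> edges G \<Longrightarrow> \<not> brace (del_edge G e)"
    using assms by (auto simp: minimal_brace_def)
  show c: "card A = card B" and n1: "1 \<le> card A" and ex: "expanding A B (adj G)"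
    using expanding_if_brace[OF br] by auto
  have nex: "\<not> expanding A B (adj (del_edge G e))" if e: "e \<in> edges G" for e
  proof
    assume H: "expanding A B (adj (del_edge G e))"
    interpret H: bip_graph "del_edge G e" A B
    proof
      show "wf_graph (del_edge G e)" using wf by (auto simp: wf_graph_def del_edge_def)
      show "A \<union> B = verts (del_edge G e)" using verts_eq by (simp add: del_edge_def)
      show "A \<inter> B = {}" by (rule disj)
      show "\<exists>a\<in>A. \<exists>b\<in>B. ends (del_edge G e) e' = {a, b}" if "e' \<in> edges (del_edge G e)" for e'
        using edge_ends[of e'] that by (simp add: del_edge_def)
    qed
    have "edges (del_edge G e) \<noteq> {}"
    proof
      assume none: "edges (del_edge G e) = {}"
      have "card A + card B + 2 \<le> card A"
        using c n1 none by (intro expandingD[OF H]) (auto simp: adj_def)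
      then show False by simp
    qed
    then show False using H.brace_if_expanding[OF c n1 H] min[OF e] by simp
  qed
  show inj: "inj_on (ends G) (edges G)"
  proof (rule inj_onI, rule ccontr)
    fix e e' assume e: "e \<in> edges G" "e' \<in> edges G" "ends G e = ends G e'" "e \<noteq> e'"
    have "adj (del_edge G e) = adj G"
    proof (intro ext iffI)
      fix a b assume "adj G a b"
      then obtain f where "f \<in> edges G" "ends G f = {a, b}" by (auto simp: adj_def)
      then have "(if f = e then e' else f) \<in> edges G - {e}" "ends G (if f = e then e' else f) = {a, b}"
        using e by auto
      then show "adj (del_edge G e) a b" unfolding adj_def del_edge_def by auto
    qed (auto simp: adj_def del_edge_def)
    then show False using nex[OF e(1)] ex by simp
  qed
  fix x y assume xy: "x \<in> A" "y \<in> B" "adj G x y"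
  then obtain e where e: "e \<in> edges G" "ends G e = {x, y}" by (auto simp: adj_def)
  have "adj (del_edge G e) a b \<longleftrightarrow> adj G a b \<and> \<not> (a = x \<and> b = y)" if "a \<in> A" "b \<in> B" for a b
  proof -
    have "{a, b} = {x, y} \<longleftrightarrow> a = x \<and> b = y" using that xy disj by (auto simp: doubleton_eq_iff)
    moreover have "f = e \<longleftrightarrow> ends G f = {x, y}" if "f \<in> edges G" for f
      using inj e that by (auto simp: inj_on_def)
    ultimately show ?thesis unfolding adj_def del_edge_def by auto
  qed
  then have "expanding A B (adj (del_edge G e)) \<longleftrightarrow> expanding A B (\<lambda>a b. adj G a b \<and> \<not> (a = x \<and> b = y))"
    by (rule expanding_cong)
  then show "\<not> expanding A B (\<lambda>a b. adj G a b \<and> \<not> (a = x \<and> b = y))"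
    using nex[OF e(1)] by simp
qed

text \<open>Certifies that the edge between \<open>x\<close> and \<open>y\<close> is indispensable:
  the total size is one more than an independent pair may have, and no other edge joins the two
  sets.\<close>

definition witness :: "'a set \<Rightarrow> 'b set \<Rightarrow> ('a \<Rightarrow> 'b \<Rightarrow> bool) \<Rightarrow> 'a \<Rightarrow> 'b \<Rightarrow> 'a set \<Rightarrow> 'b set \<Rightarrow> bool" where
  "witness A B E x y P R \<longleftrightarrow> P \<subseteq> A \<and> R \<subseteq> B \<and> x \<in> P \<and> y \<in> R \<and> card P + card R + 1 = card A \<and>
     (\<forall>p\<in>P. \<forall>r\<in>R. E p r \<longrightarrow> p = x \<and> r = y)"

text \<open>A pair that violates expansion after the deletion spans the deleted edge. Removing
  \<open>x\<close> or \<open>y\<close> from it leaves an independent pair of the original graph, so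
  its total size, at least n - 1 by the violation, is no larger. If the pair is just the two ends, 3
  \<le> n suffices.\<close>

lemma witness_if_not_expanding:
  assumes fin: "finite A" "finite B" and n3: "3 \<le> card A" and ex: "expanding A B E"
    and nex: "\<not> expanding A B (\<lambda>a b. E a b \<and> \<not> (a = x \<and> b = y))"
  shows "\<exists>P R. witness A B E x y P R"
proof -
  obtain X Y where XY: "X \<subseteq> A" "Y \<subseteq> B" "X \<noteq> {}" "Y \<noteq> {}" "\<not> card X + card Y + 2 \<le> card A"
    and no': "\<forall>a\<in>X. \<forall>b\<in>Y. \<not> (E a b \<and> \<not> (a = x \<and> b = y))"
    using nex unfolding expanding_def not_all not_imp by (elim exE conjE)
  have no: "a = x \<and> b = y" if "a \<in> X" "b \<in> Y" "E a b" for a b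
    using no'[rule_format, OF that(1,2)] that(3) by simp
  have fXY: "finite X" "finite Y" using XY fin by (auto intro: finite_subset)
  have "\<not> (\<forall>a\<in>X. \<forall>b\<in>Y. \<not> E a b)" using expandingD[OF ex XY(1-4)] XY(5) by blast
  then have xy: "x \<in> X" "y \<in> Y" "E x y" using no by blast+
  have "card X + card Y + 1 \<le> card A"
  proof (cases "X = {x}")
    case True
    show ?thesis
    proof (cases "Y = {y}")
      case False
      have "card X + card (Y - {y}) + 2 \<le> card A"
        using XY False xy no by (intro expandingD[OF ex]) blast+
      then show ?thesis using xy fXY by (simp add: card_gt_0_iff)
    qed (use True n3 in simp)
  next
    case False
    have "card (X - {x}) + card Y + 2 \<le> card A"
      using XY False xy no by (intro expandingD[OF ex]) blast+
    then show ?thesis using xy fXY by (simp add: card_gt_0_iff)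
  qed
  then have "card X + card Y + 1 = card A" using XY(5) by linarith
  moreover have "\<forall>p\<in>X. \<forall>r\<in>Y. E p r \<longrightarrow> p = x \<and> r = y" by (intro ballI impI no)
  ultimately have "witness A B E x y X Y" unfolding witness_def using XY(1,2) xy(1,2) by (intro conjI)
  then show ?thesis by blast
qed

section \<open>Minimal expanding bipartite graphs\<close>

definition noncubics :: "'a set \<Rightarrow> ('a \<Rightarrow> 'b \<Rightarrow> bool) \<Rightarrow> 'a set" where
  "noncubics A E = {x \<in> A. 4 \<le> card {y. E x y}}"

text \<open>Expanding graphs with n \<ge> 3 have minimum degree at least three, so a degree below
  four is degree three.\<close>

definition cubics :: "'a set \<Rightarrow> ('a \<Rightarrow> 'b \<Rightarrow> bool) \<Rightarrow> 'a set" where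
  "cubics A E = {x \<in> A. card {y. E x y} < 4}"

definition edge_pairs :: "('a \<Rightarrow> 'b \<Rightarrow> bool) \<Rightarrow> 'a set \<Rightarrow> 'b set \<Rightarrow> ('a \<times> 'b) set" where
  "edge_pairs E X Y = {(x, y). x \<in> X \<and> y \<in> Y \<and> E x y}"

lemma finite_edge_pairs [simp]: "finite X \<Longrightarrow> finite Y \<Longrightarrow> finite (edge_pairs E X Y)"
  by (rule finite_subset[of _ "X \<times> Y"]) (auto simp: edge_pairs_def)

lemma card_edge_pairs_flip: "card (edge_pairs (\<lambda>y x. E x y) Y X) = card (edge_pairs E X Y)"
proof -
  have "edge_pairs (\<lambda>y x. E x y) Y X = prod.swap ` edge_pairs E X Y" by (auto simp: edge_pairs_def)
  then show ?thesis by (simp add: card_image)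
qed

lemma card_edge_pairs:
  assumes "finite X" "finite Y"
  shows "card (edge_pairs E X Y) = (\<Sum>x\<in>X. card ({y. E x y} \<inter> Y))"
proof -
  have "edge_pairs E X Y = (SIGMA x:X. {y. E x y} \<inter> Y)" by (auto simp: edge_pairs_def)
  then show ?thesis using assms by simp
qed

lemma card_edge_pairs_Un_left:
  assumes "finite X" "finite X'" "finite Y" "X \<inter> X' = {}"
  shows "card (edge_pairs E (X \<union> X') Y) = card (edge_pairs E X Y) + card (edge_pairs E X' Y)"
  using assms by (simp add: card_edge_pairs sum.union_disjoint)

lemma card_edge_pairs_Un_right:
  assumes "finite X" "finite Y'" "finite Y" "Y \<inter> Y' = {}"
  shows "card (edge_pairs E X (Y \<union> Y')) = card (edge_pairs E X Y) + card (edge_pairs E X Y')"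
  using card_edge_pairs_Un_left[of Y Y' X "\<lambda>y x. E x y"] assms by (simp add: card_edge_pairs_flip[of E])

lemma witness_flip:
  assumes "witness A B E x y P R" "card A = card B"
  shows "witness B A (\<lambda>y x. E x y) y x R P"
  using assms unfolding witness_def by (simp add: add.commute)

text \<open>The last assumption says that \<open>F\<close> is a forest, avoiding the notion of a cycle.\<close>

lemma card_forest:
  assumes "finite F" "F \<noteq> {}" "F \<subseteq> X \<times> Y" "finite X" "finite Y"
    and "\<And>F'. F' \<subseteq> F \<Longrightarrow> F' \<noteq> {} \<Longrightarrow>
      \<exists>x y. (x, y) \<in> F' \<and> ((\<forall>y'. (x, y') \<in> F' \<longrightarrow> y' = y) \<or> (\<forall>x'. (x', y) \<in> F' \<longrightarrow> x' = x))"
  shows "card F + 1 \<le> card X + card Y"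
  using assms
proof (induction "card F" arbitrary: F X Y rule: less_induct)
  case less
  obtain x y where xy: "(x, y) \<in> F"
    and leaf: "(\<forall>y'. (x, y') \<in> F \<longrightarrow> y' = y) \<or> (\<forall>x'. (x', y) \<in> F \<longrightarrow> x' = x)"
    using less.prems(6)[OF order_refl less.prems(2)] by blast
  have xy': "x \<in> X" "y \<in> Y" using xy less.prems(3) by auto
  then have pos: "1 \<le> card X" "1 \<le> card Y" using less.prems by (auto simp: Suc_le_eq card_gt_0_iff)
  show ?case
  proof (cases "F - {(x, y)} = {}")
    case True
    then have "F = {(x, y)}" using xy by blast
    then show ?thesis using pos by simp
  next
    case False
    have cF: "card F = card (F - {(x, y)}) + 1"
      using card_Suc_Diff1[OF less.prems(1) xy] by simp
    have sub: "\<exists>x y. (x, y) \<in> F' \<and> ((\<forall>y'. (x, y') \<in> F' \<longrightarrow> y' = y) \<or> (\<forall>x'. (x', y) \<in> F' \<longrightarrow> x' = x))"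
      if "F' \<subseteq> F - {(x, y)}" "F' \<noteq> {}" for F'
      using less.prems(6)[of F'] that by blast
    show ?thesis
      using leaf
    proof
      assume "\<forall>y'. (x, y') \<in> F \<longrightarrow> y' = y"
      then have "F - {(x, y)} \<subseteq> (X - {x}) \<times> Y" using less.prems(3) by auto
      then have "card (F - {(x, y)}) + 1 \<le> card (X - {x}) + card Y"
        using less.hyps[of "F - {(x, y)}" "X - {x}" Y] cF False less.prems(1,4,5) sub by simp
      then show ?thesis using cF xy' pos less.prems(4) by simp
    next
      assume "\<forall>x'. (x', y) \<in> F \<longrightarrow> x' = x"
      then have "F - {(x, y)} \<subseteq> X \<times> (Y - {y})" using less.prems(3) by auto
      then have "card (F - {(x, y)}) + 1 \<le> card X + card (Y - {y})"
        using less.hyps[of "F - {(x, y)}" X "Y - {y}"] cF False less.prems(1,4,5) sub by simp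
      then show ?thesis using cF xy' pos less.prems(5) by simp
    qed
  qed
qed

text \<open>A minimal brace of order 2n, reduced to the relation between its classes. Minimality
  survives as the existence of witnesses. The assumptions are symmetric, and the interpretation
  \<open>d\<close> in later proofs is the flipped instance.\<close>

locale min_expanding =
  fixes A :: "'a set" and B :: "'b set" and E :: "'a \<Rightarrow> 'b \<Rightarrow> bool" and n :: nat
  assumes fin: "finite A" "finite B"
    and cards: "card A = n" "card B = n"
    and n3: "3 \<le> n"
    and E_in: "E x y \<Longrightarrow> x \<in> A \<and> y \<in> B"
    and exp: "expanding A B E"
    and ex_witness: "E x y \<Longrightarrow> \<exists>P R. witness A B E x y P R"
begin

abbreviation "A1 \<equiv> cubics A E"
abbreviation "A2 \<equiv> noncubics A E"
abbreviation "B1 \<equiv> cubics B (\<lambda>y x. E x y)"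
abbreviation "B2 \<equiv> noncubics B (\<lambda>y x. E x y)"
abbreviation "N x \<equiv> {y. E x y}"
abbreviation "wit \<equiv> witness A B E"

lemma flip: "min_expanding B A (\<lambda>y x. E x y) n"
proof
  show "finite B" "finite A" "card B = n" "card A = n" "3 \<le> n" by (rule fin cards n3)+
  show "y \<in> B \<and> x \<in> A" if "E x y" for x y using E_in[OF that] by blast
  show "expanding B A (\<lambda>y x. E x y)" using exp cards by (simp add: expanding_flip)
  show "\<exists>P R. witness B A (\<lambda>y x. E x y) y x P R" if e: "E x y" for x y
  proof -
    obtain P R where "witness A B E x y P R" using ex_witness[OF e] by blast
    then have "witness B A (\<lambda>y x. E x y) y x R P" by (rule witness_flip) (simp add: cards)
    then show ?thesis by blast
  qed
qed

lemma classes: "A1 \<union> A2 = A" "A1 \<inter> A2 = {}" "B1 \<union> B2 = B" "B1 \<inter> B2 = {}"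
  by (auto simp: cubics_def noncubics_def)

lemma finite_cl [simp]: "finite A1" "finite A2" "finite B1" "finite B2"
  using fin by (auto simp: cubics_def noncubics_def)

lemma card_classes: "card A1 + card A2 = n" "card B1 + card B2 = n"
  using card_Un_disjoint[of A1 A2] card_Un_disjoint[of B1 B2] classes cards by auto

lemma N_sub: "N x \<subseteq> B" using E_in by blast

lemma finite_N [simp]: "finite (N x)" using N_sub fin finite_subset by blast

lemma indep: "X \<subseteq> A \<Longrightarrow> Y \<subseteq> B \<Longrightarrow> X \<noteq> {} \<Longrightarrow> Y \<noteq> {} \<Longrightarrow> (\<And>x y. x \<in> X \<Longrightarrow> y \<in> Y \<Longrightarrow> \<not> E x y)
    \<Longrightarrow> card X + card Y + 2 \<le> n"
  using expandingD[OF exp] cards by blast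

lemma card_nbhd:
  assumes "X \<subseteq> A" "X \<noteq> {}" "card X + 2 \<le> n"
  shows "card X + 2 \<le> card {y. \<exists>x\<in>X. E x y}"
proof (rule ccontr)
  let ?N = "{y. \<exists>x\<in>X. E x y}"
  assume neg: "\<not> ?thesis"
  have N: "?N \<subseteq> B" using E_in by blast
  then have c: "card (B - ?N) = n - card ?N" using fin cards by (metis card_Diff_subset finite_subset)
  then have ne: "B - ?N \<noteq> {}" using neg assms(3) by (metis card.empty diff_is_0_eq le_trans not_le less_imp_le)
  have "card X + card (B - ?N) + 2 \<le> n"
    using assms(1,2) ne by (intro indep) auto
  then show False using neg c by linarith
qed

lemma card_N_ge3: "x \<in> A \<Longrightarrow> 3 \<le> card (N x)"
  using card_nbhd[of "{x}"] n3 by simp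

lemma card_N_cubics: "x \<in> A1 \<Longrightarrow> card (N x) = 3"
  using card_N_ge3[of x] by (auto simp: cubics_def)

lemma card_N_noncubics: "x \<in> A2 \<Longrightarrow> 4 \<le> card (N x)"
  by (simp add: noncubics_def)

lemma card_N_le: "card (N x) \<le> n"
  using N_sub[of x] fin cards card_mono by metis

section \<open>Witnesses of edges at noncubic vertices\<close>

lemma witD:
  assumes "wit x y P R"
  shows "P \<subseteq> A" "R \<subseteq> B" "x \<in> P" "y \<in> R" "card P + card R + 1 = n"
    "\<And>p r. p \<in> P \<Longrightarrow> r \<in> R \<Longrightarrow> E p r \<Longrightarrow> p = x \<and> r = y" "finite P" "finite R"
proof -
  show P: "P \<subseteq> A" "R \<subseteq> B" "x \<in> P" "y \<in> R" "card P + card R + 1 = n"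
    using assms cards by (simp_all add: witness_def)
  show "\<And>p r. p \<in> P \<Longrightarrow> r \<in> R \<Longrightarrow> E p r \<Longrightarrow> p = x \<and> r = y"
    using assms by (simp add: witness_def)
  show "finite P" "finite R" using P(1,2) fin finite_subset by blast+
qed

text \<open>As |B - R| = |P| + 1, this bounds the degrees in \<open>P\<close> apart from that of
  \<open>x\<close>; noncubic vertices therefore make \<open>P\<close> large.\<close>

lemma N_disj_witness:
  assumes w: "wit x y P R" and p: "p \<in> P" "p \<noteq> x"
  shows "N p \<subseteq> B - R"
  using witD(6)[OF w p(1)] p(2) N_sub by blast

lemma card_minus_witness: "wit x y P R \<Longrightarrow> card (B - R) = card P + 1"
  using witD(2,5,8)[of x y P R] fin cards by (simp add: card_Diff_subset)

text \<open>If P = {x}, then |R| = n - 2 and \<open>x\<close> misses the n - 3 vertices of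
  \<open>R\<close> other than \<open>y\<close>, so its degree is at most three.\<close>

lemma card_witness_ge2:
  assumes w: "wit x y P R" and x: "x \<in> A2"
  shows "2 \<le> card P"
proof (rule ccontr)
  assume "\<not> ?thesis"
  moreover have "1 \<le> card P" using witD(3,7)[OF w] by (auto simp: Suc_le_eq card_gt_0_iff)
  ultimately have P: "card P = 1" by linarith
  have "R - {y} \<subseteq> B - N x" using witD(2)[OF w] witD(6)[OF w witD(3)[OF w]] by blast
  then have "card (R - {y}) \<le> card (B - N x)" using fin by (intro card_mono) auto
  then have "card (R - {y}) \<le> n - card (N x)" using N_sub[of x] cards by (simp add: card_Diff_subset)
  moreover have "card (R - {y}) = card R - 1" using witD(4,8)[OF w] by simp
  ultimately show False using card_N_noncubics[OF x] card_N_le[of x] witD(5)[OF w] P by linarith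
qed

text \<open>If |P| = 2, the second vertex of \<open>P\<close> has its neighbours in B - R, a set of
  three vertices.\<close>

lemma card_witness_ge3:
  assumes w: "wit x y P R" and P: "P \<subseteq> A2"
  shows "3 \<le> card P"
proof (rule ccontr)
  assume neg: "\<not> ?thesis"
  have x: "x \<in> P" "x \<in> A2" using witD(3)[OF w] P by auto
  have P2: "card P = 2" using neg card_witness_ge2[OF w x(2)] by linarith
  then have "P \<noteq> {x}" by auto
  then obtain x' where x': "x' \<in> P" "x' \<noteq> x" using x by blast
  have "card (N x') \<le> card (B - R)"
    using N_disj_witness[OF w x'] fin by (intro card_mono) auto
  then have "card (N x') \<le> 3" using card_minus_witness[OF w] P2 by simp
  then show False using card_N_noncubics[of x'] x' P by auto
qed

text \<open>Uncrossing. (P \<inter> P') - {x} is independent of R \<union> R', and P \<union> P' is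
  independent of R \<inter> R' because \<open>y\<close> is not in \<open>R'\<close> and
  \<open>y'\<close> is not in \<open>R\<close>. The four sizes add up to 2n - 2, one more than the
  two bounds allow together, so R \<inter> R' must be empty; the first bound then gives the size of
  P \<union> P'.\<close>

lemma witness_share:
  assumes x: "x \<in> A2" and w: "wit x y P R" and w': "wit x y' P' R'"
    and e: "E x y" "E x y'" "y \<noteq> y'"
  shows "R \<inter> R' = {}" "n \<le> card (P \<union> P') + 1" "n \<le> card P + card P'"
proof -
  note D = witD[OF w] and D' = witD[OF w']
  have yR': "y \<notin> R'" "y' \<notin> R" using D(6)[of x y'] D'(6)[of x y] D(3) D'(3) e by blast+
  have cP: "card (P \<union> P') + card (P \<inter> P') = card P + card P'"
    using D(7) D'(7) by (metis card_Un_Int)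
  have cR: "card (R \<union> R') + card (R \<inter> R') = card R + card R'"
    using D(8) D'(8) by (metis card_Un_Int)
  have xP: "x \<in> P \<inter> P'" using D(3) D'(3) by blast
  have no: "\<not> E p r" if "p \<in> P \<inter> P' - {x}" "r \<in> R \<union> R'" for p r
    using D(6)[of p r] D'(6)[of p r] that by blast
  have c1: "card (P \<inter> P' - {x}) + card (R \<union> R') + 2 \<le> n" if "P \<inter> P' \<noteq> {x}"
    using that xP D(1,2,4) D'(1,2) by (intro indep no) auto
  have c1': "card (P \<inter> P') + card (R \<union> R') + 1 \<le> n" if "P \<inter> P' \<noteq> {x}"
    using c1[OF that] card_Suc_Diff1[of "P \<inter> P'" x] xP D(7) by simp
  \<comment> \<open>Replaces the first independent pair when P \<inter> P' = {x}: of the at least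
    four neighbours of \<open>x\<close>, only \<open>y\<close> and \<open>y'\<close> lie in R
    \<union> R'.\<close>
  have deg: "card (R \<union> R') + 2 \<le> n"
  proof -
    have "R \<union> R' - {y, y'} \<subseteq> B - N x" using D(2) D'(2) D(6)[OF D(3)] D'(6)[OF D'(3)] by blast
    then have "card (R \<union> R' - {y, y'}) \<le> card (B - N x)" using fin by (intro card_mono) auto
    moreover have "card (B - N x) = n - card (N x)" using N_sub[of x] cards by (simp add: card_Diff_subset)
    moreover have "card (R \<union> R' - {y, y'}) = card (R \<union> R') - 2"
      using D(4) D'(4) e(3) D(8) D'(8) by (subst card_Diff_subset) auto
    ultimately show ?thesis using card_N_noncubics[OF x] card_N_le[of x] by linarith
  qed
  show RR: "R \<inter> R' = {}"
  proof (rule ccontr)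
    assume R: "R \<inter> R' \<noteq> {}"
    have "\<not> E p r" if "p \<in> P \<union> P'" "r \<in> R \<inter> R'" for p r
      using D(6)[of p r] D'(6)[of p r] that yR' by blast
    then have c2: "card (P \<union> P') + card (R \<inter> R') + 2 \<le> n"
      using R D(1,2,3) D'(1,2) by (intro indep) auto
    show False
    proof (cases "P \<inter> P' = {x}")
      case True
      then show False using c2 cP cR deg D(5) D'(5) by simp
    next
      case False
      then show False using c2 cP cR c1' D(5) D'(5) by linarith
    qed
  qed
  show "n \<le> card (P \<union> P') + 1"
  proof (cases "P \<inter> P' = {x}")
    case True
    then show ?thesis using cP cR deg D(5) D'(5) RR by simp
  next
    case False
    then show ?thesis using cP cR c1' D(5) D'(5) RR by simp
  qed
  moreover have "1 \<le> card (P \<inter> P')" using xP D(7) by (auto simp: Suc_le_eq card_gt_0_iff)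
  ultimately show "n \<le> card P + card P'" using cP by linarith
qed

lemma wit_flip: "wit x y P R \<Longrightarrow> witness B A (\<lambda>y x. E x y) y x R P"
  using witness_flip cards by metis

lemma ex_witnesses: "\<exists>P R. \<forall>x y. E x y \<longrightarrow> wit x y (P x y) (R x y)"
  using ex_witness by metis

text \<open>The sizes of the sets \<open>P\<close> of two edges between noncubic vertices add up to at least \<open>n\<close> if the
  edges meet in \<open>A\<close>, and to at most \<open>n - 2\<close> if they meet in \<open>B\<close>; so a set of such edges without a
  leaf would contain edges with larger and larger \<open>P\<close>.\<close>

lemma noncubic_leaf:
  assumes "F \<subseteq> edge_pairs E A2 B2" "F \<noteq> {}"
  shows "\<exists>x y. (x, y) \<in> F \<and> ((\<forall>y'. (x, y') \<in> F \<longrightarrow> y' = y) \<or> (\<forall>x'. (x', y) \<in> F \<longrightarrow> x' = x))"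
proof (rule ccontr)
  assume neg: "\<not> ?thesis"
  interpret d: min_expanding B A "\<lambda>y x. E x y" n by (rule flip)
  obtain P R where w: "\<And>x y. E x y \<Longrightarrow> wit x y (P x y) (R x y)" using ex_witnesses by blast
  have fF: "finite F" using assms(1) finite_subset finite_edge_pairs finite_cl by metis
  define p where "p = (\<lambda>(x, y). card (P x y))"
  have "Max (p ` F) \<in> p ` F" using fF assms(2) by simp
  then obtain e where "e \<in> F" "p e = Max (p ` F)" by (metis imageE)
  then obtain x y where xy: "(x, y) \<in> F" and mx: "p (x, y) = Max (p ` F)"
    by (cases e) simp
  have le: "p e \<le> p (x, y)" if "e \<in> F" for e using that fF mx by simp
  obtain x' where x': "(x', y) \<in> F" "x' \<noteq> x" using neg xy by blast
  obtain y' where y': "(x', y') \<in> F" "y' \<noteq> y" using neg x'(1) by blast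
  have E: "E x y" "E x' y" "E x' y'" "y \<in> B2" "x' \<in> A2" using xy x' y' assms(1) by (auto simp: edge_pairs_def)
  have "n \<le> card (R x y) + card (R x' y)"
    by (rule d.witness_share(3)[OF E(4) wit_flip[OF w[OF E(1)]] wit_flip[OF w[OF E(2)]] E(1,2) x'(2)[symmetric]])
  moreover have "n \<le> card (P x' y) + card (P x' y')"
    by (rule witness_share(3)[OF E(5) w[OF E(2)] w[OF E(3)] E(2,3) y'(2)[symmetric]])
  moreover have "card (P x y) + card (R x y) + 1 = n" "card (P x' y) + card (R x' y) + 1 = n"
    using witD(5)[OF w] E by blast+
  moreover have "card (P x' y') \<le> card (P x y)" using le[OF y'(1)] by (simp add: p_def)
  ultimately show False by linarith
qed

lemma card_noncubic_edges:
  assumes "edge_pairs E A2 B2 \<noteq> {}"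
  shows "card (edge_pairs E A2 B2) + 1 \<le> card A2 + card B2"
proof (rule card_forest[of "edge_pairs E A2 B2"])
  show "edge_pairs E A2 B2 \<subseteq> A2 \<times> B2" by (auto simp: edge_pairs_def)
qed (use assms noncubic_leaf in auto)

lemma no_four_cycle:
  assumes "x \<in> A2" "x' \<in> A2" "x \<noteq> x'" "y \<in> B2" "y' \<in> B2" "y \<noteq> y'"
    and "E x y" "E x y'" "E x' y" "E x' y'"
  shows False
proof -
  have "{(x, y), (x, y'), (x', y), (x', y')} \<subseteq> edge_pairs E A2 B2" using assms by (auto simp: edge_pairs_def)
  from noncubic_leaf[OF this] show False using assms(3,6) by auto
qed

section \<open>Counting edges by the degrees of their ends\<close>

lemma card_edges:
  "card (edge_pairs E A B) + card (edge_pairs E A1 B1) + 3 * card A2 + 3 * card B2 = 6 * n + card (edge_pairs E A2 B2)"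
proof -
  interpret d: min_expanding B A "\<lambda>y x. E x y" n by (rule flip)
  \<comment> \<open>There are 3|A1| edges at \<open>A1\<close> and 3|B1| at \<open>B1\<close>; the
    edges between cubic vertices are counted twice and those between noncubic vertices not at
    all.\<close>
  have "card (edge_pairs E A B) = card (edge_pairs E A1 B) + card (edge_pairs E A2 B)"
    using card_edge_pairs_Un_left[of A1 A2 B E] classes fin by simp
  moreover have "card (edge_pairs E A2 B) = card (edge_pairs E A2 B1) + card (edge_pairs E A2 B2)"
    using card_edge_pairs_Un_right[of A2 B2 B1 E] classes by simp
  moreover have "card (edge_pairs E A B1) = card (edge_pairs E A1 B1) + card (edge_pairs E A2 B1)"
    using card_edge_pairs_Un_left[of A1 A2 B1 E] classes by simp
  moreover have "card (edge_pairs E A1 B) = 3 * card A1"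
    using card_N_cubics N_sub fin by (simp add: card_edge_pairs Int_absorb2)
  moreover have "card (edge_pairs E A B1) = 3 * card B1"
    using d.card_N_cubics d.N_sub fin card_edge_pairs[of B1 A "\<lambda>y x. E x y"]
    by (simp add: Int_absorb2 card_edge_pairs_flip[of E])
  ultimately show ?thesis using card_classes by linarith
qed

lemma card_edges_ge: "3 * n + card A2 \<le> card (edge_pairs E A B)"
proof -
  have "card (edge_pairs E A B) = card (edge_pairs E A1 B) + card (edge_pairs E A2 B)"
    using card_edge_pairs_Un_left[of A1 A2 B E] classes fin by simp
  moreover have "card (edge_pairs E A1 B) = 3 * card A1"
    using card_N_cubics N_sub fin by (simp add: card_edge_pairs Int_absorb2)
  moreover have "card (edge_pairs E A2 B) \<ge> 4 * card A2"
  proof -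
    have "card (edge_pairs E A2 B) = (\<Sum>x\<in>A2. card (N x))" using N_sub fin by (simp add: card_edge_pairs Int_absorb2)
    then show ?thesis using sum_bounded_below[of A2 4 "\<lambda>x. card (N x)"] card_N_noncubics by simp
  qed
  ultimately show ?thesis using card_classes by linarith
qed

text \<open>The neighbours of \<open>X\<close> in \<open>Y\<close> are the second components of the
  edges. If the counts agree, this projection is injective; that is the information extracted from
  tight cases.\<close>

lemma card_snd_edge_pairs:
  assumes "finite X" "finite Y"
  shows "card ({y. \<exists>x\<in>X. E x y} \<inter> Y) \<le> card (edge_pairs E X Y)"
    and "card ({y. \<exists>x\<in>X. E x y} \<inter> Y) = card (edge_pairs E X Y) \<Longrightarrow> v \<in> Y \<Longrightarrow> u \<in> X \<Longrightarrow> u' \<in> X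
      \<Longrightarrow> E u v \<Longrightarrow> E u' v \<Longrightarrow> u = u'"
proof -
  have im: "{y. \<exists>x\<in>X. E x y} \<inter> Y = snd ` edge_pairs E X Y" by (force simp: edge_pairs_def)
  then show "card ({y. \<exists>x\<in>X. E x y} \<inter> Y) \<le> card (edge_pairs E X Y)"
    using assms by (simp add: card_image_le)
  assume "card ({y. \<exists>x\<in>X. E x y} \<inter> Y) = card (edge_pairs E X Y)" "v \<in> Y" "u \<in> X" "u' \<in> X" "E u v" "E u' v"
  then have "(u, v) \<in> edge_pairs E X Y" "(u', v) \<in> edge_pairs E X Y" "card (snd ` edge_pairs E X Y) = card (edge_pairs E X Y)"
    using im by (auto simp: edge_pairs_def)
  moreover from this have "inj_on snd (edge_pairs E X Y)" using assms by (intro eq_card_imp_inj_on) auto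
  ultimately show "u = u'" unfolding inj_on_def by fastforce
qed

text \<open>Two noncubic vertices in \<open>A\<close> keep |X| \<le> n - 2, so expansion applies.
  The noncubic neighbours all lie in \<open>C\<close>, which may be smaller than \<open>B2\<close>
  when a witness separates part of \<open>B2\<close> from \<open>X\<close>.\<close>

lemma card_nbhd_cubics:
  assumes "X \<subseteq> A1" "X \<noteq> {}" "2 \<le> card A2" "C \<subseteq> B2" "\<And>x y. x \<in> X \<Longrightarrow> y \<in> B2 - C \<Longrightarrow> \<not> E x y"
  shows "card X + 2 \<le> card ({y. \<exists>x\<in>X. E x y} \<inter> B1) + card C"
proof -
  let ?N = "{y. \<exists>x\<in>X. E x y}"
  have "card X \<le> card A1" using assms(1) by (simp add: card_mono)
  then have "card X + 2 \<le> n" using card_classes assms(3) by linarith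
  then have "card X + 2 \<le> card ?N" using assms(1,2) classes by (intro card_nbhd) auto
  also have "?N \<subseteq> (?N \<inter> B1) \<union> C" using assms(5) E_in classes by blast
  then have "card ?N \<le> card ((?N \<inter> B1) \<union> C)"
    using finite_subset[OF assms(4)] by (intro card_mono) auto
  also have "\<dots> \<le> card (?N \<inter> B1) + card C" by (rule card_Un_le)
  finally show ?thesis .
qed

text \<open>This is t \<ge> 0: by expansion \<open>A1\<close> has at least |A1| + 2 - |B2|
  neighbours in \<open>B1\<close>, each on an edge of its own.\<close>

lemma card_cubic_edges_ge:
  assumes "2 \<le> card A2" "2 \<le> card B2"
  shows "n + 2 \<le> card (edge_pairs E A1 B1) + card A2 + card B2"
proof (cases "A1 = {}")
  case True
  then show ?thesis using card_classes assms by simp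
next
  case False
  have "card A1 + 2 \<le> card ({y. \<exists>x\<in>A1. E x y} \<inter> B1) + card B2"
    using False assms by (intro card_nbhd_cubics) auto
  moreover have "card ({y. \<exists>x\<in>A1. E x y} \<inter> B1) \<le> card (edge_pairs E A1 B1)" by (intro card_snd_edge_pairs) auto
  ultimately show ?thesis using card_classes by linarith
qed

end

lemma ex_two_elements:
  assumes "2 \<le> card S"
  shows "\<exists>s t. s \<in> S \<and> t \<in> S \<and> s \<noteq> t"
proof -
  obtain T where "T \<subseteq> S" "card T = 2" using assms by (metis obtain_subset_with_card_n)
  then show ?thesis by (auto simp: card_2_iff)
qed

context min_expanding
begin

text \<open>A witness with cubic vertices on both sides gives t \<ge> 1. No edge at P \<inter> A1
  ends in \<open>R\<close> and none at R \<inter> B1 ends in \<open>P\<close>, so both sets expand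
  along disjoint sets of edges between cubic vertices: the surplus of two is gained twice, while |P|
  + |R| is only one short of n. If t = 1, every estimate is tight, which is the second
  claim.\<close>

lemma cubic_cut_by_witness:
  assumes w: "wit x y P R" and x: "x \<in> A2" and y: "y \<in> B2"
    and ne: "P \<inter> A1 \<noteq> {}" "R \<inter> B1 \<noteq> {}" and ab: "2 \<le> card A2" "2 \<le> card B2"
  shows "n + 3 \<le> card (edge_pairs E A1 B1) + card A2 + card B2"
    and "card (edge_pairs E A1 B1) + card A2 + card B2 = n + 3 \<Longrightarrow>
      (\<forall>u\<in>A1. \<forall>v\<in>B1. E u v \<longrightarrow> u \<in> P \<or> v \<in> R) \<and>
      (\<forall>v\<in>B1. \<forall>u\<in>P \<inter> A1. \<forall>u'\<in>P \<inter> A1. E u v \<longrightarrow> E u' v \<longrightarrow> u = u') \<and>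
      (\<forall>u\<in>A1. \<forall>v\<in>R \<inter> B1. \<forall>v'\<in>R \<inter> B1. E u v \<longrightarrow> E u v' \<longrightarrow> v = v')"
proof -
  interpret d: min_expanding B A "\<lambda>y x. E x y" n by (rule flip)
  note D = witD[OF w]
  let ?P = "P \<inter> A1" and ?R = "R \<inter> B1"
  have xA1: "x \<notin> A1" and yB1: "y \<notin> B1" using x y classes by auto
  have no: "\<not> E p r" if "p \<in> P" "r \<in> R" "p \<in> A1 \<or> r \<in> B1" for p r
    using D(6)[OF that(1,2)] that(3) xA1 yB1 by blast
  let ?NP = "{v. \<exists>u\<in>?P. E u v} \<inter> B1" and ?NR = "{u. \<exists>v\<in>?R. E u v} \<inter> A1"
  have 1: "card ?P + 2 \<le> card ?NP + card (B2 - R)"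
    by (rule card_nbhd_cubics) (use ne ab no in auto)
  have 2: "card ?R + 2 \<le> card ?NR + card (A2 - P)"
    by (rule d.card_nbhd_cubics) (use ne ab no in auto)
  have fPR: "finite ?P" "finite ?R" by auto
  have 3: "card ?NP \<le> card (edge_pairs E ?P B1)" by (rule card_snd_edge_pairs) auto
  have 4: "card ?NR \<le> card (edge_pairs E A1 ?R)"
    using d.card_snd_edge_pairs(1)[of ?R A1] by (simp add: card_edge_pairs_flip[of E])
  let ?U = "edge_pairs E ?P B1 \<union> edge_pairs E A1 ?R"
  have sub: "?U \<subseteq> edge_pairs E A1 B1" by (auto simp: edge_pairs_def)
  have "edge_pairs E ?P B1 \<inter> edge_pairs E A1 ?R = {}" using no by (auto simp: edge_pairs_def)
  then have cU: "card ?U = card (edge_pairs E ?P B1) + card (edge_pairs E A1 ?R)" by (simp add: card_Un_disjoint)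
  have leU: "card ?U \<le> card (edge_pairs E A1 B1)" using sub by (intro card_mono) auto
  have cB: "card (B2 - R) + card (R \<inter> B2) = card B2" "card (A2 - P) + card (P \<inter> A2) = card A2"
    using card_Int_Diff[of B2 R] card_Int_Diff[of A2 P] by (simp_all add: Int_commute)
  have "card P = card ?P + card (P \<inter> A2)"
    using card_Un_disjoint[of ?P "P \<inter> A2"] D(1,7) classes
    by (metis Int_Un_distrib Int_absorb2 Int_assoc Int_empty_right Int_left_commute finite_Int)
  moreover have "card R = card ?R + card (R \<inter> B2)"
    using card_Un_disjoint[of ?R "R \<inter> B2"] D(2,8) classes
    by (metis Int_Un_distrib Int_absorb2 Int_assoc Int_empty_right Int_left_commute finite_Int)
  ultimately have sz: "card ?P + card (P \<inter> A2) + card ?R + card (R \<inter> B2) + 1 = n" using D(5) by linarith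
  show "n + 3 \<le> card (edge_pairs E A1 B1) + card A2 + card B2"
    using 1 2 3 4 cU leU cB sz by linarith
  assume eq: "card (edge_pairs E A1 B1) + card A2 + card B2 = n + 3"
  have eqs: "card ?NP = card (edge_pairs E ?P B1)" "card ?NR = card (edge_pairs E A1 ?R)" "card ?U = card (edge_pairs E A1 B1)"
    using eq 1 2 3 4 cU leU cB sz by linarith+
  have U: "?U = edge_pairs E A1 B1" using card_subset_eq[OF _ sub] eqs(3) by simp
  have a: "u \<in> P \<or> v \<in> R" if "u \<in> A1" "v \<in> B1" "E u v" for u v
  proof -
    have "(u, v) \<in> ?U" unfolding U using that by (simp add: edge_pairs_def)
    then show ?thesis by (auto simp: edge_pairs_def)
  qed
  have b: "u = u'" if "v \<in> B1" "u \<in> ?P" "u' \<in> ?P" "E u v" "E u' v" for u u' v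
    by (rule card_snd_edge_pairs(2)[OF fPR(1) _ eqs(1) that]) simp
  have eq2: "card ?NR = card (edge_pairs (\<lambda>y x. E x y) ?R A1)" using eqs(2) by (simp add: card_edge_pairs_flip[of E])
  have c: "v = v'" if "u \<in> A1" "v \<in> ?R" "v' \<in> ?R" "E u v" "E u v'" for u v v'
    by (rule d.card_snd_edge_pairs(2)[OF fPR(2) _ eq2 that]) simp
  show "(\<forall>u\<in>A1. \<forall>v\<in>B1. E u v \<longrightarrow> u \<in> P \<or> v \<in> R) \<and>
      (\<forall>v\<in>B1. \<forall>u\<in>P \<inter> A1. \<forall>u'\<in>P \<inter> A1. E u v \<longrightarrow> E u' v \<longrightarrow> u = u') \<and>
      (\<forall>u\<in>A1. \<forall>v\<in>R \<inter> B1. \<forall>v'\<in>R \<inter> B1. E u v \<longrightarrow> E u v' \<longrightarrow> v = v')"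
    using a b c by blast
qed

text \<open>With |A2| = 2, a vertex of \<open>B1\<close> has one neighbour in \<open>A1\<close> and
  one more for each vertex of \<open>A2\<close> that it misses. So \<open>t\<close> is the number of
  nonadjacent pairs between \<open>A2\<close> and \<open>B1\<close>.\<close>

lemma card_cubic_edges_two:
  assumes "card A2 = 2"
  shows "card (edge_pairs E A1 B1) + card A2 + card B2 = n + 2 + (\<Sum>x\<in>A2. card (B1 - N x))"
proof -
  interpret d: min_expanding B A "\<lambda>y x. E x y" n by (rule flip)
  have "card (edge_pairs E A B1) = card (edge_pairs E A1 B1) + card (edge_pairs E A2 B1)"
    using card_edge_pairs_Un_left[of A1 A2 B1 E] classes by simp
  moreover have "card (edge_pairs E A B1) = 3 * card B1"
    using d.card_N_cubics d.N_sub fin card_edge_pairs[of B1 A "\<lambda>y x. E x y"]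
    by (simp add: Int_absorb2 card_edge_pairs_flip[of E])
  moreover have "card (edge_pairs E A2 B1) = (\<Sum>x\<in>A2. card (N x \<inter> B1))" by (simp add: card_edge_pairs)
  moreover have "card (B1 - N x) + card (N x \<inter> B1) = card B1" for x
    using card_Int_Diff[of B1 "N x"] by (simp add: Int_commute)
  then have "(\<Sum>x\<in>A2. card (B1 - N x)) + (\<Sum>x\<in>A2. card (N x \<inter> B1)) = (\<Sum>x\<in>A2. card B1)"
    unfolding sum.distrib[symmetric] by simp
  moreover have "(\<Sum>x\<in>A2. card B1) = 2 * card B1" using assms by simp
  ultimately show ?thesis using assms card_classes by linarith
qed

text \<open>The sets \<open>R y\<close> are disjoint for the noncubic neighbours \<open>y\<close> of
  \<open>x\<close>, and R y - {y} contains only nonneighbours of \<open>x\<close>. So each of them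
  either uses up a cubic nonneighbour of \<open>x\<close> or lies in \<open>B2\<close>, where it
  takes at least three vertices.\<close>

lemma witness_cover:
  assumes x: "x \<in> A2" and w: "\<And>y. E x y \<Longrightarrow> wit x y (P y) (R y)"
  shows "(\<Sum>y\<in>N x \<inter> B2. card (R y \<inter> B1)) \<le> card (B1 - N x)"
    and "card (N x \<inter> B2) \<le> card (B1 - N x) + card {y \<in> N x \<inter> B2. R y \<subseteq> B2}"
    and "3 * card {y \<in> N x \<inter> B2. R y \<subseteq> B2} \<le> card B2"
proof -
  interpret d: min_expanding B A "\<lambda>y x. E x y" n by (rule flip)
  let ?K = "N x \<inter> B2" and ?S = "{y \<in> N x \<inter> B2. R y \<subseteq> B2}"
  have disj: "R y \<inter> R y' = {}" if "y \<in> ?K" "y' \<in> ?K" "y \<noteq> y'" for y y'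
    using witness_share(1)[OF x w w] that by blast
  have RB: "R y \<subseteq> B" "finite (R y)" if "y \<in> ?K" for y
    using witD(2,8)[OF w] that by blast+
  have sub: "R y \<inter> B1 \<subseteq> B1 - N x" if y: "y \<in> ?K" for y
  proof
    fix r assume r: "r \<in> R y \<inter> B1"
    have wy: "wit x y (P y) (R y)" using w y by blast
    have "r \<noteq> y" using r y classes by blast
    then show "r \<in> B1 - N x" using witD(6)[OF wy witD(3)[OF wy], of r] r by blast
  qed
  have "(\<Sum>y\<in>?K. card (R y \<inter> B1)) = card (\<Union>y\<in>?K. R y \<inter> B1)"
    using disj by (intro card_UN_disjoint[symmetric]) auto
  also have "\<dots> \<le> card (B1 - N x)" using sub by (intro card_mono) auto
  finally show s: "(\<Sum>y\<in>?K. card (R y \<inter> B1)) \<le> card (B1 - N x)" .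
  have "1 \<le> card (R y \<inter> B1)" if y: "y \<in> ?K - ?S" for y
  proof -
    have "R y \<inter> B1 \<noteq> {}" using RB(1)[of y] y classes by blast
    then show ?thesis by (simp add: Suc_le_eq card_gt_0_iff)
  qed
  then have "card (?K - ?S) * 1 \<le> (\<Sum>y\<in>?K - ?S. card (R y \<inter> B1))"
    using sum_bounded_below[of "?K - ?S" 1 "\<lambda>y. card (R y \<inter> B1)"] by simp
  also have "\<dots> \<le> (\<Sum>y\<in>?K. card (R y \<inter> B1))" by (rule sum_mono2) auto
  finally have "card (?K - ?S) \<le> card (B1 - N x)" using s by simp
  moreover have "?K \<inter> ?S = ?S" by blast
  then have "card ?K = card (?K - ?S) + card ?S"
    using card_Int_Diff[of ?K ?S] by simp
  ultimately show "card ?K \<le> card (B1 - N x) + card ?S" by linarith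
  have "3 \<le> card (R y)" if "y \<in> ?S" for y
    using d.card_witness_ge3[OF wit_flip[OF w]] that by blast
  then have "card ?S * 3 \<le> (\<Sum>y\<in>?S. card (R y))"
    using sum_bounded_below[of ?S 3 "\<lambda>y. card (R y)"] by simp
  also have "\<dots> = card (\<Union>y\<in>?S. R y)"
    using disj RB by (intro card_UN_disjoint[symmetric]) auto
  also have "\<dots> \<le> card B2" by (intro card_mono) auto
  finally show "3 * card ?S \<le> card B2" by simp
qed

section \<open>At least 5n - 10 edges and two noncubic vertices in each class\<close>

abbreviation "dense \<equiv> 5 * n \<le> card (edge_pairs E A B) + 10"

lemma dense_iff:
  "dense \<longleftrightarrow> card (edge_pairs E A1 B1) + 3 * card A2 + 3 * card B2 \<le> n + card (edge_pairs E A2 B2) + 10"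
  using card_edges by linarith

lemma card_noncubic_edges_two:
  "card (edge_pairs E A2 B2) = (\<Sum>x\<in>A2. card (N x \<inter> B2))"
  by (simp add: card_edge_pairs)

text \<open>The forest bound leaves |B2| \<le> 5, so at each \<open>x\<close> at most one
  \<open>R\<close> fits into \<open>B2\<close>. Summing \<open>witness_cover\<close> gives |F| \<le>
  t + 2, while density asks for |F| \<ge> t + 2|B2| - 4.\<close>

lemma dense_two_ge4:
  assumes a: "card A2 = 2" and b: "4 \<le> card B2" and H: dense
  shows False
proof -
  obtain P R where w: "\<And>x y. E x y \<Longrightarrow> wit x y (P x y) (R x y)" using ex_witnesses by blast
  have "card (edge_pairs E A2 B2) \<le> card B2 + 1"
    using card_noncubic_edges a by (cases "edge_pairs E A2 B2 = {}") auto
  then have b5: "card B2 \<le> 5"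
    using H card_cubic_edges_ge a b unfolding dense_iff by linarith
  have "card (N x \<inter> B2) \<le> card (B1 - N x) + 1" if x: "x \<in> A2" for x
    using witness_cover(2,3)[OF x w] b5 by linarith
  then have "(\<Sum>x\<in>A2. card (N x \<inter> B2)) \<le> (\<Sum>x\<in>A2. card (B1 - N x) + 1)" by (rule sum_mono)
  then have "card (edge_pairs E A2 B2) \<le> (\<Sum>x\<in>A2. card (B1 - N x)) + 2"
    unfolding card_noncubic_edges_two sum.distrib using a by simp
  then show False using H card_cubic_edges_two[OF a] a b unfolding dense_iff by linarith
qed

text \<open>Density asks for |F| \<ge> t + 2, and each vertex of \<open>A2\<close> adds at most one
  to the excess. So both have a witness with \<open>R\<close> equal to \<open>B2\<close>, and by
  disjointness only one noncubic neighbour.\<close>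

lemma dense_two_three:
  assumes a: "card A2 = 2" and b: "card B2 = 3" and H: dense
  shows False
proof -
  interpret d: min_expanding B A "\<lambda>y x. E x y" n by (rule flip)
  obtain P R where w: "\<And>x y. E x y \<Longrightarrow> wit x y (P x y) (R x y)" using ex_witnesses by blast
  obtain x x' where A2: "A2 = {x, x'}" "x \<noteq> x'" using a by (auto simp: card_2_iff)
  let ?S = "\<lambda>x. {y \<in> N x \<inter> B2. R x y \<subseteq> B2}"
  have S1: "card (?S z) \<le> 1" if "z \<in> A2" for z using witness_cover(3)[OF that w] b by linarith
  have le: "card (N z \<inter> B2) \<le> card (B1 - N z) + card (?S z)" if "z \<in> A2" for z
    by (rule witness_cover(2)[OF that w])
  have "card (edge_pairs E A2 B2) \<ge> (\<Sum>x\<in>A2. card (B1 - N x)) + 2"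
    using H card_cubic_edges_two[OF a] a b unfolding dense_iff by linarith
  then have ge: "card (N x \<inter> B2) + card (N x' \<inter> B2) \<ge> card (B1 - N x) + card (B1 - N x') + 2"
    unfolding card_noncubic_edges_two using A2 by simp
  have one: "\<exists>y. N z \<inter> B2 = {y} \<and> R z y = B2"
    if z: "z \<in> A2" and k: "card (N z \<inter> B2) \<ge> card (B1 - N z) + 1" for z
  proof -
    have "card (?S z) \<noteq> 0" using le[OF z] k by linarith
    then obtain y where y: "y \<in> N z \<inter> B2" "R z y \<subseteq> B2" by (metis (no_types, lifting) card.empty empty_Collect_eq)
    have "3 \<le> card (R z y)" using d.card_witness_ge3[OF wit_flip[OF w]] y by blast
    then have R: "R z y = B2" using y(2) b by (intro card_seteq) auto
    have "y' = y" if y': "y' \<in> N z \<inter> B2" for y'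
    proof (rule ccontr)
      assume "y' \<noteq> y"
      then have "R z y \<inter> R z y' = {}" using witness_share(1)[OF z w w, of y y'] y y' by blast
      moreover have "y' \<in> R z y'" using witD(4)[OF w] y' by blast
      ultimately show False using R y' by blast
    qed
    then show ?thesis using y R by blast
  qed
  have "card (N x \<inter> B2) \<ge> card (B1 - N x) + 1" "card (N x' \<inter> B2) \<ge> card (B1 - N x') + 1"
    using ge le[of x] le[of x'] S1[of x] S1[of x'] A2 by auto
  then obtain y y' where y: "N x \<inter> B2 = {y}" "R x y = B2" and y': "N x' \<inter> B2 = {y'}" "R x' y' = B2"
    using one[of x] one[of x'] A2 by auto
  have e: "E x y" "E x' y'" "y \<in> B2" "y' \<in> B2" using y y' by auto
  note wy = w[OF e(1)] and wy' = w[OF e(2)]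
  have cP: "card (P x y) + 4 = n" using witD(5)[OF wy] y(2) b by simp
  show False
  proof (cases "y' = y")
    case True
    \<comment> \<open>Uncrossing at the common end \<open>y\<close> bounds n by |B2| + 1 = 4, but n
      = |P| + 4 with \<open>P\<close> nonempty.\<close>
    have "n \<le> card (R x y \<union> R x' y') + 1"
      using d.witness_share(2)[OF e(3) wit_flip[OF wy] _ e(1) _ A2(2), of "R x' y'" "P x' y'"]
        wit_flip[OF wy'] e(2) True by simp
    then have "n \<le> 4" using y y' b by simp
    moreover have "1 \<le> card (P x y)" using witD(3,7)[OF wy] by (auto simp: Suc_le_eq card_gt_0_iff)
    ultimately show False using cP by linarith
  next
    case False
    \<comment> \<open>Both \<open>y'\<close> and the third vertex \<open>z\<close> of
      \<open>B2\<close> turn out to have neighbourhood A - P, of size four. So \<open>x'\<close>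
      gets a second noncubic neighbour.\<close>
    obtain z where z: "z \<in> B2" "z \<noteq> y" "z \<noteq> y'"
      using b by (metis card_2_iff' card_3_iff insertCI False e(3,4))
    have cA: "card (A - P x y) = 4"
      using d.card_minus_witness[OF wit_flip[OF wy]] y(2) b by simp
    have eq: "{u. E u v} = A - P x y" if "v \<in> B2" "v \<noteq> y" for v
    proof (rule card_seteq)
      show "finite (A - P x y)" using fin by simp
      show "{u. E u v} \<subseteq> A - P x y"
        by (rule d.N_disj_witness[OF wit_flip[OF wy]]) (use that y in auto)
      show "card (A - P x y) \<le> card {u. E u v}" using cA d.card_N_noncubics[OF that(1)] by simp
    qed
    have "E x' z" using eq[OF e(4) False] eq[OF z(1,2)] e(2) by blast
    then show False using y'(1) z by blast
  qed
qed

text \<open>No \<open>R\<close> fits into a \<open>B2\<close> of size two, so each vertex of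
  \<open>A2\<close> has at most as many noncubic neighbours as cubic nonneighbours, whereas density
  asks for |F| \<ge> t. Hence equality throughout, and each \<open>R\<close> of an edge of
  \<open>F\<close> has exactly one cubic vertex. The bound on \<open>n\<close> compares 5n - 10 with
  3n + 2.\<close>

lemma dense_two_two_edges:
  assumes a: "card A2 = 2" and b: "card B2 = 2" and H: dense
    and fam: "\<forall>x y. E x y \<longrightarrow> wit x y (P x y) (R x y)"
  shows "x \<in> A2 \<Longrightarrow> card (N x \<inter> B2) = card (B1 - N x)"
    and "x \<in> A2 \<Longrightarrow> y \<in> N x \<inter> B2 \<Longrightarrow> card (R x y \<inter> B1) = 1"
    and "6 \<le> n" and "card (edge_pairs E A B) + 10 = 5 * n"
proof -
  have w: "\<And>x y. E x y \<Longrightarrow> wit x y (P x y) (R x y)" using fam by blast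
  have S0: "{y \<in> N z \<inter> B2. R z y \<subseteq> B2} = {}" if "z \<in> A2" for z
  proof -
    have "card {y \<in> N z \<inter> B2. R z y \<subseteq> B2} = 0" using witness_cover(3)[OF that w] b by linarith
    moreover have "finite {y \<in> N z \<inter> B2. R z y \<subseteq> B2}" by (rule finite_subset[of _ B2]) auto
    ultimately show ?thesis by (simp only: card_0_eq)
  qed
  have le: "card (N z \<inter> B2) \<le> card (B1 - N z)" if z: "z \<in> A2" for z
    using witness_cover(2)[OF z w] unfolding S0[OF z] by simp
  have ge: "card (edge_pairs E A2 B2) \<ge> (\<Sum>x\<in>A2. card (B1 - N x))"
    using H card_cubic_edges_two[OF a] a b unfolding dense_iff by linarith
  have eq: "card (N z \<inter> B2) = card (B1 - N z)" if z: "z \<in> A2" for z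
  proof (rule ccontr)
    assume "\<not> ?thesis"
    then have "\<exists>z\<in>A2. card (N z \<inter> B2) < card (B1 - N z)" using le[OF z] z by (metis le_neq_implies_less)
    then have "(\<Sum>x\<in>A2. card (N x \<inter> B2)) < (\<Sum>x\<in>A2. card (B1 - N x))"
      using le by (intro sum_strict_mono_ex1) auto
    then show False using ge unfolding card_noncubic_edges_two by linarith
  qed
  then show "x \<in> A2 \<Longrightarrow> card (N x \<inter> B2) = card (B1 - N x)" .
  have "card (edge_pairs E A2 B2) = (\<Sum>x\<in>A2. card (B1 - N x))"
    unfolding card_noncubic_edges_two using eq by simp
  then show m: "card (edge_pairs E A B) + 10 = 5 * n"
    using card_cubic_edges_two[OF a] card_edges a b by linarith
  show "6 \<le> n" using m card_edges_ge a by linarith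
  assume x: "x \<in> A2" and y: "y \<in> N x \<inter> B2"
  have ge1: "1 \<le> card (R x v \<inter> B1)" if v: "v \<in> N x \<inter> B2" for v
  proof -
    have "R x v \<subseteq> B" using witD(2)[OF w] v by blast
    then have "R x v \<inter> B1 \<noteq> {}" using S0[OF x] v classes by blast
    then show ?thesis by (simp add: Suc_le_eq card_gt_0_iff)
  qed
  show "card (R x y \<inter> B1) = 1"
  proof (rule ccontr)
    assume "\<not> ?thesis"
    then have "\<exists>v\<in>N x \<inter> B2. 1 < card (R x v \<inter> B1)" using ge1[OF y] y by (metis le_neq_implies_less)
    then have "(\<Sum>v\<in>N x \<inter> B2. 1) < (\<Sum>v\<in>N x \<inter> B2. card (R x v \<inter> B1))"
      using ge1 by (intro sum_strict_mono_ex1) auto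
    then show False using witness_cover(1)[OF x w] eq[OF x] by simp
  qed
qed

text \<open>Excludes an edge of \<open>F\<close> whose \<open>P\<close> contains all of
  \<open>A2\<close>. The exact counts force n = 6 and exactly two disjoint edges in
  \<open>F\<close>, and then fix enough neighbourhoods to exhibit two independent sets of three
  vertices.\<close>

lemma dense_two_two_left:
  assumes a: "card A2 = 2" and b: "card B2 = 2" and H: dense
    and fam: "\<forall>x y. E x y \<longrightarrow> wit x y (P x y) (R x y)"
    and x: "x \<in> A2" and y: "y \<in> B2" and xy: "E x y" and sub: "A2 \<subseteq> P x y"
  shows False
proof -
  interpret d: min_expanding B A "\<lambda>y x. E x y" n by (rule flip)
  have dH: "5 * n \<le> card (edge_pairs (\<lambda>y x. E x y) B A) + 10" using H by (simp add: card_edge_pairs_flip[of E])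
  have w: "\<And>x y. E x y \<Longrightarrow> wit x y (P x y) (R x y)" using fam by blast
  have dw: "\<forall>v u. E u v \<longrightarrow> witness B A (\<lambda>y x. E x y) v u (R u v) (P u v)" using wit_flip[OF w] by blast
  note prim = dense_two_two_edges[of P R, OF a b H fam]
  note dual = d.dense_two_two_edges[of "\<lambda>v u. R u v" "\<lambda>v u. P u v", OF b a dH dw]
  have single: "S = {s}" if "card S = 1" "s \<in> S" for S and s :: 'c
    using that by (auto simp: card_1_singleton_iff)
  have "card (A2 - {x}) = 1" using a x by simp
  then obtain x' where "A2 - {x} = {x'}" by (meson card_1_singletonE)
  then have A2: "A2 = {x, x'}" "x' \<noteq> x" using x by blast+
  have cPR: "card (P u v) = card (P u v \<inter> A2) + 1" "card (R u v) = card (R u v \<inter> B2) + 1"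
    if "u \<in> A2" "v \<in> B2" "E u v" for u v
  proof -
    have "card (R u v \<inter> B1) = 1" "card (P u v \<inter> A1) = 1"
      using prim(2)[of u v] dual(2)[of v u] that by simp_all
    moreover have "P u v - A2 = P u v \<inter> A1" "R u v - B2 = R u v \<inter> B1"
      using witD(1,2)[OF w[OF that(3)]] classes by blast+
    ultimately show "card (P u v) = card (P u v \<inter> A2) + 1" "card (R u v) = card (R u v \<inter> B2) + 1"
      using card_Int_Diff[OF witD(7)[OF w[OF that(3)]], of A2] card_Int_Diff[OF witD(8)[OF w[OF that(3)]], of B2]
      by simp_all
  qed
  note D = witD[OF w[OF xy]]
  have "card (R x y \<inter> B1) = 1" using prim(2)[OF x] y xy by simp
  then obtain r where r: "R x y \<inter> B1 = {r}" by (meson card_1_singletonE)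
  have "card (P x y \<inter> A1) = 1" using dual(2)[OF y] x xy by simp
  then obtain p where p: "P x y \<inter> A1 = {p}" by (meson card_1_singletonE)
  have rB: "r \<in> B1" "r \<in> R x y" "r \<noteq> y" using r y classes by blast+
  have pA: "p \<in> A1" "p \<in> P x y" "p \<noteq> x" using p x classes by blast+
  have x'P: "x' \<in> P x y" using sub A2 by blast
  have nr: "\<not> E x r" "\<not> E x' r" "\<not> E p r" "\<not> E p y" "\<not> E x' y"
    using D(6)[of _ r] D(6)[of _ y] D(3,4) rB pA x'P A2 by blast+
  \<comment> \<open>As \<open>x'\<close> misses the cubic \<open>r\<close>, the equality of the two
    counts provides a noncubic neighbour \<open>y'\<close> of \<open>x'\<close>.\<close>
  have "r \<in> B1 - N x'" using rB nr by blast
  then have "card (B1 - N x') \<noteq> 0" by auto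
  then have "card (N x' \<inter> B2) \<noteq> 0" using prim(1)[of x'] A2 by simp
  then obtain y' where y': "y' \<in> B2" "E x' y'" by (metis card.empty disjoint_iff mem_Collect_eq)
  have yy': "y' \<noteq> y" using y' nr by blast
  have B2: "B2 = {y, y'}" using b y y'(1) yy' by (auto simp: card_2_iff)
  have y'R: "y' \<notin> R x y" using D(6)[OF x'P, of y'] y' yy' by blast
  have "R x y \<inter> B2 = {y}" using B2 y'R D(4) by blast
  then have "card (R x y) = 2" using cPR(2)[OF x y xy] by simp
  moreover have "P x y \<inter> A2 = A2" using sub by blast
  then have "card (P x y) = 3" using cPR(1)[OF x y xy] a by simp
  ultimately have n: "n = 6" using D(5) by simp
  \<comment> \<open>A witness of this edge would have one noncubic and one cubic vertex on each
    side, a total of four instead of five.\<close>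
  have nxy': "\<not> E x y'"
  proof
    assume e: "E x y'"
    note D' = witD[OF w[OF e]]
    have "x' \<notin> P x y'" using D'(6)[OF _ D'(4), of x'] y'(2) A2 by blast
    then have "P x y' \<inter> A2 = {x}" using A2 D'(3) by blast
    moreover have "y \<notin> R x y'" using D'(6)[OF D'(3), of y] xy yy' by blast
    then have "R x y' \<inter> B2 = {y'}" using B2 D'(4) by auto
    ultimately show False using cPR[OF x y'(1) e] D'(5) n by simp
  qed
  have "N x' \<inter> B2 = {y'}" using B2 y' nr by auto
  then have "card (B1 - N x') = 1" using prim(1)[of x'] A2 by simp
  then have miss': "B1 - N x' = {r}" using \<open>r \<in> B1 - N x'\<close> by (intro single)
  note e' = y'(2)
  note D' = witD[OF w[OF e']]
  have x'2: "x' \<in> A2" using A2 by blast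
  have "card (R x' y' \<inter> B1) = 1" using prim(2)[OF x'2] y' by simp
  then obtain r' where r': "R x' y' \<inter> B1 = {r'}" by (meson card_1_singletonE)
  have "r' \<noteq> y'" using r' y' classes by blast
  then have "\<not> E x' r'" using D'(6)[OF D'(3), of r'] r' by blast
  then have "r' = r" using r' miss' by blast
  have "card (P x' y' \<inter> A1) = 1" using dual(2)[OF y'(1)] x'2 y' by simp
  then obtain p' where p': "P x' y' \<inter> A1 = {p'}" by (meson card_1_singletonE)
  have "p' \<noteq> x'" using p' x'2 classes by blast
  then have np': "\<not> E p' r" "\<not> E p' y'" "p' \<in> A1"
    using D'(6)[of p' r] D'(6)[of p' y'] p' r' \<open>r' = r\<close> D'(4) by blast+
  have "u \<notin> A2" if "E u r" for u using that nr(1,2) A2(1) by auto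
  then have Mr: "{u. E u r} \<subseteq> A1" using d.N_sub[of r] classes by blast
  have cA1: "card A1 = 4" "card B1 = 4" using card_classes a b n by simp_all
  have "card (A1 - {u. E u r}) = 1"
    using d.card_N_cubics[OF rB(1)] Mr cA1 by (simp add: card_Diff_subset)
  then have Mr': "A1 - {u. E u r} = {p}" using pA nr(3) by (intro single) auto
  then have "p' = p" using np' by blast
  have "{u. E u y} \<inter> A2 = {x}" "{u. E u y'} \<inter> A2 = {x'}" using A2 xy y' nr nxy' by auto
  then have "card (A1 - {u. E u y}) = 1" "card (A1 - {u. E u y'}) = 1"
    using dual(1)[OF y] dual(1)[OF y'(1)] by simp_all
  moreover have "p \<in> A1 - {u. E u y}" "p \<in> A1 - {u. E u y'}" using pA nr np' \<open>p' = p\<close> by blast+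
  ultimately have My: "A1 - {u. E u y} = {p}" "A1 - {u. E u y'} = {p}"
    by (auto intro!: single simp del: Diff_iff)
  \<comment> \<open>Each of \<open>y\<close>, \<open>y'\<close> and \<open>r\<close> misses only
    \<open>p\<close> in \<open>A1\<close>. So the other three vertices of \<open>A1\<close> have no
    neighbours besides them.\<close>
  have Nu: "N u = {y, y', r}" if u: "u \<in> A1 - {p}" for u
  proof (rule card_seteq[symmetric])
    have "u \<notin> A1 - {u. E u y}" "u \<notin> A1 - {u. E u y'}" "u \<notin> A1 - {u. E u r}"
      unfolding My Mr' using u by simp_all
    then show "{y, y', r} \<subseteq> N u" using u by simp
    have "r \<noteq> y'" using rB y' classes by blast
    then show "card (N u) \<le> card {y, y', r}" using u yy' rB card_N_cubics[of u] by simp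
  qed simp
  have "card (A1 - {p}) + card (B1 - {r}) + 2 \<le> n"
  proof (rule indep)
    have "card (A1 - {p}) = 3" "card (B1 - {r}) = 3" using cA1 pA rB by simp_all
    then show "A1 - {p} \<noteq> {}" "B1 - {r} \<noteq> {}" by (metis card.empty zero_neq_numeral)+
    show "\<not> E u v" if "u \<in> A1 - {p}" "v \<in> B1 - {r}" for u v
    proof -
      have "v \<notin> B2" using that(2) classes by blast
      then have "v \<notin> {y, y', r}" using that(2) y y'(1) by blast
      then have "v \<notin> N u" unfolding Nu[OF that(1)] .
      then show ?thesis by blast
    qed
  qed (use classes in blast)+
  then show False using cA1 pA rB n by simp
qed

text \<open>A witness of an edge of \<open>F\<close> would have one cubic vertex on each side and,
  as n \<ge> 6, at least three noncubic ones. So it would contain \<open>A2\<close> or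
  \<open>B2\<close>, which the preceding lemma excludes in both orientations.\<close>

lemma dense_two_two:
  assumes a: "card A2 = 2" and b: "card B2 = 2" and H: dense
  shows "edge_pairs E A2 B2 = {}" and "x \<in> A2 \<Longrightarrow> B1 \<subseteq> N x" and "card (edge_pairs E A B) + 10 = 5 * n"
proof -
  interpret d: min_expanding B A "\<lambda>y x. E x y" n by (rule flip)
  have dH: "5 * n \<le> card (edge_pairs (\<lambda>y x. E x y) B A) + 10" using H by (simp add: card_edge_pairs_flip[of E])
  obtain P R where fam: "\<forall>x y. E x y \<longrightarrow> wit x y (P x y) (R x y)" using ex_witnesses by blast
  have w: "\<And>x y. E x y \<Longrightarrow> wit x y (P x y) (R x y)" using fam by blast
  have dw: "\<forall>v u. E u v \<longrightarrow> witness B A (\<lambda>y x. E x y) v u (R u v) (P u v)" using wit_flip[OF w] by blast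
  note prim = dense_two_two_edges[of P R, OF a b H fam]
  note dual = d.dense_two_two_edges[of "\<lambda>v u. R u v" "\<lambda>v u. P u v", OF b a dH dw]
  show m: "card (edge_pairs E A B) + 10 = 5 * n" by (rule prim(4))
  show emp: "edge_pairs E A2 B2 = {}"
  proof (rule ccontr)
    assume "\<not> ?thesis"
    then obtain x y where e: "x \<in> A2" "y \<in> B2" "E x y" by (auto simp: edge_pairs_def)
    note D = witD[OF w[OF e(3)]]
    have "card (R x y \<inter> B1) = 1" "card (P x y \<inter> A1) = 1"
      using prim(2)[of x y] dual(2)[of y x] e by simp_all
    moreover have "P x y - A2 = P x y \<inter> A1" "R x y - B2 = R x y \<inter> B1"
      using D(1,2) classes by blast+
    ultimately have "card (P x y) = card (P x y \<inter> A2) + 1" "card (R x y) = card (R x y \<inter> B2) + 1"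
      using card_Int_Diff[OF D(7), of A2] card_Int_Diff[OF D(8), of B2] by simp_all
    then have "card (P x y \<inter> A2) + card (R x y \<inter> B2) \<ge> 3" using D(5) prim(3) by linarith
    moreover have "\<not> A2 \<subseteq> P x y" using dense_two_two_left[OF a b H fam e] by blast
    then have "card (P x y \<inter> A2) < card A2" by (intro psubset_card_mono) auto
    moreover have "\<not> B2 \<subseteq> R x y"
      using d.dense_two_two_left[OF b a dH dw, of y x] e by blast
    then have "card (R x y \<inter> B2) < card B2" by (intro psubset_card_mono) auto
    ultimately show False using a b by linarith
  qed
  show "B1 \<subseteq> N x" if x: "x \<in> A2"
  proof -
    have "N x \<inter> B2 = {}" using emp x by (auto simp: edge_pairs_def)
    then have "card (B1 - N x) = 0" using prim(1)[OF x] by simp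
    then show ?thesis by simp
  qed
qed

text \<open>Here |P| = 3 and |B - R| = 4, so the vertices \<open>u\<close>, \<open>v\<close> of
  degree at least four are twins with neighbourhood B - R. Two common noncubic neighbours would
  close a 4-cycle in \<open>F\<close>.\<close>

lemma witness_noncubic_left:
  assumes a: "card A2 = 3" and w: "wit x y P R" and y: "y \<in> B2" and e: "E x y" and P: "P \<subseteq> A2"
  obtains u v where "A2 = {x, u, v}" "x \<noteq> u" "x \<noteq> v" "u \<noteq> v" "P = A2" "N v = N u" "card (B - R) = 4"
    "card (N u \<inter> B2) \<le> 1" "N x \<inter> B2 \<subseteq> insert y (N u \<inter> B2)"
proof -
  note D = witD[OF w]
  have PA: "P = A2" using card_witness_ge3[OF w P] a P by (intro card_seteq) auto
  then have x: "x \<in> A2" using D(3) by blast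
  obtain u v where A2: "A2 = {x, u, v}" "x \<noteq> u" "x \<noteq> v" "u \<noteq> v"
  proof -
    have "card (A2 - {x}) = 2" using a x by simp
    then obtain u v where "A2 - {x} = {u, v}" "u \<noteq> v" by (auto simp: card_2_iff)
    then show ?thesis using that[of u v] x by blast
  qed
  have c4: "card (B - R) = 4" using card_minus_witness[OF w] PA a by simp
  have eq: "N z = B - R" if "z \<in> A2" "z \<noteq> x" for z
  proof (rule card_seteq)
    show "N z \<subseteq> B - R" using N_disj_witness[OF w] that PA by blast
    show "card (B - R) \<le> card (N z)" using c4 card_N_noncubics[OF that(1)] by simp
  qed (use fin in simp)
  have uv: "N u = B - R" "N v = B - R" using eq A2 by blast+
  have "card (N u \<inter> B2) \<le> 1"
  proof (rule ccontr)
    assume "\<not> ?thesis"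
    then have "2 \<le> card (N u \<inter> B2)" by simp
    then obtain s t where "s \<in> N u \<inter> B2" "t \<in> N u \<inter> B2" "s \<noteq> t"
      by (metis ex_two_elements)
    then show False using no_four_cycle[of u v s t] uv A2 by blast
  qed
  moreover have "N x \<inter> B2 \<subseteq> insert y (N u \<inter> B2)"
  proof
    fix s assume s: "s \<in> N x \<inter> B2"
    then show "s \<in> insert y (N u \<inter> B2)" using D(6)[OF D(3), of s] uv N_sub[of x] by blast
  qed
  ultimately show ?thesis using that[of u v] A2 PA uv c4 by simp
qed

lemma card_noncubic_edges_le4:
  assumes a: "card A2 = 3" and w: "wit x y P R" and y: "y \<in> B2" and e: "E x y" and P: "P \<subseteq> A2"
  shows "card (edge_pairs E A2 B2) \<le> 4"
proof -
  obtain u v where uv: "A2 = {x, u, v}" "x \<noteq> u" "x \<noteq> v" "u \<noteq> v" "N v = N u"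
    "card (N u \<inter> B2) \<le> 1" "N x \<inter> B2 \<subseteq> insert y (N u \<inter> B2)"
    by (rule witness_noncubic_left[OF a w y e P]) blast
  have "card (N x \<inter> B2) \<le> card (insert y (N u \<inter> B2))" using uv(7) by (intro card_mono) auto
  also have "\<dots> \<le> 1 + card (N u \<inter> B2)" by (simp add: card_insert_if)
  finally show ?thesis unfolding card_noncubic_edges_two using uv by simp
qed

text \<open>Density forces |F| = 6 and t = 0, so no witness of an edge of \<open>F\<close> has cubic
  vertices on both sides. A \<open>P\<close> inside \<open>A2\<close> would limit |F| to four, so
  each \<open>R\<close> lies in \<open>B2\<close> and has at least three of its four vertices.
  Disjointness then leaves one edge of \<open>F\<close> per vertex of \<open>A2\<close>.\<close>

lemma dense_three_four:
  assumes a: "card A2 = 3" and b: "card B2 = 4" and H: dense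
  shows False
proof -
  obtain P R where w: "\<And>x y. E x y \<Longrightarrow> wit x y (P x y) (R x y)" using ex_witnesses by blast
  have F6: "6 \<le> card (edge_pairs E A2 B2)"
    using H card_cubic_edges_ge a b unfolding dense_iff by linarith
  then have "edge_pairs E A2 B2 \<noteq> {}" by auto
  then have e11: "card (edge_pairs E A1 B1) + card A2 + card B2 = n + 2"
    using H card_noncubic_edges card_cubic_edges_ge a b unfolding dense_iff by linarith
  have RB: "R x y \<subseteq> B2" if e: "x \<in> A2" "y \<in> B2" "E x y" for x y
  proof -
    have "P x y \<inter> A1 = {} \<or> R x y \<inter> B1 = {}"
      using cubic_cut_by_witness(1)[OF w[OF e(3)] e(1,2)] e11 a b by fastforce
    moreover have "P x y \<inter> A1 \<noteq> {}"
    proof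
      assume "P x y \<inter> A1 = {}"
      then have "P x y \<subseteq> A2" using witD(1)[OF w[OF e(3)]] classes by blast
      then show False using card_noncubic_edges_le4[OF a w[OF e(3)] e(2,3)] F6 by simp
    qed
    ultimately show ?thesis using witD(2)[OF w[OF e(3)]] classes by blast
  qed
  have "card (N x \<inter> B2) \<le> 1" if x: "x \<in> A2" for x
  proof -
    have "{y \<in> N x \<inter> B2. R x y \<subseteq> B2} = N x \<inter> B2" using RB x by blast
    then show ?thesis using witness_cover(3)[OF x w] b by simp
  qed
  then have "(\<Sum>x\<in>A2. card (N x \<inter> B2)) \<le> (\<Sum>x\<in>A2. 1)" by (rule sum_mono)
  then show False using F6 a by (simp add: card_noncubic_edges_two)
qed

text \<open>Now |F| = 4, t = 0, and all of \<open>A2\<close> is adjacent to one noncubic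
  \<open>z\<close>. A witness of an edge from a twin to \<open>z\<close> cannot have
  \<open>P\<close> inside \<open>A2\<close>, since \<open>x\<close> is adjacent to \<open>z\<close>
  too; so it has \<open>R\<close> equal to \<open>B2\<close>. Uncrossing two of them gives n \<le>
  4, although B - R has four vertices and misses \<open>y\<close>.\<close>

lemma dense_three_three_left:
  assumes a: "card A2 = 3" and b: "card B2 = 3" and H: dense
    and w: "wit x y P R" and y: "y \<in> B2" and e: "E x y" and P: "P \<subseteq> A2"
  shows False
proof -
  interpret d: min_expanding B A "\<lambda>y x. E x y" n by (rule flip)
  obtain u v where uv: "A2 = {x, u, v}" "x \<noteq> u" "x \<noteq> v" "u \<noteq> v" "N v = N u" "card (B - R) = 4"
    "card (N u \<inter> B2) \<le> 1" "N x \<inter> B2 \<subseteq> insert y (N u \<inter> B2)"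
    by (rule witness_noncubic_left[OF a w y e P]) blast
  have F4: "4 \<le> card (edge_pairs E A2 B2)"
    using H card_cubic_edges_ge a b unfolding dense_iff by linarith
  have e11: "card (edge_pairs E A1 B1) + card A2 + card B2 = n + 2"
    using H card_noncubic_edges_le4[OF a w y e P] card_cubic_edges_ge a b unfolding dense_iff by linarith
  have sum: "card (edge_pairs E A2 B2) = card (N x \<inter> B2) + 2 * card (N u \<inter> B2)"
    unfolding card_noncubic_edges_two using uv(1-5) by simp
  have "card (N x \<inter> B2) \<le> card (insert y (N u \<inter> B2))" using uv(8) by (intro card_mono) auto
  also have "\<dots> \<le> 1 + card (N u \<inter> B2)" by (simp add: card_insert_if)
  finally have "card (N u \<inter> B2) = 1" "2 \<le> card (N x \<inter> B2)" using sum F4 uv(7) by linarith+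
  then obtain z where z: "N u \<inter> B2 = {z}" by (meson card_1_singletonE)
  have "z \<in> N x"
  proof (rule ccontr)
    assume "z \<notin> N x"
    then have "N x \<inter> B2 \<subseteq> {y}" using uv(8) unfolding z by blast
    then have "card (N x \<inter> B2) \<le> card {y}" by (intro card_mono) auto
    then show False using \<open>2 \<le> card (N x \<inter> B2)\<close> by simp
  qed
  have RB: "R' = B2" if q: "q \<in> A2" "q \<noteq> x" "E q z" "wit q z P' R'" for q P' R'
  proof -
    have zB: "z \<in> B2" using z by blast
    have "P' \<inter> A1 \<noteq> {}"
    proof
      assume "P' \<inter> A1 = {}"
      then have "P' \<subseteq> A2" using witD(1)[OF q(4)] classes by blast
      then have "P' = A2" using card_witness_ge3[OF q(4)] a by (intro card_seteq) auto
      then have "x \<in> P'" using uv(1) by simp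
      then show False using witD(6)[OF q(4) _ witD(4)[OF q(4)], of x] \<open>z \<in> N x\<close> q(2) by simp
    qed
    then have "R' \<inter> B1 = {}"
      using cubic_cut_by_witness(1)[OF q(4,1) zB] e11 a b by fastforce
    then have "R' \<subseteq> B2" using witD(2)[OF q(4)] classes by blast
    then show ?thesis using d.card_witness_ge3[OF wit_flip[OF q(4)]] b by (intro card_seteq) auto
  qed
  have ez: "z \<in> B2" "E u z" "E v z" using z uv(5) by blast+
  obtain P' R' P'' R'' where w': "wit u z P' R'" "wit v z P'' R''" using ex_witness ez by metis
  have "R' = B2" by (rule RB[OF _ _ ez(2) w'(1)]) (use uv(1-3) in auto)
  have "R'' = B2" by (rule RB[OF _ _ ez(3) w'(2)]) (use uv(1-3) in auto)
  then have "n \<le> 4"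
    using d.witness_share(2)[OF ez(1) wit_flip[OF w'(1)] wit_flip[OF w'(2)] ez(2,3) uv(4)] b \<open>R' = B2\<close> by simp
  moreover have "card (B - R) < card B"
    using fin witD(2,4)[OF w] by (intro psubset_card_mono) auto
  ultimately show False using uv(6) cards by simp
qed

text \<open>All witnesses of edges of \<open>F\<close> have cubic vertices on both sides, so t = 1,
  |F| \<ge> 5, and the tightness clauses hold for each of them. Combined for two edges of
  \<open>F\<close> with a common end, whose \<open>R\<close> (or \<open>P\<close>) are disjoint,
  they make the edges between cubic vertices a perfect matching of \<open>A1\<close> and
  \<open>B1\<close>.\<close>

lemma dense_three_three:
  assumes a: "card A2 = 3" and b: "card B2 = 3" and H: dense
  shows False
proof -
  interpret d: min_expanding B A "\<lambda>y x. E x y" n by (rule flip)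
  have dH: "5 * n \<le> card (edge_pairs (\<lambda>y x. E x y) B A) + 10" using H by (simp add: card_edge_pairs_flip[of E])
  have ne: "P \<inter> A1 \<noteq> {}" "R \<inter> B1 \<noteq> {}" if w: "wit x y P R" and e: "x \<in> A2" "y \<in> B2" "E x y" for x y P R
  proof -
    show "P \<inter> A1 \<noteq> {}"
    proof
      assume "P \<inter> A1 = {}"
      then have "P \<subseteq> A2" using witD(1)[OF w] classes by blast
      then show False by (rule dense_three_three_left[OF a b H w e(2,3)])
    qed
    show "R \<inter> B1 \<noteq> {}"
    proof
      assume "R \<inter> B1 = {}"
      then have "R \<subseteq> B2" using witD(2)[OF w] classes by blast
      then show False by (rule d.dense_three_three_left[OF b a dH wit_flip[OF w] e(1,3)])
    qed
  qed
  have F4: "4 \<le> card (edge_pairs E A2 B2)"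
    using H card_cubic_edges_ge a b unfolding dense_iff by linarith
  then have Fne: "edge_pairs E A2 B2 \<noteq> {}" by auto
  then obtain x0 y0 where e0: "x0 \<in> A2" "y0 \<in> B2" "E x0 y0" by (auto simp: edge_pairs_def)
  obtain P0 R0 where w0: "wit x0 y0 P0 R0" using ex_witness[OF e0(3)] by blast
  have "n + 3 \<le> card (edge_pairs E A1 B1) + card A2 + card B2"
    using cubic_cut_by_witness(1)[OF w0 e0(1,2) ne[OF w0 e0]] a b by simp
  then have e11: "card (edge_pairs E A1 B1) + card A2 + card B2 = n + 3" and F5: "5 \<le> card (edge_pairs E A2 B2)"
    using H card_noncubic_edges[OF Fne] a b unfolding dense_iff by linarith+
  have cut: "(\<forall>u\<in>A1. \<forall>v\<in>B1. E u v \<longrightarrow> u \<in> P \<or> v \<in> R) \<and>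
      (\<forall>v\<in>B1. \<forall>u\<in>P \<inter> A1. \<forall>u'\<in>P \<inter> A1. E u v \<longrightarrow> E u' v \<longrightarrow> u = u') \<and>
      (\<forall>u\<in>A1. \<forall>v\<in>R \<inter> B1. \<forall>v'\<in>R \<inter> B1. E u v \<longrightarrow> E u v' \<longrightarrow> v = v')"
    if "wit x y P R" "x \<in> A2" "y \<in> B2" "E x y" for x y P R
    using cubic_cut_by_witness(2)[OF that(1-3) ne[OF that] _ _ e11] a b by simp
  have big: "\<exists>x\<in>A2. 2 \<le> card (N x \<inter> B2)"
  proof (rule ccontr)
    assume "\<not> ?thesis"
    then have "\<And>x. x \<in> A2 \<Longrightarrow> card (N x \<inter> B2) \<le> 1" by force
    then have "(\<Sum>x\<in>A2. card (N x \<inter> B2)) \<le> (\<Sum>x\<in>A2. 1)" by (rule sum_mono)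
    then show False using F5 a by (simp add: card_noncubic_edges_two)
  qed
  have big': "\<exists>y\<in>B2. 2 \<le> card ({u. E u y} \<inter> A2)"
  proof (rule ccontr)
    assume "\<not> ?thesis"
    then have "\<And>y. y \<in> B2 \<Longrightarrow> card ({u. E u y} \<inter> A2) \<le> 1" by force
    then have "(\<Sum>y\<in>B2. card ({u. E u y} \<inter> A2)) \<le> (\<Sum>y\<in>B2. 1)" by (rule sum_mono)
    then show False using F5 b d.card_noncubic_edges_two by (simp add: card_edge_pairs_flip[of E])
  qed
  obtain x where x: "x \<in> A2" "2 \<le> card (N x \<inter> B2)" using big by blast
  then obtain y y' where y: "y \<in> N x \<inter> B2" "y' \<in> N x \<inter> B2" "y \<noteq> y'"
    by (metis ex_two_elements)
  obtain z where z: "z \<in> B2" "2 \<le> card ({u. E u z} \<inter> A2)" using big' by blast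
  then obtain s t where s: "s \<in> {u. E u z} \<inter> A2" "t \<in> {u. E u z} \<inter> A2" "s \<noteq> t"
    by (metis ex_two_elements)
  have ey: "E x y" "E x y'" "y \<in> B2" "y' \<in> B2" using y by blast+
  have es: "E s z" "E t z" "s \<in> A2" "t \<in> A2" using s by blast+
  obtain P R P' R' where w: "wit x y P R" "wit x y' P' R'" using ex_witness ey by metis
  obtain Ps Rs Pt Rt where ws: "wit s z Ps Rs" "wit t z Pt Rt" using ex_witness es by metis
  note c = cut[OF w(1) x(1) ey(3,1)] and c' = cut[OF w(2) x(1) ey(4,2)]
  note cs = cut[OF ws(1) es(3) z(1) es(1)] and ct = cut[OF ws(2) es(4) z(1) es(2)]
  have RR: "R \<inter> R' = {}" using witness_share(1)[OF x(1) w ey(1,2) y(3)] .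
  have PP: "Ps \<inter> Pt = {}"
    using d.witness_share(1)[OF z(1) wit_flip[OF ws(1)] wit_flip[OF ws(2)] es(1,2) s(3)] .
  have one: "u = u'" if "v \<in> B1" "u \<in> A1" "u' \<in> A1" "E u v" "E u' v" for u u' v
  proof (cases "v \<in> R")
    case False
    then have "u \<in> P" "u' \<in> P" using c that by blast+
    then show ?thesis using c that by blast
  next
    case True
    then have "v \<notin> R'" using RR by blast
    then have "u \<in> P'" "u' \<in> P'" using c' that by blast+
    then show ?thesis using c' that by blast
  qed
  have one': "v = v'" if "u \<in> A1" "v \<in> B1" "v' \<in> B1" "E u v" "E u v'" for u v v'
  proof (cases "u \<in> Ps")
    case False
    then have "v \<in> Rs" "v' \<in> Rs" using cs that by blast+
    then show ?thesis using cs that by blast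
  next
    case True
    then have "u \<notin> Pt" using PP by blast
    then have "v \<in> Rt" "v' \<in> Rt" using ct that by blast+
    then show ?thesis using ct that by blast
  qed
  have "inj_on snd (edge_pairs E A1 B1)"
    by (rule inj_onI) (use one in \<open>auto simp: edge_pairs_def\<close>)
  then have "card (snd ` edge_pairs E A1 B1) = card B1"
    using e11 a b card_classes by (simp add: card_image)
  moreover have "snd ` edge_pairs E A1 B1 \<subseteq> B1" by (auto simp: edge_pairs_def)
  ultimately have im: "snd ` edge_pairs E A1 B1 = B1" by (intro card_subset_eq) auto
  \<comment> \<open>If \<open>v\<close> were outside R \<union> R', its partner \<open>u\<close>
    would miss \<open>y\<close> and \<open>y'\<close> and have at most two neighbours. So
    \<open>B1\<close> lies in R \<union> R', where \<open>x\<close> has no cubic neighbour, and its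
    degree is at most |B2| = 3.\<close>
  have "\<not> E x v" if v: "v \<in> B1" for v
  proof -
    have "v \<in> snd ` edge_pairs E A1 B1" using v im by simp
    then obtain u where u: "u \<in> A1" "E u v" by (auto simp: edge_pairs_def)
    have "v \<in> R \<or> v \<in> R'"
    proof (rule ccontr)
      assume "\<not> ?thesis"
      then have uP: "u \<in> P" "u \<in> P'" using c c' u v by blast+
      have "u \<noteq> x" using u x classes by blast
      then have "\<not> E u y" "\<not> E u y'" using witD(6)[OF w(1) uP(1)] witD(6)[OF w(2) uP(2)] witD(4)[OF w(1)] witD(4)[OF w(2)] by blast+
      then have "N u \<subseteq> insert v (B2 - {y, y'})" using one'[OF u(1) v _ u(2)] N_sub[of u] classes by blast
      then have "card (N u) \<le> card (insert v (B2 - {y, y'}))" by (intro card_mono) auto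
      also have "\<dots> \<le> Suc (card (B2 - {y, y'}))" by (simp add: card_insert_if)
      also have "card (B2 - {y, y'}) = 1" using ey y(3) b by (simp add: card_Diff_subset)
      finally show False using card_N_cubics[OF u(1)] by simp
    qed
    moreover have "v \<noteq> y" "v \<noteq> y'" using v ey classes by blast+
    ultimately show ?thesis using witD(6)[OF w(1) witD(3)[OF w(1)], of v] witD(6)[OF w(2) witD(3)[OF w(2)], of v] by blast
  qed
  then have "N x \<subseteq> B2" using N_sub[of x] classes by blast
  then have "card (N x) \<le> card B2" by (intro card_mono) auto
  then show False using card_N_noncubics[OF x(1)] b by simp
qed

lemma dense_two_two_if_le:
  assumes "2 \<le> card A2" "card A2 \<le> card B2" dense
  shows "card A2 = 2 \<and> card B2 = 2"
proof -
  have le: "card (edge_pairs E A2 B2) + 1 \<le> card A2 + card B2"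
    using card_noncubic_edges assms by (cases "edge_pairs E A2 B2 = {}") auto
  then have "card A2 + card B2 \<le> 7"
    using assms card_cubic_edges_ge unfolding dense_iff by linarith
  then have "card A2 = 2 \<and> card B2 = 2 \<or> card A2 = 2 \<and> card B2 = 3 \<or> card A2 = 2 \<and> 4 \<le> card B2
    \<or> card A2 = 3 \<and> card B2 = 3 \<or> card A2 = 3 \<and> card B2 = 4"
    using assms(1,2) by arith
  then show ?thesis
    using dense_two_three[OF _ _ assms(3)] dense_two_ge4[OF _ _ assms(3)]
      dense_three_three[OF _ _ assms(3)] dense_three_four[OF _ _ assms(3)] by blast
qed

theorem dense_noncubic_two:
  assumes a: "2 \<le> card A2" "2 \<le> card B2" and H: dense
  shows "card A2 = 2" "card B2 = 2" "edge_pairs E A2 B2 = {}" "\<And>x. x \<in> A2 \<Longrightarrow> B1 \<subseteq> N x"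
    "\<And>y. y \<in> B2 \<Longrightarrow> A1 \<subseteq> {x. E x y}" "card (edge_pairs E A B) + 10 = 5 * n"
proof -
  interpret d: min_expanding B A "\<lambda>y x. E x y" n by (rule flip)
  have dH: "5 * n \<le> card (edge_pairs (\<lambda>y x. E x y) B A) + 10" using H by (simp add: card_edge_pairs_flip[of E])
  show *: "card A2 = 2" "card B2 = 2"
    using dense_two_two_if_le[OF a(1) _ H] d.dense_two_two_if_le[OF a(2) _ dH] by (meson nle_le)+
  show "edge_pairs E A2 B2 = {}" "\<And>x. x \<in> A2 \<Longrightarrow> B1 \<subseteq> N x" "card (edge_pairs E A B) + 10 = 5 * n"
    using dense_two_two[OF * H] by blast+
  show "\<And>y. y \<in> B2 \<Longrightarrow> A1 \<subseteq> {x. E x y}" using d.dense_two_two(2)[OF *(2,1) dH] .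
qed

end

section \<open>Cycles\<close>

lemma two_elements:
  assumes "card S = 2" "s \<in> S" "t \<in> S" "s \<noteq> t" "u \<in> S"
  shows "u = s \<or> u = t"
  using assms by (auto simp: card_2_iff)

lemma other_element:
  assumes "card S = 2" "s \<in> S"
  obtains t where "t \<in> S" "t \<noteq> s"
  using assms by (auto simp: card_2_iff)

text \<open>The path \<alpha>(0), \<beta>(0), \<alpha>(1), ..., \<beta>(j - 1), \<alpha>(j): it
  starts and ends in \<open>A\<close>, hence the different index ranges.\<close>

definition alt_path :: "'a set \<Rightarrow> 'b set \<Rightarrow> ('a \<Rightarrow> 'b \<Rightarrow> bool) \<Rightarrow> nat \<Rightarrow> (nat \<Rightarrow> 'a) \<Rightarrow> (nat \<Rightarrow> 'b) \<Rightarrow> bool" where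
  "alt_path A B H j \<alpha> \<beta> \<longleftrightarrow> inj_on \<alpha> {..j} \<and> inj_on \<beta> {..<j} \<and> \<alpha> ` {..j} \<subseteq> A \<and> \<beta> ` {..<j} \<subseteq> B \<and>
     (\<forall>i<j. H (\<alpha> i) (\<beta> i) \<and> H (\<alpha> (Suc i)) (\<beta> i))"

text \<open>\<open>conn\<close> is connectedness in the form in which expansion supplies it: the
  \<open>A\<close>-vertices of a cycle that does not exhaust \<open>A\<close> would have only as
  many neighbours as there are of them.\<close>

locale two_regular =
  fixes A :: "'a set" and B :: "'b set" and H :: "'a \<Rightarrow> 'b \<Rightarrow> bool" and k :: nat
  assumes fin: "finite A" "finite B"
    and cards: "card A = k" "card B = k" and k2: "2 \<le> k"
    and degA: "a \<in> A \<Longrightarrow> card {b \<in> B. H a b} = 2"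
    and degB: "b \<in> B \<Longrightarrow> card {a \<in> A. H a b} = 2"
    and conn: "X \<subset> A \<Longrightarrow> X \<noteq> {} \<Longrightarrow> card X < card {b \<in> B. \<exists>a\<in>X. H a b}"
begin

lemma path_step:
  assumes p: "alt_path A B H j \<alpha> \<beta>" and j: "j < k"
  obtains a b where "b \<in> B" "H (\<alpha> j) b" "b \<notin> \<beta> ` {..<j}" "a \<in> A" "H a b" "a \<noteq> \<alpha> j"
    "a \<in> \<alpha> ` {..j} \<longrightarrow> a = \<alpha> 0 \<and> Suc j = k"
proof -
  have inj: "inj_on \<alpha> {..j}" "inj_on \<beta> {..<j}"
    and inA: "\<And>i. i \<le> j \<Longrightarrow> \<alpha> i \<in> A" and inB: "\<And>i. i < j \<Longrightarrow> \<beta> i \<in> B"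
    and e: "\<And>i. i < j \<Longrightarrow> H (\<alpha> i) (\<beta> i)" "\<And>i. i < j \<Longrightarrow> H (\<alpha> (Suc i)) (\<beta> i)"
    using p by (auto simp: alt_path_def)
  have aneq: "\<alpha> i \<noteq> \<alpha> i'" if "i \<le> j" "i' \<le> j" "i \<noteq> i'" for i i'
    using inj(1) that by (auto simp: inj_on_def)
  have bneq: "\<beta> i \<noteq> \<beta> i'" if "i < j" "i' < j" "i \<noteq> i'" for i i'
    using inj(2) that by (auto simp: inj_on_def)
  have NB: "u = \<alpha> i \<or> u = \<alpha> (Suc i)" if "i < j" "u \<in> A" "H u (\<beta> i)" for i u
    using two_elements[OF degB[OF inB[OF that(1)]], of "\<alpha> i" "\<alpha> (Suc i)" u] that inA e aneq[of i "Suc i"] by auto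
  have NA: "v = \<beta> (i - 1) \<or> v = \<beta> i" if "0 < i" "i < j" "v \<in> B" "H (\<alpha> i) v" for i v
    using two_elements[OF degA[OF inA[of i]], of "\<beta> (i - 1)" "\<beta> i" v] that inB e(1)[of i] e(2)[of "i - 1"] bneq[of "i - 1" i]
    by auto
  have "\<exists>b. b \<in> B \<and> H (\<alpha> j) b \<and> (0 < j \<longrightarrow> b \<noteq> \<beta> (j - 1))"
  proof (cases "j = 0")
    case True
    have "card {b \<in> B. H (\<alpha> j) b} \<noteq> 0" using degA[OF inA[of j]] by simp
    then obtain b where "b \<in> {b \<in> B. H (\<alpha> j) b}" by (metis (no_types, lifting) card.empty ex_in_conv)
    then show ?thesis using True by blast
  next
    case False
    then have "\<beta> (j - 1) \<in> {b \<in> B. H (\<alpha> j) b}" using inB[of "j - 1"] e(2)[of "j - 1"] by simp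
    then show ?thesis using other_element[OF degA[OF inA[of j]]] by blast
  qed
  then obtain b where b: "b \<in> B" "H (\<alpha> j) b" "0 < j \<Longrightarrow> b \<noteq> \<beta> (j - 1)" by blast
  have bnew: "b \<noteq> \<beta> i" if i: "i < j" for i
  proof
    assume bi: "b = \<beta> i"
    then have "Suc i \<noteq> j" using b(3) i by auto
    moreover have "\<alpha> j = \<alpha> i \<or> \<alpha> j = \<alpha> (Suc i)" using NB[OF i, of "\<alpha> j"] inA b(2) bi by simp
    ultimately show False using aneq[of j i] aneq[of j "Suc i"] i by auto
  qed
  have "\<alpha> j \<in> {a \<in> A. H a b}" using inA b(2) by simp
  then obtain a where a: "a \<in> A" "H a b" "a \<noteq> \<alpha> j" using other_element[OF degB[OF b(1)]] by blast
  have "a = \<alpha> 0 \<and> Suc j = k" if hit: "a \<in> \<alpha> ` {..j}"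
  proof -
    obtain i where i: "i \<le> j" "a = \<alpha> i" using hit by auto
    then have ij: "i < j" using a(3) by (metis le_neq_implies_less)
    have "i = 0"
    proof (rule ccontr)
      assume "i \<noteq> 0"
      then have "b = \<beta> (i - 1) \<or> b = \<beta> i" using NA[of i b] ij b(1) a(2) i(2) by simp
      moreover have "i - 1 < j" using ij by linarith
      ultimately show False using bnew[of "i - 1"] bnew[of i] ij by blast
    qed
    moreover have "Suc j = k"
    proof (rule ccontr)
      assume "Suc j \<noteq> k"
      then have small: "Suc j < k" using j by simp
      let ?X = "\<alpha> ` {..j}"
      have cX: "card ?X = Suc j" using inj(1) by (simp add: card_image)
      then have "?X \<subset> A" using inA small cards by auto
      moreover have "?X \<noteq> {}" by auto
      ultimately have "Suc j < card {v \<in> B. \<exists>u\<in>?X. H u v}" using conn[of ?X] cX by simp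
      also have "{v \<in> B. \<exists>u\<in>?X. H u v} \<subseteq> insert b (\<beta> ` {..<j})"
      proof
        fix v assume "v \<in> {v \<in> B. \<exists>u\<in>?X. H u v}"
        then obtain i' where v: "v \<in> B" "i' \<le> j" "H (\<alpha> i') v" by auto
        have a0: "H (\<alpha> 0) b" "0 < j" using a(2) i(2) \<open>i = 0\<close> ij by auto
        consider "i' = 0" | "i' = j" "i' \<noteq> 0" | "0 < i'" "i' < j" using v(2) by linarith
        then show "v \<in> insert b (\<beta> ` {..<j})"
        proof cases
          case 1
          then have "v = \<beta> 0 \<or> v = b"
            using two_elements[OF degA[OF inA[of 0]], of "\<beta> 0" b v] v inB[of 0] e(1)[of 0] a0 b(1) bnew[of 0] by auto
          then show ?thesis using a0 by auto
        next
          case 2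
          then have "v = \<beta> (j - 1) \<or> v = b"
            using two_elements[OF degA[OF inA[of j]], of "\<beta> (j - 1)" b v] v inB[of "j - 1"] e(2)[of "j - 1"] b by auto
          then show ?thesis using a0 by auto
        next
          case 3
          then have "v = \<beta> (i' - 1) \<or> v = \<beta> i'" using NA[of i' v] v by simp
          moreover have "i' - 1 < j" using 3 by linarith
          ultimately show ?thesis using 3 by blast
        qed
      qed
      then have "card {v \<in> B. \<exists>u\<in>?X. H u v} \<le> card (insert b (\<beta> ` {..<j}))" by (intro card_mono) auto
      also have "\<dots> \<le> Suc (card (\<beta> ` {..<j}))" by (simp add: card_insert_if)
      also have "card (\<beta> ` {..<j}) \<le> j" using card_image_le[of "{..<j}" \<beta>] by simp
      finally show False by simp
    qed
    ultimately show ?thesis using i by simp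
  qed
  then show ?thesis using that[of b a] b a bnew by blast
qed

lemma ex_path: "j < k \<Longrightarrow> \<exists>\<alpha> \<beta>. alt_path A B H j \<alpha> \<beta>"
proof (induction j)
  case 0
  have "card A \<noteq> 0" using k2 cards by simp
  then obtain a where "a \<in> A" by (metis card.empty ex_in_conv)
  then have "alt_path A B H 0 (\<lambda>_. a) (\<lambda>_. undefined)" by (simp add: alt_path_def)
  then show ?case by blast
next
  case (Suc j)
  then obtain \<alpha> \<beta> where p: "alt_path A B H j \<alpha> \<beta>" by auto
  obtain a b where ab: "b \<in> B" "H (\<alpha> j) b" "b \<notin> \<beta> ` {..<j}" "a \<in> A" "H a b"
    "a \<in> \<alpha> ` {..j} \<longrightarrow> a = \<alpha> 0 \<and> Suc j = k"
    using path_step[OF p] Suc.prems by (metis Suc_lessD)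
  have new: "a \<notin> \<alpha> ` {..j}" using ab(6) Suc.prems by auto
  let ?\<alpha> = "\<alpha>(Suc j := a)" and ?\<beta> = "\<beta>(j := b)"
  have ia: "?\<alpha> ` {..j} = \<alpha> ` {..j}" "?\<beta> ` {..<j} = \<beta> ` {..<j}" by auto
  have "inj_on ?\<alpha> {..j}" "inj_on ?\<beta> {..<j}" using p by (auto simp: alt_path_def inj_on_def)
  then have "inj_on ?\<alpha> {..Suc j}" "inj_on ?\<beta> {..<Suc j}"
    using new ab(3) ia by (simp_all add: atMost_Suc lessThan_Suc)
  moreover have "?\<alpha> ` {..Suc j} \<subseteq> A" "?\<beta> ` {..<Suc j} \<subseteq> B"
    using p ab(1,4) unfolding atMost_Suc lessThan_Suc image_insert ia by (auto simp: alt_path_def)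
  moreover have "\<forall>i<Suc j. H (?\<alpha> i) (?\<beta> i) \<and> H (?\<alpha> (Suc i)) (?\<beta> i)"
    using p ab by (auto simp: alt_path_def less_Suc_eq)
  ultimately have "alt_path A B H (Suc j) ?\<alpha> ?\<beta>" unfolding alt_path_def by blast
  then show ?case by blast
qed

text \<open>Closes a path through all of \<open>A\<close>; \<beta>(j) is the vertex between
  \<alpha>(j) and its cyclic successor.\<close>

theorem ex_cycle:
  "\<exists>\<alpha> \<beta>. bij_betw \<alpha> {..<k} A \<and> bij_betw \<beta> {..<k} B \<and>
     (\<forall>i<k. \<forall>j<k. H (\<alpha> i) (\<beta> j) \<longleftrightarrow> j = i \<or> i = Suc j mod k)"
proof -
  define j where "j = k - 1"
  have j: "j < k" "Suc j = k" "0 < j" using k2 by (auto simp: j_def)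
  obtain \<alpha> \<beta> where p: "alt_path A B H j \<alpha> \<beta>" using ex_path[OF j(1)] by blast
  obtain a b where ab: "b \<in> B" "H (\<alpha> j) b" "b \<notin> \<beta> ` {..<j}" "a \<in> A" "H a b" "a \<noteq> \<alpha> j"
    "a \<in> \<alpha> ` {..j} \<longrightarrow> a = \<alpha> 0 \<and> Suc j = k"
    by (rule path_step[OF p j(1)])
  have sets: "{..j} = {..<k}" "insert j {..<j} = {..<k}" using j by auto
  have inja: "inj_on \<alpha> {..<k}" and subA: "\<alpha> ` {..<k} \<subseteq> A" using p unfolding alt_path_def sets by blast+
  have "\<alpha> ` {..<k} = A" using subA inja fin cards by (intro card_subset_eq) (auto simp: card_image)
  then have bA: "bij_betw \<alpha> {..<k} A" using inja by (simp add: bij_betw_def)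
  then have a0: "a = \<alpha> 0" using ab(4,7) sets by (auto simp: bij_betw_def)
  define \<gamma> where "\<gamma> = \<beta>(j := b)"
  have "\<gamma> ` {..<j} = \<beta> ` {..<j}" "inj_on \<gamma> {..<j}"
    using p by (auto simp: \<gamma>_def alt_path_def inj_on_def)
  then have injb: "inj_on \<gamma> {..<k}" and subB: "\<gamma> ` {..<k} \<subseteq> B"
    using ab(1,3) p by (auto simp: \<gamma>_def alt_path_def sets(2)[symmetric])
  have "\<gamma> ` {..<k} = B" using subB injb fin cards by (intro card_subset_eq) (auto simp: card_image)
  then have bB: "bij_betw \<gamma> {..<k} B" using injb by (simp add: bij_betw_def)
  have e1: "H (\<alpha> i) (\<gamma> i)" if "i < k" for i
    using p ab that j by (cases "i = j") (auto simp: \<gamma>_def alt_path_def)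
  have e2: "H (\<alpha> (Suc i mod k)) (\<gamma> i)" if "i < k" for i
  proof (cases "i = j")
    case True
    then show ?thesis using ab(5) a0 j by (simp add: \<gamma>_def)
  next
    case False
    then have "i < j" using that j by simp
    then show ?thesis using p j by (simp add: \<gamma>_def alt_path_def)
  qed
  have iff: "H (\<alpha> i) (\<gamma> l) \<longleftrightarrow> l = i \<or> i = Suc l mod k" if i: "i < k" and l: "l < k" for i l
  proof
    assume H: "H (\<alpha> i) (\<gamma> l)"
    have d: "Suc l mod k \<noteq> l" using l k2 by (cases "Suc l = k") auto
    have lt: "Suc l mod k < k" using k2 by simp
    have "\<alpha> l \<noteq> \<alpha> (Suc l mod k)" using inja l lt d by (auto simp: inj_on_def)
    moreover have "\<gamma> l \<in> B" "\<alpha> l \<in> A" "\<alpha> (Suc l mod k) \<in> A" "\<alpha> i \<in> A" using subA subB i l lt by auto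
    ultimately have "\<alpha> i = \<alpha> l \<or> \<alpha> i = \<alpha> (Suc l mod k)"
      using two_elements[OF degB, of "\<gamma> l" "\<alpha> l" "\<alpha> (Suc l mod k)" "\<alpha> i"] e1[OF l] e2[OF l] H by simp
    then show "l = i \<or> i = Suc l mod k" using inja i l lt unfolding inj_on_def by auto
  next
    assume "l = i \<or> i = Suc l mod k"
    then show "H (\<alpha> i) (\<gamma> l)" using e1 e2 l by auto
  qed
  show ?thesis using bA bB iff by blast
qed

end

section \<open>At most one noncubic vertex in a class\<close>

context min_expanding
begin

lemma card_edges_sum: "card (edge_pairs E A B) = 3 * card A1 + (\<Sum>x\<in>A2. card (N x))"
proof -
  have "card (edge_pairs E A B) = card (edge_pairs E A1 B) + card (edge_pairs E A2 B)"
    using card_edge_pairs_Un_left[of A1 A2 B E] classes fin by simp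
  then show ?thesis using card_N_cubics N_sub fin by (simp add: card_edge_pairs Int_absorb2)
qed

text \<open>Counted from \<open>A\<close> there are 3n edges; each noncubic vertex of
  \<open>B\<close> would add at least one.\<close>

lemma noncubic_empty: "A2 = {} \<Longrightarrow> B2 = {}"
proof -
  interpret d: min_expanding B A "\<lambda>y x. E x y" n by (rule flip)
  assume "A2 = {}"
  then have "card (edge_pairs E A B) = 3 * n" using card_edges_sum card_classes by simp
  moreover have "3 * n + card B2 \<le> card (edge_pairs E A B)"
    using d.card_edges_ge by (simp add: card_edge_pairs_flip[of E])
  ultimately have "card B2 = 0" by simp
  then show "B2 = {}" by simp
qed

lemma card_edges_hub: "A2 = {x} \<Longrightarrow> card (edge_pairs E A B) + 3 = 3 * n + card (N x)"
  using card_edges_sum card_classes by simp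

text \<open>If \<open>x\<close> had no nonneighbour, the witness of an edge from \<open>x\<close> to
  a noncubic \<open>y\<close> would have R = {y}, but \<open>R\<close> has at least two
  vertices.\<close>

lemma hub_degree:
  assumes "A2 = {x}"
  shows "card (N x) < n"
proof (rule ccontr)
  interpret d: min_expanding B A "\<lambda>y x. E x y" n by (rule flip)
  assume "\<not> ?thesis"
  then have NB: "N x = B" using N_sub fin cards by (intro card_seteq) auto
  have "B2 \<noteq> {}" using assms d.noncubic_empty by blast
  then obtain y where y: "y \<in> B2" by blast
  then have e: "E x y" using NB classes by blast
  then obtain P R where w: "wit x y P R" using ex_witness by blast
  have "R \<subseteq> {y}" using witD(6)[OF w witD(3)[OF w]] witD(2)[OF w] NB by blast
  then have "card R \<le> 1" using card_mono[of "{y}" R] by simp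
  then show False using d.card_witness_ge2[OF wit_flip[OF w] y] by simp
qed

text \<open>As m = 3n - 3 + |N x|, density reads |N x| \<ge> 2n - 7; together with 4 \<le> |N x| < n
  this leaves two values of n.\<close>

lemma hub_dense:
  assumes "A2 = {x}" dense
  shows "(n = 5 \<or> n = 6) \<and> card (N x) + 1 = n"
  using assms(2) hub_degree[OF assms(1)] card_edges_hub[OF assms(1)] card_N_noncubics[of x] assms(1) by auto

text \<open>Apart from \<open>y\<close>, only the nonneighbour \<open>z\<close> of \<open>x\<close>
  can be in \<open>R\<close>. If \<open>z\<close> were noncubic, \<open>R\<close> would need three
  vertices. A second noncubic vertex of \<open>B\<close> would have a witness that contains
  \<open>z\<close> as well, against disjointness.\<close>

lemma hub_witness:
  assumes A2: "A2 = {x}" and z: "B - N x = {z}" and y: "y \<in> B2" and e: "E x y" and w: "wit x y P R"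
  shows "R = {y, z}" "z \<in> B1" "B2 = {y}"
proof -
  interpret d: min_expanding B A "\<lambda>y x. E x y" n by (rule flip)
  have x: "x \<in> A2" using A2 by blast
  have *: "R' = {v, z} \<and> z \<in> B1" if v: "v \<in> B2" "wit x v P' R'" "E x v" for v P' R'
  proof -
    have sub: "R' \<subseteq> {v, z}" using witD(6)[OF v(2) witD(3)[OF v(2)]] witD(2)[OF v(2)] z by blast
    have c2: "2 \<le> card R'" by (rule d.card_witness_ge2[OF wit_flip[OF v(2)] v(1)])
    have le: "card {v, z} \<le> 2" by (simp add: card_insert_if)
    have R': "R' = {v, z}" using sub c2 le by (intro card_seteq) auto
    moreover have "z \<notin> B2"
    proof
      assume "z \<in> B2"
      then have "3 \<le> card R'" using R' v(1) by (intro d.card_witness_ge3[OF wit_flip[OF v(2)]]) auto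
      then show False using R' le by simp
    qed
    moreover have "z \<in> B" using z by blast
    ultimately show ?thesis using classes by blast
  qed
  show R: "R = {y, z}" "z \<in> B1" using *[OF y w e] by blast+
  have "v = y" if v: "v \<in> B2" for v
  proof (rule ccontr)
    assume ne: "v \<noteq> y"
    have "v \<noteq> z" using v R(2) classes by blast
    then have ev: "E x v" using v z classes by blast
    then obtain P' R' where w': "wit x v P' R'" using ex_witness by blast
    have "R \<inter> R' = {}" by (rule witness_share(1)[OF x w w' e ev ne[symmetric]])
    then show False using R *[OF v w' ev] by blast
  qed
  then show "B2 = {y}" using y by blast
qed

text \<open>Nonadjacent hubs lead to a biwheel. For adjacent hubs both sides of the witness of their
  edge have two vertices, hence n = 5, and the graph will be \<open>Q10_plus\<close>.\<close>

lemma hub_structure: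
  assumes A2: "A2 = {x}" and deg: "card (N x) + 1 = n"
  obtains y where "B2 = {y}" "card {u. E u y} + 1 = n" "\<not> E x y"
  | y w z where "B2 = {y}" "card {u. E u y} + 1 = n" "E x y" "n = 5" "B - N x = {z}" "A - {u. E u y} = {w}"
    "w \<in> A1" "z \<in> B1" "\<not> E w z"
proof -
  interpret d: min_expanding B A "\<lambda>y x. E x y" n by (rule flip)
  have "card (B - N x) = 1" using deg N_sub[of x] cards by (simp add: card_Diff_subset)
  then obtain z where z: "B - N x = {z}" by (meson card_1_singletonE)
  have B2ne: "B2 \<noteq> {}" using A2 d.noncubic_empty by blast
  have degy: "card {u. E u y} + 1 = n" if "B2 = {y}" for y
    using d.card_edges_hub[OF that] card_edges_hub[OF A2] deg by (simp add: card_edge_pairs_flip[of E])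
  show ?thesis
  proof (cases "\<exists>y\<in>B2. E x y")
    case False
    then have "B2 \<subseteq> {z}" using z classes by blast
    then have B2: "B2 = {z}" using B2ne by blast
    then show ?thesis using that(1)[of z] degy[OF B2] z by blast
  next
    case True
    then obtain y where y: "y \<in> B2" "E x y" by blast
    then obtain P R where w: "wit x y P R" using ex_witness by blast
    note h = hub_witness[OF A2 z y w]
    note dy = degy[OF h(3)]
    have "card (A - {u. E u y}) = 1" using dy d.N_sub[of y] cards by (simp add: card_Diff_subset)
    then obtain q where q: "A - {u. E u y} = {q}" by (meson card_1_singletonE)
    have x: "x \<in> A2" using A2 by blast
    note dh = d.hub_witness[OF h(3) q x y(2) wit_flip[OF w]]
    have "q \<noteq> x" "z \<noteq> y" using q z y(2) by blast+
    then have "card P = 2" "card R = 2" using h(1) dh(1) by simp_all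
    then have "n = 5" using witD(5)[OF w] by simp
    moreover have "\<not> E q z" using witD(6)[OF w, of q z] h(1) dh(1) \<open>q \<noteq> x\<close> by blast
    ultimately show ?thesis using that(2)[OF h(3) dy y(2) _ z q dh(2) h(2)] by blast
  qed
qed

text \<open>Each hub is adjacent to all cubic vertices of the other class, so the rest is 2-regular.
  Removing the hub \<open>y\<close> costs a set one neighbour, and the surplus of one that remains
  is the connectedness needed.\<close>

lemma hub_cycle:
  assumes A2: "A2 = {x}" and B2: "B2 = {y}" and dx: "card (N x) + 1 = n" and dy: "card {u. E u y} + 1 = n"
    and no: "\<not> E x y"
  shows "\<exists>\<alpha> \<beta>. bij_betw \<alpha> {..<n - 1} A1 \<and> bij_betw \<beta> {..<n - 1} B1 \<and>
     (\<forall>i<n - 1. \<forall>j<n - 1. E (\<alpha> i) (\<beta> j) \<longleftrightarrow> j = i \<or> i = Suc j mod (n - 1))"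
proof -
  interpret d: min_expanding B A "\<lambda>y x. E x y" n by (rule flip)
  have c: "card A1 = n - 1" "card B1 = n - 1" using card_classes A2 B2 by simp_all
  have memB: "v = y \<or> v \<in> B1" if v: "v \<in> B" for v
  proof -
    have "v \<in> B1 \<or> v \<in> B2" using v classes(3) by blast
    then show ?thesis unfolding B2 by blast
  qed
  have memA: "u = x \<or> u \<in> A1" if u: "u \<in> A" for u
  proof -
    have "u \<in> A1 \<or> u \<in> A2" using u classes(1) by blast
    then show ?thesis unfolding A2 by blast
  qed
  have "N x \<subseteq> B1" using no E_in memB by blast
  then have Nx: "N x = B1" using c dx by (intro card_subset_eq) auto
  have "{u. E u y} \<subseteq> A1" using no E_in memA by blast
  then have Ny: "{u. E u y} = A1" using c dy by (intro card_subset_eq) auto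
  have NA: "N u = insert y {b \<in> B1. E u b}" if "u \<in> A1" for u
    using E_in[of u] memB that Ny by blast
  have NB: "{a. E a v} = insert x {a \<in> A1. E a v}" if "v \<in> B1" for v
    using E_in[of _ v] memA that Nx by blast
  have "y \<in> B2" "x \<in> A2" unfolding A2 B2 by simp_all
  then have y: "y \<notin> B1" "x \<notin> A1" using classes by blast+
  interpret t: two_regular A1 B1 E "n - 1"
  proof
    show "2 \<le> n - 1" using n3 by simp
    show "card {b \<in> B1. E a b} = 2" if "a \<in> A1" for a
      using card_N_cubics[OF that] NA[OF that] y by simp
    show "card {a \<in> A1. E a b} = 2" if "b \<in> B1" for b
      using d.card_N_cubics[OF that] NB[OF that] y by simp
    show "card X < card {b \<in> B1. \<exists>a\<in>X. E a b}" if X: "X \<subset> A1" "X \<noteq> {}" for X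
    proof -
      have "card X < n - 1" using psubset_card_mono[OF _ X(1)] c by simp
      then have "card X + 2 \<le> card {v. \<exists>u\<in>X. E u v}" using X classes by (intro card_nbhd) auto
      also have "{v. \<exists>u\<in>X. E u v} \<subseteq> insert y {b \<in> B1. \<exists>a\<in>X. E a b}"
        using NA X by blast
      then have "card {v. \<exists>u\<in>X. E u v} \<le> card (insert y {b \<in> B1. \<exists>a\<in>X. E a b})" by (intro card_mono) auto
      also have "\<dots> \<le> Suc (card {b \<in> B1. \<exists>a\<in>X. E a b})" by (simp add: card_insert_if)
      finally show ?thesis by simp
    qed
  qed (use c in auto)
  show ?thesis by (rule t.ex_cycle)
qed

text \<open>Each vertex has exactly one nonneighbour in the other class, so the graph is complete
  bipartite minus a perfect matching, recorded by \<nu>.\<close>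

lemma cubic_four:
  assumes "A2 = {}" "B2 = {}" "n = 4"
  obtains \<nu> where "bij_betw \<nu> A B" "\<And>a. a \<in> A \<Longrightarrow> \<not> E a (\<nu> a)"
proof -
  interpret d: min_expanding B A "\<lambda>y x. E x y" n by (rule flip)
  have cA: "card (B - N a) = 1" if "a \<in> A" for a
    using card_N_cubics[of a] that classes assms N_sub[of a] cards by (simp add: card_Diff_subset)
  have cB: "card (A - {a. E a b}) = 1" if "b \<in> B" for b
    using d.card_N_cubics[of b] that classes assms d.N_sub[of b] cards by (simp add: card_Diff_subset)
  define \<nu> where "\<nu> a = (SOME b. b \<in> B - N a)" for a
  have \<nu>: "\<nu> a \<in> B - N a" if "a \<in> A" for a
  proof -
    have "B - N a \<noteq> {}" using cA[OF that] by (metis card.empty zero_neq_one)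
    then show ?thesis unfolding \<nu>_def by (rule some_in_eq[THEN iffD2])
  qed
  have "inj_on \<nu> A"
  proof (rule inj_onI)
    fix a a' assume a: "a \<in> A" "a' \<in> A" "\<nu> a = \<nu> a'"
    obtain u where "A - {u. E u (\<nu> a)} = {u}" using cB[of "\<nu> a"] \<nu>[OF a(1)] by (meson DiffD1 card_1_singletonE)
    moreover have "a \<in> A - {u. E u (\<nu> a)}" "a' \<in> A - {u. E u (\<nu> a)}" using a \<nu>[OF a(1)] \<nu>[OF a(2)] by auto
    ultimately show "a = a'" by auto
  qed
  moreover have "\<nu> ` A \<subseteq> B" using \<nu> by blast
  ultimately have "bij_betw \<nu> A B" using fin cards by (simp add: bij_betw_def card_image card_subset_eq)
  then show ?thesis using that \<nu> by blast
qed

text \<open>The nonadjacent pairs form a 2-regular graph. If it were not a single cycle, it would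
  have a 4-cycle as a component, that is, two independent pairs of vertices with total size four > n
  - 2.\<close>

lemma cubic_five:
  assumes "A2 = {}" "B2 = {}" "n = 5"
  shows "\<exists>\<alpha> \<beta>. bij_betw \<alpha> {..<5} A \<and> bij_betw \<beta> {..<5} B \<and>
     (\<forall>i<5. \<forall>j<5. E (\<alpha> i) (\<beta> j) \<longleftrightarrow> \<not> (j = i \<or> i = Suc j mod 5))"
proof -
  interpret d: min_expanding B A "\<lambda>y x. E x y" n by (rule flip)
  have cA: "card (B - N a) = 2" if "a \<in> A" for a
    using card_N_cubics[of a] that classes assms N_sub[of a] cards by (simp add: card_Diff_subset)
  have cB: "card (A - {a. E a b}) = 2" if "b \<in> B" for b
    using d.card_N_cubics[of b] that classes assms d.N_sub[of b] cards by (simp add: card_Diff_subset)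
  have eqs: "{b \<in> B. \<not> E a b} = B - N a" "{a \<in> A. \<not> E a b} = A - {a. E a b}" for a b by auto
  interpret t: two_regular A B "\<lambda>a b. \<not> E a b" 5
  proof
    show "card {b \<in> B. \<not> E a b} = 2" if "a \<in> A" for a using cA[OF that] eqs by simp
    show "card {a \<in> A. \<not> E a b} = 2" if "b \<in> B" for b using cB[OF that] eqs by simp
    show "card X < card {b \<in> B. \<exists>a\<in>X. \<not> E a b}" if X: "X \<subset> A" "X \<noteq> {}" for X
    proof (rule ccontr)
      let ?Y = "{b \<in> B. \<exists>a\<in>X. \<not> E a b}"
      assume "\<not> ?thesis"
      then have le: "card ?Y \<le> card X" by simp
      have XA: "X \<subseteq> A" "finite X" using X fin finite_subset by blast+
      have cX: "card X < 5" using psubset_card_mono[OF fin(1) X(1)] cards assms by simp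
      have in2: "card Z + card W \<le> 3"
        if "Z \<subseteq> A" "W \<subseteq> B" "Z \<noteq> {}" "W \<noteq> {}" "\<And>z w. z \<in> Z \<Longrightarrow> w \<in> W \<Longrightarrow> \<not> E z w" for Z W
        using indep[OF that] assms by simp
      have sub: "B - N a \<subseteq> ?Y" if "a \<in> X" for a using that by blast
      have Yge: "2 \<le> card ?Y"
      proof -
        obtain a where "a \<in> X" using X by blast
        then show ?thesis using card_mono[OF _ sub, of a] cA[of a] XA fin by auto
      qed
      show False
      proof (cases "card X = 2")
        case True
        then have Y: "card ?Y = 2" using le Yge by simp
        have eq: "B - N a = ?Y" if "a \<in> X" for a
          using sub[OF that] Y cA[of a] that XA fin by (intro card_subset_eq) auto
        have "card X + card ?Y \<le> 3"
        proof (rule in2)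
          show "?Y \<noteq> {}" using Y by (metis (no_types, lifting) card.empty zero_neq_numeral)
          show "\<not> E z w" if "z \<in> X" "w \<in> ?Y" for z w using eq[OF that(1)] that(2) by blast
        qed (use X in auto)
        then show False using True Y by simp
      next
        \<comment> \<open>Here the 4-cycle is found on the other side, in A - X and B - ?Y.\<close>
        case False
        have cX3: "card X = 3 \<or> card X = 4" using False le Yge cX by linarith
        have cAX: "card (A - X) = 5 - card X" using XA cards assms by (simp add: card_Diff_subset)
        have cBY: "card (B - ?Y) = 5 - card ?Y" using fin cards assms by (subst card_Diff_subset) auto
        have "card (B - ?Y) \<noteq> 0" using cBY le cX by linarith
        then have ne: "B - ?Y \<noteq> {}" by (metis (no_types, lifting) card.empty)
        have sub': "A - {a. E a b} \<subseteq> A - X" if "b \<in> B - ?Y" for b using that by blast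
        have ge: "2 \<le> card (A - X)"
        proof -
          obtain b where b: "b \<in> B - ?Y" using ne by blast
          then have "card (A - {a. E a b}) \<le> card (A - X)" using sub' fin by (intro card_mono) auto
          then show ?thesis using cB[of b] b by auto
        qed
        then have AX: "card (A - X) = 2" using cAX cX3 by linarith
        have eq: "A - {a. E a b} = A - X" if "b \<in> B - ?Y" for b
          using sub'[OF that] AX cB[of b] that fin by (intro card_subset_eq) auto
        have "card (A - X) + card (B - ?Y) \<le> 3"
        proof (rule in2)
          show "A - X \<noteq> {}" using AX by (metis card.empty zero_neq_numeral)
          show "\<not> E z w" if "z \<in> A - X" "w \<in> B - ?Y" for z w using eq[OF that(2)] that(1) by blast
        qed (use ne in auto)
        then show False using AX cBY le cX3 cAX by linarith
      qed
    qed
  qed (use fin cards assms in auto)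
  show ?thesis using t.ex_cycle by blast
qed

end

section \<open>Isomorphisms with the particular graphs\<close>

text \<open>Edges are only required to go to edges. The number of edges upgrades this to an
  isomorphism, so nonadjacent pairs need no attention.\<close>

definition embeds :: "'a set \<Rightarrow> 'b set \<Rightarrow> ('a \<Rightarrow> 'b \<Rightarrow> bool) \<Rightarrow> 'w set \<Rightarrow> 'w set set \<Rightarrow> bool" where
  "embeds A B E V F \<longleftrightarrow> (\<exists>f g. inj_on f A \<and> inj_on g B \<and> f ` A \<inter> g ` B = {} \<and> f ` A \<union> g ` B = V \<and>
     (\<forall>a\<in>A. \<forall>b\<in>B. E a b \<longrightarrow> {f a, g b} \<in> F))"

lemma embedsI:
  assumes "bij_betw f A VA" "bij_betw g B VB" "VA \<inter> VB = {}" "VA \<union> VB = V"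
    and "\<And>a b. a \<in> A \<Longrightarrow> b \<in> B \<Longrightarrow> E a b \<Longrightarrow> {f a, g b} \<in> F"
  shows "embeds A B E V F"
  unfolding embeds_def
proof (intro exI[of _ f] exI[of _ g] conjI)
  show "\<forall>a\<in>A. \<forall>b\<in>B. E a b \<longrightarrow> {f a, g b} \<in> F" using assms(5) by blast
qed (use assms(1-4) in \<open>simp_all add: bij_betw_def\<close>)

lemma embedsI_inv:
  assumes p: "bij_betw p VA A" and q: "bij_betw q VB B" and V: "VA \<inter> VB = {}" "VA \<union> VB = V"
    and e: "\<And>v w. v \<in> VA \<Longrightarrow> w \<in> VB \<Longrightarrow> E (p v) (q w) \<Longrightarrow> {v, w} \<in> F"
  shows "embeds A B E V F"
proof (rule embedsI[OF bij_betw_inv_into[OF p] bij_betw_inv_into[OF q] V])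
  fix a b assume ab: "a \<in> A" "b \<in> B" "E a b"
  show "{inv_into VA p a, inv_into VB q b} \<in> F"
  proof (rule e)
    show "inv_into VA p a \<in> VA" using ab p by (metis bij_betw_def inv_into_into)
    show "inv_into VB q b \<in> VB" using ab q by (metis bij_betw_def inv_into_into)
    show "E (p (inv_into VA p a)) (q (inv_into VB q b))"
      using ab p q by (simp add: bij_betw_inv_into_right)
  qed
qed

context bip_graph
begin

text \<open>\<open>adj\<close> is symmetric; \<open>cross\<close> orients the edges from
  \<open>A\<close> to \<open>B\<close>, as \<open>min_expanding\<close> requires.\<close>

abbreviation "cross a b \<equiv> a \<in> A \<and> b \<in> B \<and> adj G a b"

lemma card_edges_cross:
  assumes "inj_on (ends G) (edges G)"
  shows "card (edges G) = card (edge_pairs cross A B)"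
proof -
  have "(\<lambda>(a, b). {a, b}) ` edge_pairs cross A B = ends G ` edges G"
  proof (intro equalityI subsetI)
    fix e assume "e \<in> ends G ` edges G"
    then obtain e' where e': "e' \<in> edges G" "e = ends G e'" by blast
    then obtain a b where ab: "a \<in> A" "b \<in> B" "ends G e' = {a, b}" using edge_ends by blast
    then have "(a, b) \<in> edge_pairs cross A B" using e' by (auto simp: edge_pairs_def adj_def)
    then show "e \<in> (\<lambda>(a, b). {a, b}) ` edge_pairs cross A B" using ab e' by force
  qed (auto simp: edge_pairs_def adj_def)
  moreover have "card ((\<lambda>(a, b). {a, b}) ` edge_pairs cross A B) = card (edge_pairs cross A B)"
  proof (rule card_image, rule inj_onI)
    fix e e' assume "e \<in> edge_pairs cross A B" "e' \<in> edge_pairs cross A B" "(case e of (a, b) \<Rightarrow> {a, b}) = (case e' of (a, b) \<Rightarrow> {a, b})"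
    then show "e = e'" using disj by (auto simp: edge_pairs_def doubleton_eq_iff)
  qed
  ultimately show ?thesis using card_image[OF assms] by simp
qed

text \<open>Without parallel edges the vertex map induces an injection of the edges into
  \<open>F\<close>, and \<open>F\<close> is not larger than the edge set.\<close>

lemma iso_if_embeds:
  assumes inj: "inj_on (ends G) (edges G)" and emb: "embeds A B cross V F"
    and F: "finite F" "card F \<le> card (edges G)"
  shows "G \<simeq> simple_graph V F"
proof -
  obtain f g where fg: "inj_on f A" "inj_on g B" "f ` A \<inter> g ` B = {}" "f ` A \<union> g ` B = V"
    and e: "\<And>a b. a \<in> A \<Longrightarrow> b \<in> B \<Longrightarrow> adj G a b \<Longrightarrow> {f a, g b} \<in> F"
    using emb unfolding embeds_def by blast
  define h where "h v = (if v \<in> A then f v else g v)" for v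
  have hA: "h v = f v" if "v \<in> A" for v using that by (simp add: h_def)
  have hB: "h v = g v" if "v \<in> B" for v using that disj by (auto simp: h_def)
  have img: "h ` A = f ` A" "h ` B = g ` B" using hA hB by (auto intro: image_cong)
  have "inj_on h A" "inj_on h B" using fg(1,2) hA hB by (simp_all add: inj_on_def)
  moreover have "h ` (A - B) \<inter> h ` (B - A) = {}" using fg(3) img by blast
  ultimately have injh: "inj_on h (verts G)"
    unfolding verts_eq[symmetric] by (simp add: inj_on_Un)
  have bijh: "bij_betw h (verts G) V"
    using injh img fg(4) unfolding bij_betw_def by (simp add: verts_eq[symmetric] image_Un)
  have sub: "(\<lambda>e. h ` ends G e) ` edges G \<subseteq> F"
  proof
    fix s assume "s \<in> (\<lambda>e. h ` ends G e) ` edges G"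
    then obtain e' where e': "e' \<in> edges G" "s = h ` ends G e'" by blast
    then obtain a b where ab: "a \<in> A" "b \<in> B" "ends G e' = {a, b}" using edge_ends by blast
    then have "adj G a b" using e' by (auto simp: adj_def)
    then show "s \<in> F" using e[OF ab(1,2)] ab e' hA hB by simp
  qed
  have injg: "inj_on (\<lambda>e. h ` ends G e) (edges G)"
  proof (rule inj_onI)
    fix e1 e2 assume e12: "e1 \<in> edges G" "e2 \<in> edges G" "h ` ends G e1 = h ` ends G e2"
    have "ends G e1 \<subseteq> verts G" "ends G e2 \<subseteq> verts G" using wf e12 by (auto simp: wf_graph_def)
    then have "ends G e1 = ends G e2" using inj_on_image_eq_iff[OF injh] e12(3) by blast
    then show "e1 = e2" using inj e12 by (auto simp: inj_on_def)
  qed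
  have "(\<lambda>e. h ` ends G e) ` edges G = F"
    using card_seteq[OF F(1) sub] F(2) card_image[OF injg] by simp
  then have "bij_betw (\<lambda>e. h ` ends G e) (edges G) F" using injg by (simp add: bij_betw_def)
  then show ?thesis using bijh unfolding graph_iso_def simple_graph_def
    by (intro exI[of _ h] exI[of _ "\<lambda>e. h ` ends G e"]) simp
qed

end

lemma iso_cards:
  assumes "G \<simeq> H"
  shows "card (verts G) = card (verts H)" "card (edges G) = card (edges H)"
  using assms by (auto simp: graph_iso_def dest: bij_betw_same_card)

subsection \<open>The complete bipartite graphs\<close>

lemma embeds_complete:
  assumes "finite A" "finite B" "card A = card VA" "card B = card VB" "finite VA" "finite VB"
    and V: "VA \<inter> VB = {}" "VA \<union> VB = V" and "\<And>v w. v \<in> VA \<Longrightarrow> w \<in> VB \<Longrightarrow> {v, w} \<in> F"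
  shows "embeds A B E V F"
proof -
  obtain f where f: "bij_betw f A VA" using assms finite_same_card_bij by blast
  obtain g where g: "bij_betw g B VB" using assms finite_same_card_bij by blast
  show ?thesis using f g V by (rule embedsI) (use f g assms(9) in \<open>auto simp: bij_betw_def\<close>)
qed

lemma card_cycle_edges: "finite (cycle_edges k)" "card (cycle_edges k) \<le> k"
  using card_image_le[of "{..<k}" "\<lambda>i. {i, Suc i mod k}"] by (auto simp: cycle_edges_def)

lemma (in bip_graph) complete_iso:
  assumes inj: "inj_on (ends G) (edges G)" and c: "card A = card B"
    and n: "1 \<le> card A" "card A \<le> 3" and ex: "expanding A B (adj G)"
  shows "G \<simeq> K2 \<or> G \<simeq> C4 \<or> G \<simeq> K33"
proof -
  have all: "adj G a b" if "a \<in> A" "b \<in> B" for a b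
  proof (rule ccontr)
    assume "\<not> adj G a b"
    then have "card {a} + card {b} + 2 \<le> card A" using that by (intro expandingD[OF ex]) auto
    then show False using n by simp
  qed
  have "edge_pairs cross A B = A \<times> B" using all by (auto simp: edge_pairs_def)
  then have m: "card (edges G) = card A * card A"
    using card_edges_cross[OF inj] c by (simp add: card_cartesian_product)
  note fin = finite_classes
  consider "card A = 1" | "card A = 2" | "card A = 3" using n by linarith
  then show ?thesis
  proof cases
    case 1
    have "G \<simeq> K2" unfolding K2_def
    proof (rule iso_if_embeds[OF inj])
      show "embeds A B cross {0, 1::nat} {{0, 1}}"
        by (rule embeds_complete[of _ _ "{0}" "{1}"]) (use fin c 1 in auto)
    qed (use m 1 in auto)
    then show ?thesis by blast
  next
    case 2
    have "G \<simeq> C4" unfolding C4_def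
    proof (rule iso_if_embeds[OF inj])
      show "embeds A B cross {..<4} (cycle_edges 4)"
      proof (rule embeds_complete[of _ _ "{0, 2}" "{1, 3}"])
        show "{0, 2} \<union> {1, 3} = {..<4::nat}" by auto
        show "{v, w} \<in> cycle_edges 4" if "v \<in> {0, 2}" "w \<in> {1, 3}" for v w
          using that by (auto simp: cycle_edges_def lessThan_nat_numeral lessThan_Suc insert_commute)
      qed (use fin c 2 in auto)
      show "card (cycle_edges 4) \<le> card (edges G)" using card_cycle_edges(2)[of 4] m 2 by simp
    qed (rule card_cycle_edges)
    then show ?thesis by blast
  next
    case 3
    have "G \<simeq> K33" unfolding K33_def
    proof (rule iso_if_embeds[OF inj])
      show "embeds A B cross {..<6} ((\<lambda>(i, j). {i, j}) ` ({0, 1, 2::nat} \<times> {3, 4, 5}))"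
      proof (rule embeds_complete[of _ _ "{0, 1, 2}" "{3, 4, 5}"])
        show "{0, 1, 2} \<union> {3, 4, 5} = {..<6::nat}" by auto
        show "{v, w} \<in> (\<lambda>(i, j). {i, j}) ` ({0, 1, 2} \<times> {3, 4, 5})" if "v \<in> {0, 1, 2}" "w \<in> {3, 4, 5}" for v w :: nat
          using that by blast
      qed (use fin c 3 in auto)
      have "card ((\<lambda>(i, j). {i, j}) ` ({0, 1, 2::nat} \<times> {3, 4, 5})) \<le> card ({0, 1, 2::nat} \<times> {3, 4, 5::nat})"
        by (rule card_image_le) simp
      then show "card ((\<lambda>(i, j). {i, j}) ` ({0, 1, 2::nat} \<times> {3, 4, 5})) \<le> card (edges G)"
        using m 3 by (simp add: card_cartesian_product)
    qed simp
    then show ?thesis by blast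
  qed
qed

subsection \<open>Biwheels\<close>

definition biwheel_edges :: "nat \<Rightarrow> nat set set" where
  "biwheel_edges n = cycle_edges (2 * n - 2)
      \<union> (\<lambda>i. {2 * n - 2, i}) ` {i \<in> {..<2 * n - 2}. even i}
      \<union> (\<lambda>i. {2 * n - 1, i}) ` {i \<in> {..<2 * n - 2}. odd i}"

lemma biwheel_eq: "biwheel n = simple_graph {..<2 * n} (biwheel_edges n)"
  by (simp add: biwheel_def biwheel_edges_def)

lemma even_below: "{i \<in> {..<2 * k}. even i} = (\<lambda>i. 2 * i) ` {..<k::nat}"
  by (auto elim!: evenE)

lemma odd_below: "{i \<in> {..<2 * k}. odd i} = (\<lambda>i. 2 * i + 1) ` {..<k::nat}"
  by (auto elim!: oddE)

lemma card_biwheel_edges: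
  assumes "1 \<le> n"
  shows "finite (biwheel_edges n)" "card (biwheel_edges n) \<le> 4 * n - 4"
proof -
  have k: "2 * n - 2 = 2 * (n - 1)" by simp
  let ?C = "cycle_edges (2 * n - 2)"
  let ?X = "(\<lambda>i. {2 * n - 2, i}) ` {i \<in> {..<2 * n - 2}. even i}"
  let ?Y = "(\<lambda>i. {2 * n - 1, i}) ` {i \<in> {..<2 * n - 2}. odd i}"
  show "finite (biwheel_edges n)" by (simp add: biwheel_edges_def card_cycle_edges)
  have "card ?X \<le> n - 1" "card ?Y \<le> n - 1"
    unfolding k even_below odd_below image_image
    using card_image_le[of "{..<n - 1}"] by (metis card_lessThan finite_lessThan)+
  moreover have "card (biwheel_edges n) \<le> card ?C + card ?X + card ?Y"
    unfolding biwheel_edges_def using card_Un_le[of "?C \<union> ?X" ?Y] card_Un_le[of ?C ?X] by linarith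
  moreover have "card ?C \<le> 2 * n - 2" by (rule card_cycle_edges)
  ultimately show "card (biwheel_edges n) \<le> 4 * n - 4" using assms by linarith
qed

text \<open>On the rim \<alpha>(i) is placed at 2i and \<beta>(i) at 2i + 1. The hub
  \<open>x\<close>, adjacent to the odd positions, becomes 2n - 1, and \<open>y\<close> becomes 2n -
  2.\<close>

lemma (in min_expanding) embeds_biwheel:
  assumes A2: "A2 = {x}" and B2: "B2 = {y}" and dx: "card (N x) + 1 = n" and dy: "card {u. E u y} + 1 = n"
    and no: "\<not> E x y"
  shows "embeds A B E {..<2 * n} (biwheel_edges n)"
proof -
  define k where "k = n - 1"
  have nk: "n = k + 1" "2 \<le> k" using n3 by (auto simp: k_def)
  obtain \<alpha> \<beta> where ab: "bij_betw \<alpha> {..<k} A1" "bij_betw \<beta> {..<k} B1"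
    and H: "\<And>i j. i < k \<Longrightarrow> j < k \<Longrightarrow> E (\<alpha> i) (\<beta> j) \<longleftrightarrow> j = i \<or> i = Suc j mod k"
    using hub_cycle[OF assms] unfolding k_def by blast
  let ?VA = "insert (2 * k + 1) ((\<lambda>i. 2 * i) ` {..<k})" and ?VB = "insert (2 * k) ((\<lambda>i. 2 * i + 1) ` {..<k})"
  define p where "p v = (if v = 2 * k + 1 then x else \<alpha> (v div 2))" for v
  define q where "q v = (if v = 2 * k then y else \<beta> (v div 2))" for v
  have p2: "p (2 * i) = \<alpha> i" "q (2 * i + 1) = \<beta> i" for i
  proof -
    have "2 * i \<noteq> 2 * k + 1" "2 * i + 1 \<noteq> 2 * k" by presburger+
    then show "p (2 * i) = \<alpha> i" "q (2 * i + 1) = \<beta> i" by (simp_all add: p_def q_def)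
  qed
  have p1: "p (2 * k + 1) = x" "q (2 * k) = y" by (auto simp: p_def q_def)
  have "x \<in> A2" "y \<in> B2" unfolding A2 B2 by simp_all
  then have xy: "x \<notin> A1" "y \<notin> B1" using classes by blast+
  have AB: "insert x A1 = A" "insert y B1 = B" using classes(1,3) unfolding A2 B2 by simp_all
  have new: "2 * k + 1 \<notin> (\<lambda>i. 2 * i) ` {..<k}" "2 * k \<notin> (\<lambda>i. 2 * i + 1) ` {..<k}"
    unfolding even_below[symmetric] odd_below[symmetric] by simp_all
  have "bij_betw p ((\<lambda>i. 2 * i) ` {..<k}) A1"
    using ab(1) p2 by (auto simp: bij_betw_def inj_on_def image_image)
  then have "bij_betw p ?VA (insert x A1)"
    using notIn_Un_bij_betw[OF new(1), of p A1] xy(1) p1(1) by simp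
  then have bp: "bij_betw p ?VA A" unfolding AB .
  have "bij_betw q ((\<lambda>i. 2 * i + 1) ` {..<k}) B1"
    using ab(2) p2 by (auto simp: bij_betw_def inj_on_def image_image)
  then have "bij_betw q ?VB (insert y B1)"
    using notIn_Un_bij_betw[OF new(2), of q B1] xy(2) p1(2) by simp
  then have bq: "bij_betw q ?VB B" unfolding AB .
  have n2: "2 * n - 2 = 2 * k" "2 * n - 1 = 2 * k + 1" using nk by auto
  show ?thesis
  proof (rule embedsI_inv[OF bp bq])
    show "?VA \<inter> ?VB = {}" by (auto dest: arg_cong[of _ _ even])
    have "v \<in> ?VA \<union> ?VB" if "v < 2 * n" for v
    proof -
      have "v = 2 * k + 1 \<or> v = 2 * k \<or> v < 2 * k" using that nk by linarith
      moreover have "v \<in> (\<lambda>i. 2 * i) ` {..<k} \<union> (\<lambda>i. 2 * i + 1) ` {..<k}" if "v < 2 * k"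
        unfolding even_below[symmetric] odd_below[symmetric] using that by auto
      ultimately show ?thesis by blast
    qed
    then show "?VA \<union> ?VB = {..<2 * n}" using nk by auto
    fix v w assume v: "v \<in> ?VA" and w: "w \<in> ?VB" and e: "E (p v) (q w)"
    consider "v = 2 * k + 1" "w = 2 * k" | j where "v = 2 * k + 1" "j < k" "w = 2 * j + 1"
      | i where "i < k" "v = 2 * i" "w = 2 * k" | i j where "i < k" "j < k" "v = 2 * i" "w = 2 * j + 1"
      using v w by blast
    then show "{v, w} \<in> biwheel_edges n"
    proof cases
      case 1
      then show ?thesis using e p1 no by simp
    next
      case 2
      then have "w \<in> {i \<in> {..<2 * k}. odd i}" by simp
      then show ?thesis using 2(1) unfolding biwheel_edges_def n2 by blast
    next
      case 3
      then have "v \<in> {i \<in> {..<2 * k}. even i}" by simp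
      then show ?thesis using 3(3) unfolding biwheel_edges_def n2 by (simp add: insert_commute)
    next
      case 4
      then have "j = i \<or> i = Suc j mod k" using e p2 H by metis
      then have "{v, w} \<in> cycle_edges (2 * k)"
      proof
        assume "j = i"
        then have "{v, w} = {2 * i, Suc (2 * i) mod (2 * k)}" using 4 by simp
        then show ?thesis using 4 unfolding cycle_edges_def by (intro image_eqI[of _ _ "2 * i"]) auto
      next
        assume "i = Suc j mod k"
        then have "v = (2 * Suc j) mod (2 * k)" using 4 by (simp add: mult_mod_right)
        then have "{v, w} = {2 * j + 1, Suc (2 * j + 1) mod (2 * k)}" using 4 by (simp add: insert_commute)
        then show ?thesis using 4 unfolding cycle_edges_def by (intro image_eqI[of _ _ "2 * j + 1"]) auto
      qed
      then show ?thesis unfolding biwheel_edges_def n2 by blast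
    qed
  qed
qed

lemma (in min_expanding) embeds_cube:
  assumes "A2 = {}" "B2 = {}" "n = 4"
  shows "embeds A B E {..<8} (biwheel_edges 4)"
proof -
  obtain \<nu> where nu: "bij_betw \<nu> A B" "\<And>a. a \<in> A \<Longrightarrow> \<not> E a (\<nu> a)"
    by (rule cubic_four[OF assms]) blast
  have "card {0, 2, 4, 7::nat} = card A" using cards assms by simp
  then obtain h where h: "bij_betw h {0, 2, 4, 7::nat} A"
    using finite_same_card_bij[of "{0, 2, 4, 7::nat}" A] fin by blast
  \<comment> \<open>Antipodal vertices of the cube in the labelling of \<open>biwheel 4\<close>; the
    default value 0 belongs to 3.\<close>
  define opp :: "nat \<Rightarrow> nat" where "opp = (\<lambda>_. 0)(5 := 2, 1 := 4, 6 := 7)"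
  have opp: "bij_betw opp {3, 5, 1, 6} {0, 2, 4, 7}" by (auto simp: bij_betw_def opp_def inj_on_def)
  have q: "bij_betw (\<nu> \<circ> h \<circ> opp) {3, 5, 1, 6} B"
    by (rule bij_betw_trans[OF opp bij_betw_trans[OF h nu(1)], unfolded comp_assoc[symmetric]])
  show ?thesis
  proof (rule embedsI_inv[OF h q])
    show "{0, 2, 4, 7} \<union> {3, 5, 1, 6} = {..<8::nat}" by auto
    fix v w :: nat assume vw: "v \<in> {0, 2, 4, 7}" "w \<in> {3, 5, 1, 6}" and e: "E (h v) ((\<nu> \<circ> h \<circ> opp) w)"
    have "h v \<in> A" using h vw(1) by (auto simp: bij_betw_def)
    then have "v \<noteq> opp w" using e nu(2) by auto
    then have "v < 6 \<and> w = Suc v mod 6 \<or> w < 6 \<and> v = Suc w mod 6 \<or> v = 7 \<and> w < 6 \<and> odd w \<or> w = 6 \<and> v < 6 \<and> even v"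
      using vw unfolding opp_def by (elim insertE emptyE; simp)
    moreover have "{i, Suc i mod 6} \<in> biwheel_edges 4" if "i < 6" for i
      using that by (auto simp: biwheel_edges_def cycle_edges_def)
    moreover have "{7, i} \<in> biwheel_edges 4" if "i < 6" "odd i" for i
      using that by (auto simp: biwheel_edges_def)
    moreover have "{6, i} \<in> biwheel_edges 4" if "i < 6" "even i" for i
      using that by (auto simp: biwheel_edges_def)
    ultimately show "{v, w} \<in> biwheel_edges 4" by (auto simp: insert_commute)
  qed auto
qed

subsection \<open>The Moebius ladder\<close>

lemma (in min_expanding) embeds_M10:
  assumes "A2 = {}" "B2 = {}" "n = 5"
  shows "embeds A B E {..<10} (cycle_edges 10 \<union> (\<lambda>i. {i, i + 5}) ` {..<5})"
proof -
  obtain \<alpha> \<beta> where ab: "bij_betw \<alpha> {..<5} A" "bij_betw \<beta> {..<5} B"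
    and H: "\<And>i j. i < 5 \<Longrightarrow> j < 5 \<Longrightarrow> E (\<alpha> i) (\<beta> j) \<longleftrightarrow> \<not> (j = i \<or> i = Suc j mod 5)"
    using cubic_five[OF assms] by blast
  let ?VA = "{0, 2, 4, 6, 8::nat}" and ?VB = "{1, 3, 5, 7, 9::nat}"
  \<comment> \<open>In the ladder an even \<open>v\<close> is adjacent to v + 1, v - 1 and v + 5
    modulo 10. Through the shift by two their \<beta>-indices exceed the \<alpha>-index of
    \<open>v\<close> by 3, 1 and 2 modulo 5, which avoids exactly the nonadjacent differences 0 and
    4.\<close>
  have "bij_betw (\<lambda>v. v mod 5) ?VA {..<5}" "bij_betw (\<lambda>v. (v + 2) mod 5) ?VB {..<5}"
    by (auto simp: bij_betw_def inj_on_def lessThan_nat_numeral lessThan_Suc)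
  note p = bij_betw_trans[OF this(1) ab(1)] and q = bij_betw_trans[OF this(2) ab(2)]
  show ?thesis
  proof (rule embedsI_inv[OF p q])
    show "?VA \<union> ?VB = {..<10::nat}" by auto
    fix v w :: nat assume vw: "v \<in> ?VA" "w \<in> ?VB"
      and e: "E ((\<alpha> \<circ> (\<lambda>v. v mod 5)) v) ((\<beta> \<circ> (\<lambda>v. (v + 2) mod 5)) w)"
    have "\<not> ((w + 2) mod 5 = v mod 5 \<or> v mod 5 = Suc ((w + 2) mod 5) mod 5)"
      using e H[of "v mod 5" "(w + 2) mod 5"] by simp
    then have "w = Suc v mod 10 \<or> v = Suc w mod 10 \<or> v < 5 \<and> w = v + 5 \<or> w < 5 \<and> v = w + 5"
      using vw by (elim insertE emptyE; simp)
    moreover have "v < 10" "w < 10" using vw by auto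
    moreover have "{i, Suc i mod 10} \<in> cycle_edges 10" if "i < 10" for i
      using that by (auto simp: cycle_edges_def)
    moreover have "{i, i + 5} \<in> (\<lambda>i. {i, i + 5}) ` {..<5}" if "i < 5" for i :: nat
      using that by auto
    ultimately show "{v, w} \<in> cycle_edges 10 \<union> (\<lambda>i. {i, i + 5}) ` {..<5}"
      by (metis UnCI insert_commute)
  qed auto
qed

subsection \<open>The graphs \<open>Q\<^sub>2\<^sub>n\<close>\<close>

text \<open>A uniform numbering of the cubic vertices, together with \<open>qu\<close>: indices
  below 3 are those of \<open>Q10\<close>, and index i \<ge> 3 is the vertex added in step i +
  3.\<close>

definition qw :: "nat \<Rightarrow> q_vertex" where
  "qw i = (if i < 3 then Vw (i + 1) else Va (i + 3))"

definition qu :: "nat \<Rightarrow> q_vertex" where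
  "qu i = (if i < 3 then Vu (i + 1) else Vb (i + 3))"

definition q_verts :: "nat \<Rightarrow> q_vertex set" where
  "q_verts k = {Va 1, Va 2, Vb 1, Vb 2} \<union> qw ` {..<k} \<union> qu ` {..<k}"

text \<open>Closed form of the recursion, with k = n - 2 rungs between \<open>qu j\<close> and
  \<open>qw j\<close>; an S-extension adds one rung.\<close>

definition q_edges :: "nat \<Rightarrow> q_vertex set set" where
  "q_edges k = (\<lambda>j. {Va 1, qu j}) ` {..<k} \<union> (\<lambda>j. {Va 2, qu j}) ` {..<k} \<union>
     (\<lambda>j. {Vb 1, qw j}) ` {..<k} \<union> (\<lambda>j. {Vb 2, qw j}) ` {..<k} \<union> (\<lambda>j. {qu j, qw j}) ` {..<k}"

lemma q_inj [simp]: "qw i = qw j \<longleftrightarrow> i = j" "qu i = qu j \<longleftrightarrow> i = j"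
  by (auto simp: qw_def qu_def)

lemma q_neq [simp]: "qw i \<noteq> qu j" "qu j \<noteq> qw i" "qw i \<noteq> Va 1" "qw i \<noteq> Va 2" "qw i \<noteq> Va (Suc 0)"
  "qw i \<noteq> Vb j" "qu i \<noteq> Vb 1" "qu i \<noteq> Vb 2" "qu i \<noteq> Vb (Suc 0)" "qu i \<noteq> Va j"
  "Va 1 \<noteq> qw i" "Va 2 \<noteq> qw i" "Va (Suc 0) \<noteq> qw i" "Vb j \<noteq> qw i" "Vb 1 \<noteq> qu i" "Vb 2 \<noteq> qu i"
  "Vb (Suc 0) \<noteq> qu i" "Va j \<noteq> qu i"
  by (auto simp: qw_def qu_def)

lemma q_class_simps [simp]: "q_class (qw i)" "\<not> q_class (qu i)"
  by (auto simp: qw_def qu_def)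

lemma Q10_eq: "Q10 = simple_graph (q_verts 3) (q_edges 3)"
proof -
  have l3: "{..<3::nat} = {0, 1, 2}" by auto
  have "Va ` {1, 2} \<union> Vw ` {1, 2, 3} \<union> Vb ` {1, 2} \<union> Vu ` {1, 2, 3} = q_verts 3"
    unfolding q_verts_def l3 by (auto simp: qw_def qu_def)
  moreover have "(\<lambda>(i, j). {Va i, Vu j}) ` ({1, 2} \<times> {1, 2, 3})
      \<union> (\<lambda>(i, j). {Vb i, Vw j}) ` ({1, 2} \<times> {1, 2, 3})
      \<union> (\<lambda>j. {Vu j, Vw j}) ` {1, 2, 3} = q_edges 3"
    unfolding q_edges_def l3 by (simp add: qw_def qu_def insert_commute Sigma_def eval_nat_numeral)
  ultimately show ?thesis unfolding Q10_def by simp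
qed

lemma q_step_eq:
  assumes "3 \<le> k"
  shows "Q_step (simple_graph (q_verts k) (q_edges k)) {Va 1, Va 2, Vb 1, Vb 2} (k + 3) =
    simple_graph (q_verts (Suc k)) (q_edges (Suc k))"
proof -
  have new: "qw k = Va (k + 3)" "qu k = Vb (k + 3)" using assms by (simp_all add: qw_def qu_def)
  have "{Va 1, Va 2, Vb 1, Vb 2} \<inter> {v \<in> q_verts k. q_class v} = {Va 1, Va 2}"
    "{Va 1, Va 2, Vb 1, Vb 2} \<inter> {v \<in> q_verts k. \<not> q_class v} = {Vb 1, Vb 2}"
    by (auto simp: q_verts_def)
  moreover have "q_verts k \<union> {qw k, qu k} = q_verts (Suc k)"
    by (auto simp: q_verts_def lessThan_Suc)
  moreover have "q_edges k \<union> (\<lambda>b. {qw k, b}) ` {Vb 1, Vb 2} \<union> (\<lambda>a. {qu k, a}) ` {Va 1, Va 2} \<union> {{qw k, qu k}} =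
      q_edges (Suc k)"
    unfolding q_edges_def lessThan_Suc by (simp add: insert_commute)
  ultimately show ?thesis
    unfolding Q_step_def S_extension_def new[symmetric] by (simp add: simple_graph_def)
qed

lemma finite_q_edges: "finite (q_edges k)"
  by (simp add: q_edges_def)

lemma degree_simple: "degree (simple_graph V F) v = card {e \<in> F. v \<in> e}"
  by (simp add: degree_def simple_graph_def)

text \<open>The hubs have degree \<open>k\<close> and all other vertices at most three. For k = 3,
  the graph \<open>Q10\<close>, no vertex is noncubic, which is why the recursion names the set S
  explicitly in its first step.\<close>

lemma noncubic_q:
  assumes "4 \<le> k"
  shows "noncubic (simple_graph (q_verts k) (q_edges k)) = {Va 1, Va 2, Vb 1, Vb 2}"
proof -
  let ?d = "\<lambda>v. card {e \<in> q_edges k. v \<in> e}"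
  have "4 \<le> ?d v" if v: "v \<in> {Va 1, Va 2, Vb 1, Vb 2}" for v
  proof -
    have 1: "4 \<le> ?d v" if "inj_on (\<lambda>j. {v, g j}) {..<k}" "(\<lambda>j. {v, g j}) ` {..<k} \<subseteq> q_edges k" for g
    proof -
      have "k = card ((\<lambda>j. {v, g j}) ` {..<k})" using that(1) by (simp add: card_image)
      also have "\<dots> \<le> ?d v" using that(2) finite_q_edges by (intro card_mono) auto
      finally show ?thesis using assms by simp
    qed
    have "inj_on (\<lambda>j. {v, qu j}) {..<k} \<and> (\<lambda>j. {v, qu j}) ` {..<k} \<subseteq> q_edges k \<or>
        inj_on (\<lambda>j. {v, qw j}) {..<k} \<and> (\<lambda>j. {v, qw j}) ` {..<k} \<subseteq> q_edges k"
      using v by (auto simp: inj_on_def doubleton_eq_iff q_edges_def)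
    then show ?thesis using 1 by blast
  qed
  note ge = this
  have w: "?d (qw i) \<le> 3" for i
  proof -
    have "{e \<in> q_edges k. qw i \<in> e} \<subseteq> {{Vb 1, qw i}, {Vb 2, qw i}, {qu i, qw i}}"
      by (auto simp: q_edges_def)
    then have "?d (qw i) \<le> card {{Vb 1, qw i}, {Vb 2, qw i}, {qu i, qw i}}" by (intro card_mono) auto
    also have "\<dots> \<le> 3" by (simp add: card_insert_if)
    finally show ?thesis .
  qed
  have u: "?d (qu i) \<le> 3" for i
  proof -
    have "{e \<in> q_edges k. qu i \<in> e} \<subseteq> {{Va 1, qu i}, {Va 2, qu i}, {qu i, qw i}}"
      by (auto simp: q_edges_def)
    then have "?d (qu i) \<le> card {{Va 1, qu i}, {Va 2, qu i}, {qu i, qw i}}" by (intro card_mono) auto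
    also have "\<dots> \<le> 3" by (simp add: card_insert_if)
    finally show ?thesis .
  qed
  have "4 \<le> ?d v \<longleftrightarrow> v \<in> {Va 1, Va 2, Vb 1, Vb 2}" if v: "v \<in> q_verts k" for v
  proof
    assume d: "4 \<le> ?d v"
    have "v \<noteq> qw i" "v \<noteq> qu i" for i using d w[of i] u[of i] by auto
    then show "v \<in> {Va 1, Va 2, Vb 1, Vb 2}" using v unfolding q_verts_def by blast
  qed (rule ge)
  moreover have "verts (simple_graph (q_verts k) (q_edges k)) = q_verts k" by (simp add: simple_graph_def)
  moreover have "{Va 1, Va 2, Vb 1, Vb 2} \<subseteq> q_verts k" by (auto simp: q_verts_def)
  ultimately show ?thesis unfolding noncubic_def degree_simple by blast
qed

lemma Q_eq: "5 \<le> n \<Longrightarrow> Q n = simple_graph (q_verts (n - 2)) (q_edges (n - 2))"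
proof (induction n rule: dec_induct)
  case base
  then show ?case by (simp add: Q.simps Q10_eq)
next
  case (step n)
  define k where "k = n - 2"
  have k: "Suc n - 2 = Suc k" "Suc n = k + 3" "3 \<le> k" using step.hyps by (auto simp: k_def)
  have IH: "Q n = simple_graph (q_verts k) (q_edges k)" using step.IH by (simp add: k_def)
  have "Q (Suc n) = Q_step (simple_graph (q_verts k) (q_edges k)) {Va 1, Va 2, Vb 1, Vb 2} (k + 3)"
  proof (cases "n = 5")
    case True
    then show ?thesis by (simp add: Q.simps[of 6] k_def Q10_eq)
  next
    case False
    then have "Q (Suc n) = Q_step (Q n) (noncubic (Q n)) (Suc n)"
      using step.hyps by (subst Q.simps) simp
    then show ?thesis using False step.hyps noncubic_q[of k] unfolding IH k(2)[symmetric] by (simp add: k_def)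
  qed
  then show ?case using q_step_eq[OF k(3)] k(1) by simp
qed

lemma card_q_verts: "card (q_verts k) = 2 * k + 4"
proof -
  have "card (qw ` {..<k} \<union> qu ` {..<k}) = 2 * k"
    by (subst card_Un_disjoint) (auto simp: card_image inj_on_def)
  moreover have "{Va 1, Va 2, Vb 1, Vb 2} \<inter> (qw ` {..<k} \<union> qu ` {..<k}) = {}" by auto
  ultimately show ?thesis unfolding q_verts_def Un_assoc by (subst card_Un_disjoint) auto
qed

lemma card_q_edges: "card (q_edges k) = 5 * k"
proof -
  have "inj_on (\<lambda>j. {v, qu j}) {..<k}" "inj_on (\<lambda>j. {v, qw j}) {..<k}" "inj_on (\<lambda>j. {qu j, qw j}) {..<k}" for v
    by (auto simp: inj_on_def doubleton_eq_iff)
  then have i: "card ((\<lambda>j. {v, qu j}) ` {..<k}) = k" "card ((\<lambda>j. {v, qw j}) ` {..<k}) = k"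
    "card ((\<lambda>j. {qu j, qw j}) ` {..<k}) = k" for v
    by (simp_all add: card_image)
  let ?a = "\<lambda>v. (\<lambda>j. {v, qu j}) ` {..<k}" and ?b = "\<lambda>v. (\<lambda>j. {v, qw j}) ` {..<k}"
  let ?c = "(\<lambda>j. {qu j, qw j}) ` {..<k}"
  have d: "?a (Va 1) \<inter> ?a (Va 2) = {}" "(?a (Va 1) \<union> ?a (Va 2)) \<inter> ?b (Vb 1) = {}"
    "(?a (Va 1) \<union> ?a (Va 2) \<union> ?b (Vb 1)) \<inter> ?b (Vb 2) = {}"
    "(?a (Va 1) \<union> ?a (Va 2) \<union> ?b (Vb 1) \<union> ?b (Vb 2)) \<inter> ?c = {}"
    by (auto simp: doubleton_eq_iff)
  have f: "finite (?a v)" "finite (?b v)" "finite ?c" for v by simp_all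
  have "card (q_edges k) = card (?a (Va 1)) + card (?a (Va 2)) + card (?b (Vb 1)) + card (?b (Vb 2)) + card ?c"
    unfolding q_edges_def by (simp only: card_Un_disjoint d f finite_Un simp_thms)
  then show ?thesis unfolding i by simp
qed

text \<open>A vertex of degree three that is adjacent to both hubs of the other class has one
  neighbour left.\<close>

lemma (in min_expanding) ex_matching:
  assumes A: "A = {x1, x2} \<union> A'" "x1 \<noteq> x2" "x1 \<notin> A'" "x2 \<notin> A'" "card A' = k"
    and B: "B = {y1, y2} \<union> B'" "y1 \<noteq> y2" "y1 \<notin> B'" "y2 \<notin> B'" "card B' = k"
    and A': "\<And>u. u \<in> A' \<Longrightarrow> E u y1 \<and> E u y2 \<and> card (N u) = 3"
    and B': "\<And>v. v \<in> B' \<Longrightarrow> E x1 v \<and> E x2 v \<and> card {u. E u v} = 3"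
  shows "\<exists>m. bij_betw m B' A' \<and> (\<forall>u\<in>A'. \<forall>v\<in>B'. E u v \<longrightarrow> u = m v)"
proof -
  have fin': "finite A'" "finite B'" using fin A(1) B(1) by (metis finite_Un)+
  have 1: "card {u \<in> A'. E u v} = 1" if v: "v \<in> B'" for v
  proof -
    have "{u. E u v} = {x1, x2} \<union> {u \<in> A'. E u v}" using B'[OF v] E_in[of _ v] A(1) by auto
    moreover have "card ({x1, x2} \<union> {u \<in> A'. E u v}) = card {x1, x2} + card {u \<in> A'. E u v}"
      using fin' A(3,4) by (intro card_Un_disjoint) auto
    ultimately show ?thesis using B'[OF v] A(2) by simp
  qed
  have 2: "card {v \<in> B'. E u v} = 1" if u: "u \<in> A'" for u
  proof -
    have "N u = {y1, y2} \<union> {v \<in> B'. E u v}" using A'[OF u] E_in[of u] B(1) by auto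
    moreover have "card ({y1, y2} \<union> {v \<in> B'. E u v}) = card {y1, y2} + card {v \<in> B'. E u v}"
      using fin' B(3,4) by (intro card_Un_disjoint) auto
    ultimately show ?thesis using A'[OF u] B(2) by simp
  qed
  have "\<forall>v. \<exists>u. v \<in> B' \<longrightarrow> {u \<in> A'. E u v} = {u}" using 1 by (meson card_1_singletonE)
  then obtain m where m: "\<And>v. v \<in> B' \<Longrightarrow> {u \<in> A'. E u v} = {m v}" by metis
  have m': "m v \<in> A'" "E (m v) v" if "v \<in> B'" for v using m[OF that] by auto
  have "inj_on m B'"
  proof (rule inj_onI)
    fix v v' assume v: "v \<in> B'" "v' \<in> B'" "m v = m v'"
    obtain w where "{w \<in> B'. E (m v) w} = {w}" using 2[OF m'(1)[OF v(1)]] by (meson card_1_singletonE)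
    moreover have "v \<in> {w \<in> B'. E (m v) w}" "v' \<in> {w \<in> B'. E (m v) w}"
      using v m'(2)[OF v(1)] m'(2)[OF v(2)] by simp_all
    ultimately show "v = v'" by auto
  qed
  moreover from this have "m ` B' = A'"
    using m'(1) fin' A(5) B(5) by (intro card_subset_eq) (auto simp: card_image)
  ultimately have "bij_betw m B' A'" by (simp add: bij_betw_def)
  moreover have "u = m v" if "u \<in> A'" "v \<in> B'" "E u v" for u v using m[OF that(2)] that by auto
  ultimately show ?thesis by blast
qed

text \<open>\<open>F\<close> may exceed \<open>q_edges k\<close> so that \<open>Q10_plus\<close> is
  covered too; the list indices run over the four possible edges between hubs.\<close>

lemma (in min_expanding) embeds_q:
  assumes A: "A = {x1, x2} \<union> A'" "x1 \<noteq> x2" "x1 \<notin> A'" "x2 \<notin> A'" "card A' = k"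
    and B: "B = {y1, y2} \<union> B'" "y1 \<noteq> y2" "y1 \<notin> B'" "y2 \<notin> B'" "card B' = k"
    and m: "bij_betw m B' A'" "\<And>u v. u \<in> A' \<Longrightarrow> v \<in> B' \<Longrightarrow> E u v \<Longrightarrow> u = m v"
    and F: "q_edges k \<subseteq> F" "\<And>i j. E ([x1, x2] ! i) ([y1, y2] ! j) \<Longrightarrow> i < 2 \<Longrightarrow> j < 2 \<Longrightarrow> {Va (i + 1), Vb (j + 1)} \<in> F"
  shows "embeds A B E (q_verts k) F"
proof -
  have fA': "finite A'" using A fin by auto
  then obtain h where h: "bij_betw h A' {..<k}" using finite_same_card_bij[of A' "{..<k}"] A(5) by auto
  define f where "f u = (if u = x1 then Va 1 else if u = x2 then Va 2 else qw (h u))" for u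
  define g where "g v = (if v = y1 then Vb 1 else if v = y2 then Vb 2 else qu (h (m v)))" for v
  have hm: "bij_betw (h \<circ> m) B' {..<k}" by (rule bij_betw_trans[OF m(1) h])
  have fA: "f u = qw (h u)" if "u \<in> A'" for u using that A by (auto simp: f_def)
  have gB: "g v = qu (h (m v))" if "v \<in> B'" for v using that B by (auto simp: g_def)
  have fx: "f x1 = Va 1" "f x2 = Va 2" "g y1 = Vb 1" "g y2 = Vb 2" using A(2) B(2) by (auto simp: f_def g_def)
  have "f ` A' = (\<lambda>u. qw (h u)) ` A'" using fA by (intro image_cong) auto
  also have "\<dots> = qw ` (h ` A')" by (rule image_image[symmetric])
  finally have imf: "f ` A' = qw ` {..<k}" using h by (simp only: bij_betw_def)
  have img: "g ` B' = qu ` {..<k}"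
  proof -
    have "g ` B' = (\<lambda>v. qu ((h \<circ> m) v)) ` B'" using gB by (intro image_cong) auto
    also have "\<dots> = qu ` ((h \<circ> m) ` B')" by (rule image_image[symmetric])
    finally show ?thesis using hm by (simp only: bij_betw_def)
  qed
  have "inj_on f A'" using fA h by (simp add: inj_on_def bij_betw_def)
  moreover have "inj_on g B'" using gB hm by (simp add: inj_on_def bij_betw_def)
  ultimately have bij: "bij_betw f A (f ` A)" "bij_betw g B (g ` B)"
    unfolding bij_betw_def A(1) B(1)
    using imf img fx A(2-4) B(2-4) by (auto simp: inj_on_Un inj_on_insert)
  have imA: "f ` A = {Va 1, Va 2} \<union> qw ` {..<k}" "g ` B = {Vb 1, Vb 2} \<union> qu ` {..<k}"
    unfolding A(1) B(1) image_Un imf img by (simp_all add: fx)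
  show ?thesis
  proof (rule embedsI[OF bij])
    show "f ` A \<inter> g ` B = {}" unfolding imA by auto
    show "f ` A \<union> g ` B = q_verts k" unfolding imA q_verts_def by auto
    fix u v assume u: "u \<in> A" and v: "v \<in> B" and e: "E u v"
    have hlt: "h u < k" if "u \<in> A'" for u using h that by (auto simp: bij_betw_def)
    have hmlt: "h (m v) < k" if "v \<in> B'" for v using hm that by (auto simp: bij_betw_def)
    consider "u \<in> A'" "v \<in> B'" | "u \<in> A'" "v = y1 \<or> v = y2" | "u = x1 \<or> u = x2" "v \<in> B'"
      | "u = x1 \<or> u = x2" "v = y1 \<or> v = y2" using u v A(1) B(1) by blast
    then show "{f u, g v} \<in> F"
    proof cases
      case 1
      then have "{f u, g v} = {qu (h u), qw (h u)}" using m(2)[OF 1 e] fA gB by auto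
      then have "{f u, g v} \<in> q_edges k" using hlt[OF 1(1)] unfolding q_edges_def by blast
      then show ?thesis using F(1) by blast
    next
      case 2
      then have "{f u, g v} = {Vb 1, qw (h u)} \<or> {f u, g v} = {Vb 2, qw (h u)}" using fA fx by auto
      then have "{f u, g v} \<in> q_edges k" using hlt[OF 2(1)] unfolding q_edges_def by blast
      then show ?thesis using F(1) by blast
    next
      case 3
      then have "{f u, g v} = {Va 1, qu (h (m v))} \<or> {f u, g v} = {Va 2, qu (h (m v))}" using gB fx by auto
      then have "{f u, g v} \<in> q_edges k" using hmlt[OF 3(2)] unfolding q_edges_def by blast
      then show ?thesis using F(1) by blast
    next
      case 4
      then show ?thesis using e fx F(2)[of 0 0] F(2)[of 0 1] F(2)[of 1 0] F(2)[of 1 1] by (auto simp: numeral_2_eq_2)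
    qed
  qed
qed


section \<open>Extremal minimal braces\<close>

context bip_graph
begin

lemma min_expanding_cross:
  assumes mb: "minimal_brace G" and n3: "3 \<le> card A"
  shows "min_expanding A B cross (card A)"
proof
  note M = minimal_brace_expanding[OF mb]
  show "finite A" "finite B" by (rule finite_classes)+
  show "card A = card A" "card B = card A" "3 \<le> card A" using M(1) n3 by simp_all
  show "x \<in> A \<and> y \<in> B" if "cross x y" for x y using that by blast
  show ex: "expanding A B cross"
    using M(3) by (subst expanding_cong[of A B cross "adj G"]) auto
  show "\<exists>P R. witness A B cross x y P R" if c: "cross x y" for x y
  proof (rule witness_if_not_expanding[OF finite_classes n3 ex])
    have "\<not> expanding A B (\<lambda>a b. adj G a b \<and> \<not> (a = x \<and> b = y))" using M(5) c by blast
    then show "\<not> expanding A B (\<lambda>a b. cross a b \<and> \<not> (a = x \<and> b = y))"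
      by (subst expanding_cong[of A B _ "\<lambda>a b. adj G a b \<and> \<not> (a = x \<and> b = y)"]) auto
  qed
qed

lemma hub_iso:
  assumes mb: "minimal_brace G" and n3: "3 \<le> card A" and hub: "card (noncubics A cross) = 1"
    and dense: "5 * card A \<le> card (edges G) + 10"
  shows "G \<simeq> biwheel 5 \<or> G \<simeq> biwheel 6 \<or> G \<simeq> Q10_plus"
proof -
  note inj = minimal_brace_expanding(4)[OF mb]
  interpret m: min_expanding A B cross "card A" by (rule min_expanding_cross[OF mb n3])
  interpret d: min_expanding B A "\<lambda>y x. cross x y" "card A" by (rule m.flip)
  note me = card_edges_cross[OF inj]
  obtain x where A2: "m.A2 = {x}" using hub by (meson card_1_singletonE)
  have n: "card A = 5 \<or> card A = 6" and dx: "card {y. cross x y} + 1 = card A"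
    using m.hub_dense[OF A2] dense me by simp_all
  have edges: "card (edges G) + 3 = 3 * card A + card {y. cross x y}"
    using m.card_edges_hub[OF A2] me by simp
  show ?thesis
  proof (rule m.hub_structure[OF A2 dx])
    fix y assume B2: "m.B2 = {y}" and dy: "card {u. cross u y} + 1 = card A" and no: "\<not> cross x y"
    have "G \<simeq> biwheel (card A)" unfolding biwheel_eq
      by (rule iso_if_embeds[OF inj m.embeds_biwheel[OF A2 B2 dx dy no]])
        (use card_biwheel_edges[of "card A"] edges dx n in auto)
    then show ?thesis using n by auto
  next
    fix y w z
    assume B2: "m.B2 = {y}" and dy: "card {u. cross u y} + 1 = card A" and xy: "cross x y"
      and n5: "card A = 5" and z: "B - {y. cross x y} = {z}" and w: "A - {u. cross u y} = {w}"
      and wA: "w \<in> m.A1" and zB: "z \<in> m.B1" and nwz: "\<not> cross w z"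
    \<comment> \<open>\<open>x\<close>, \<open>w\<close> and \<open>y\<close>, \<open>z\<close> take
      the roles of a1, a2 and b1, b2. The cubic \<open>w\<close> misses \<open>y\<close> and
      \<open>z\<close>, so its neighbourhood is the rest of \<open>B\<close>, and likewise for
      \<open>z\<close>. The edge between \<open>x\<close> and \<open>y\<close> is the one added to
      \<open>Q10\<close>.\<close>
    define A' where "A' = A - {x, w}"
    define B' where "B' = B - {y, z}"
    have x: "x \<in> A" "x \<noteq> w" "w \<in> A" "\<not> cross w y" using xy w by blast+
    have y: "y \<in> B" "y \<noteq> z" "z \<in> B" "\<not> cross x z" using xy z by blast+
    have A: "A = {x, w} \<union> A'" "x \<notin> A'" "w \<notin> A'" using x by (auto simp: A'_def)
    have B: "B = {y, z} \<union> B'" "y \<notin> B'" "z \<notin> B'" using y by (auto simp: B'_def)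
    have cA': "card A' = 3" using n5 x finite_classes by (simp add: A'_def card_Diff_subset)
    have cB': "card B' = 3" using n5 y finite_classes m.cards by (simp add: B'_def card_Diff_subset)
    have f': "finite A'" "finite B'" using finite_classes by (simp_all add: A'_def B'_def)
    have "{v. cross w v} \<subseteq> B'" using x nwz by (auto simp: B'_def)
    then have Nw: "{v. cross w v} = B'" using m.card_N_cubics[OF wA] cB' f' by (intro card_subset_eq) auto
    have "{u. cross u z} \<subseteq> A'" using y nwz by (auto simp: A'_def)
    then have Nz: "{u. cross u z} = A'" using d.card_N_cubics[OF zB] cA' f' by (intro card_subset_eq) auto
    have A'c: "cross u y \<and> cross u z \<and> card {v. cross u v} = 3" if u: "u \<in> A'" for u
    proof -
      have "u \<in> A" "u \<noteq> x" "u \<noteq> w" using u by (auto simp: A'_def)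
      moreover have "u \<in> m.A1 \<or> u \<in> m.A2" using \<open>u \<in> A\<close> m.classes(1) by blast
      then have "u \<in> m.A1" using \<open>u \<noteq> x\<close> unfolding A2 by blast
      moreover have "cross u y" using \<open>u \<in> A\<close> \<open>u \<noteq> w\<close> w by blast
      moreover have "cross u z" using Nz u by blast
      ultimately show ?thesis using m.card_N_cubics by blast
    qed
    have B'c: "cross x v \<and> cross w v \<and> card {u. cross u v} = 3" if v: "v \<in> B'" for v
    proof -
      have "v \<in> B" "v \<noteq> y" "v \<noteq> z" using v by (auto simp: B'_def)
      moreover have "v \<in> m.B1 \<or> v \<in> m.B2" using \<open>v \<in> B\<close> m.classes(3) by blast
      then have "v \<in> m.B1" using \<open>v \<noteq> y\<close> unfolding B2 by blast
      moreover have "cross x v" using \<open>v \<in> B\<close> \<open>v \<noteq> z\<close> z by blast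
      moreover have "cross w v" using Nw v by blast
      ultimately show ?thesis using d.card_N_cubics by blast
    qed
    obtain g where g: "bij_betw g B' A'" "\<And>u v. u \<in> A' \<Longrightarrow> v \<in> B' \<Longrightarrow> cross u v \<Longrightarrow> u = g v"
      using m.ex_matching[OF A(1) x(2) A(2,3) cA' B(1) y(2) B(2,3) cB' A'c B'c] by blast
    let ?F = "insert {Va 1, Vb 1} (q_edges 3)"
    have emb: "embeds A B cross (q_verts 3) ?F"
    proof (rule m.embeds_q[OF A(1) x(2) A(2,3) cA' B(1) y(2) B(2,3) cB' g])
      fix i j :: nat assume c: "cross ([x, w] ! i) ([y, z] ! j)" and ij: "i < 2" "j < 2"
      have "i = 0 \<or> i = 1" "j = 0 \<or> j = 1" using ij by auto
      then have "i = 0 \<and> j = 0" using c x(4) y(4) nwz by auto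
      then show "{Va (i + 1), Vb (j + 1)} \<in> ?F" by simp
    qed auto
    have "Q10_plus = simple_graph (q_verts 3) ?F"
      unfolding Q10_plus_def Q10_eq by (simp add: simple_graph_def)
    moreover have "G \<simeq> simple_graph (q_verts 3) ?F"
    proof (rule iso_if_embeds[OF inj emb])
      show "finite ?F" by (simp add: finite_q_edges)
      have "card ?F \<le> Suc (card (q_edges 3))" by (simp add: card_insert_if finite_q_edges)
      then show "card ?F \<le> card (edges G)" using card_q_edges[of 3] edges dx n5 by linarith
    qed
    ultimately show ?thesis by simp
  qed
qed

text \<open>Without noncubic vertices m = 3n, so density leaves n \<le> 5. A single noncubic vertex
  in \<open>B\<close> is handled by the flipped \<open>hub_iso\<close>.\<close>

lemma extremal_iso:
  assumes mb: "minimal_brace G" and dense: "5 * card A \<le> card (edges G) + 10"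
  shows "(\<exists>H \<in> {K2, C4, K33, biwheel 4, biwheel 5, M10, biwheel 6}. G \<simeq> H) \<or> G \<simeq> Q10_plus
    \<or> (\<exists>H \<in> Q_family. G \<simeq> H)"
proof -
  note M = minimal_brace_expanding[OF mb]
  note inj = M(4)
  show ?thesis
  proof (cases "card A \<le> 3")
    case True
    then show ?thesis using complete_iso[OF inj M(1,2) _ M(3)] by blast
  next
    case False
    then have n3: "3 \<le> card A" "4 \<le> card A" by simp_all
    interpret f: bip_graph G B A by (rule flip)
    interpret m: min_expanding A B cross "card A" by (rule min_expanding_cross[OF mb n3(1)])
    interpret d: min_expanding B A "\<lambda>y x. cross x y" "card A" by (rule m.flip)
    note me = card_edges_cross[OF inj]
    have crossf: "(\<lambda>y x. cross x y) = f.cross" by (auto simp: fun_eq_iff adj_commute)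
    have H: "5 * card A \<le> card (edge_pairs cross A B) + 10" using dense me by simp
    consider "m.A2 = {}" | "card m.A2 = 1" | "card m.B2 = 1" | "2 \<le> card m.A2" "2 \<le> card m.B2"
    proof -
      have "card m.A2 = 0 \<or> card m.A2 = 1 \<or> card m.B2 = 0 \<or> card m.B2 = 1 \<or> 2 \<le> card m.A2 \<and> 2 \<le> card m.B2"
        by arith
      moreover have "m.A2 = {}" if "card m.B2 = 0" using that d.noncubic_empty by simp
      moreover have "m.A2 = {}" if "card m.A2 = 0" using that by simp
      ultimately show ?thesis using that by blast
    qed
    then show ?thesis
    proof cases
      case 1
      have B2: "m.B2 = {}" by (rule m.noncubic_empty[OF 1])
      have m3: "card (edges G) = 3 * card A"
        using m.card_edges_sum m.card_classes 1 me by simp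
      then have "card A = 4 \<or> card A = 5" using dense n3 by linarith
      then show ?thesis
      proof
        assume n: "card A = 4"
        have "G \<simeq> biwheel 4" unfolding biwheel_eq
          by (rule iso_if_embeds[OF inj])
            (use m.embeds_cube[OF 1 B2 n] card_biwheel_edges[of 4] m3 n in auto)
        then show ?thesis by blast
      next
        assume n: "card A = 5"
        have "G \<simeq> M10" unfolding M10_def
        proof (rule iso_if_embeds[OF inj m.embeds_M10[OF 1 B2 n]])
          have "card (cycle_edges 10 \<union> (\<lambda>i. {i, i + 5}) ` {..<5}) \<le> card (cycle_edges 10) + card ((\<lambda>i. {i, i + 5}) ` {..<5::nat})"
            by (rule card_Un_le)
          also have "\<dots> \<le> 10 + 5"
            using card_cycle_edges(2)[of 10] card_image_le[of "{..<5::nat}" "\<lambda>i. {i, i + 5}"] by simp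
          finally show "card (cycle_edges 10 \<union> (\<lambda>i. {i, i + 5}) ` {..<5}) \<le> card (edges G)" using m3 n by simp
        qed (simp add: card_cycle_edges)
        then show ?thesis by blast
      qed
    next
      case 2
      then show ?thesis using hub_iso[OF mb n3(1) 2 dense] by blast
    next
      case 3
      have "card (noncubics B f.cross) = 1" using 3 unfolding crossf .
      then show ?thesis using f.hub_iso[OF mb] n3(1) M(1) dense by auto
    next
      case 4
      note D = m.dense_noncubic_two[OF 4 H]
      define k where "k = card A - 2"
      have n6: "6 \<le> card A" using D(6) m.card_edges_ge D(1) by linarith
      obtain x1 x2 where A2: "m.A2 = {x1, x2}" "x1 \<noteq> x2" using D(1) by (auto simp: card_2_iff)
      obtain y1 y2 where B2: "m.B2 = {y1, y2}" "y1 \<noteq> y2" using D(2) by (auto simp: card_2_iff)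
      have x: "x1 \<in> m.A2" "x2 \<in> m.A2" "y1 \<in> m.B2" "y2 \<in> m.B2" using A2 B2 by simp_all
      have A: "A = {x1, x2} \<union> m.A1" "x1 \<notin> m.A1" "x2 \<notin> m.A1" "card m.A1 = k"
        using m.classes(1,2) x m.card_classes(1) D(1) unfolding A2(1)[symmetric] by (auto simp: k_def)
      have B: "B = {y1, y2} \<union> m.B1" "y1 \<notin> m.B1" "y2 \<notin> m.B1" "card m.B1 = k"
        using m.classes(3,4) x m.card_classes(2) D(2) unfolding B2(1)[symmetric] by (auto simp: k_def)
      have A1: "cross u y1 \<and> cross u y2 \<and> card {v. cross u v} = 3" if "u \<in> m.A1" for u
        using D(5)[OF x(3)] D(5)[OF x(4)] that m.card_N_cubics[OF that] by blast
      have B1: "cross x1 v \<and> cross x2 v \<and> card {u. cross u v} = 3" if "v \<in> m.B1" for v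
        using D(4)[OF x(1)] D(4)[OF x(2)] that d.card_N_cubics[OF that] by blast
      obtain g where g: "bij_betw g m.B1 m.A1" "\<And>u v. u \<in> m.A1 \<Longrightarrow> v \<in> m.B1 \<Longrightarrow> cross u v \<Longrightarrow> u = g v"
        using m.ex_matching[OF A(1) A2(2) A(2-4) B(1) B2(2) B(2-4) A1 B1] by blast
      have emb: "embeds A B cross (q_verts k) (q_edges k)"
      proof (rule m.embeds_q[OF A(1) A2(2) A(2-4) B(1) B2(2) B(2-4) g order_refl])
        fix i j :: nat assume c: "cross ([x1, x2] ! i) ([y1, y2] ! j)" and ij: "i < 2" "j < 2"
        have "i = 0 \<or> i = 1" "j = 0 \<or> j = 1" using ij by auto
        then have "([x1, x2] ! i, [y1, y2] ! j) \<in> edge_pairs cross m.A2 m.B2" using c x by (auto simp: edge_pairs_def)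
        then show "{Va (i + 1), Vb (j + 1)} \<in> q_edges k" using D(3) by simp
      qed
      have "G \<simeq> simple_graph (q_verts k) (q_edges k)"
        by (rule iso_if_embeds[OF inj emb finite_q_edges])
          (use card_q_edges[of k] D(6) me in \<open>simp add: k_def\<close>)
      then have "G \<simeq> Q (card A)" using Q_eq[of "card A"] n6 by (simp add: k_def)
      moreover have "Q (card A) \<in> Q_family" using n6 by (auto simp: Q_family_def)
      ultimately show ?thesis by blast
    qed
  qed
qed

end

text \<open>Exact counts, as the converse of the equality claim cannot use the upper bounds that
  served the embeddings.\<close>

lemma card_M10: "card (verts M10) = 10" "card (edges M10) = 15"
proof -
  show "card (verts M10) = 10" by (simp add: M10_def simple_graph_def)
  have "edges M10 = {{0, 1}, {1, 2}, {2, 3}, {3, 4}, {4, 5}, {5, 6}, {6, 7}, {7, 8}, {8, 9}, {9, 0},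
      {0, 5}, {1, 6}, {2, 7}, {3, 8}, {4, 9::nat}}"
    by (simp add: M10_def simple_graph_def cycle_edges_def lessThan_nat_numeral lessThan_Suc insert_commute
        numeral_2_eq_2[symmetric])
  then show "card (edges M10) = 15" by (simp add: doubleton_eq_iff)
qed

lemma card_biwheel6: "card (verts (biwheel 6)) = 12" "card (edges (biwheel 6)) = 20"
proof -
  show "card (verts (biwheel 6)) = 12" by (simp add: biwheel_def simple_graph_def)
  have "{i \<in> {..<10}. even i} = {0, 2, 4, 6, 8::nat}" "{i \<in> {..<10}. odd i} = {1, 3, 5, 7, 9::nat}"
    by (auto simp: lessThan_nat_numeral lessThan_Suc)
  then have "edges (biwheel 6) = {{0, 1}, {1, 2}, {2, 3}, {3, 4}, {4, 5}, {5, 6}, {6, 7}, {7, 8}, {8, 9}, {9, 0},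
      {10, 0}, {10, 2}, {10, 4}, {10, 6}, {10, 8}, {11, 1}, {11, 3}, {11, 5}, {11, 7}, {11, 9::nat}}"
    by (simp add: biwheel_def simple_graph_def cycle_edges_def lessThan_nat_numeral lessThan_Suc insert_commute
        numeral_2_eq_2[symmetric])
  then show "card (edges (biwheel 6)) = 20" by (simp add: doubleton_eq_iff)
qed

theorem theorem4p2:
  fixes G :: "('v, 'e) graph" and n\<^sub>G m\<^sub>G :: real
  assumes "minimal_brace G"
    and "\<forall>H \<in> {K2, C4, K33, biwheel 4, biwheel 5}. \<not> G \<simeq> H"
    and "\<not> G \<simeq> Q10_plus"
  defines "n\<^sub>G \<equiv> real (card (verts G)) / 2"
    and "m\<^sub>G \<equiv> real (card (edges G))"
  shows "m\<^sub>G \<le> 5 * n\<^sub>G - 10 \<and>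
    (m\<^sub>G = 5 * n\<^sub>G - 10 \<longleftrightarrow>
      (\<exists>H \<in> {M10, biwheel 6}. G \<simeq> H) \<or> (\<exists>H \<in> Q_family. G \<simeq> H))"
proof -
  have br: "wf_graph G" "bipartite G" using assms(1) by (simp_all add: minimal_brace_def brace_def)
  from br(2) obtain A B where AB: "A \<union> B = verts G" "A \<inter> B = {}"
    "\<forall>e\<in>edges G. \<exists>a\<in>A. \<exists>b\<in>B. ends G e = {a, b}"
    unfolding bipartite_def by (elim exE conjE)
  interpret bip_graph G A B
    by (rule bip_graph.intro[OF br(1) AB(1,2)]) (rule AB(3)[rule_format])
  have "card A = card B" using minimal_brace_expanding(1)[OF assms(1)] .
  then have cV: "card (verts G) = 2 * card A"
    using card_Un_disjoint[OF finite_classes disj] verts_eq by simp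
  \<comment> \<open>The listed graphs have 5n - 10 edges by counting, and isomorphism transfers this
    to \<open>G\<close>.\<close>
  have conv: "2 * card (edges G) + 20 = 5 * card (verts G)"
    if ext: "(\<exists>H \<in> {M10, biwheel 6}. G \<simeq> H) \<or> (\<exists>H \<in> Q_family. G \<simeq> H)"
  proof -
    consider "G \<simeq> M10" | "G \<simeq> biwheel 6" | n where "6 \<le> n" "G \<simeq> Q n"
      using ext by (auto simp: Q_family_def)
    then show ?thesis
    proof cases
      case 1
      then show ?thesis using iso_cards[OF 1] card_M10 by simp
    next
      case 2
      then show ?thesis using iso_cards[OF 2] card_biwheel6 by simp
    next
      case 3
      have "verts (Q n) = q_verts (n - 2)" "edges (Q n) = q_edges (n - 2)"
        using Q_eq[of n] 3(1) by (simp_all add: simple_graph_def)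
      then show ?thesis using iso_cards[OF 3(2)] card_q_verts card_q_edges 3(1) by simp
    qed
  qed
  have ext: "(\<exists>H \<in> {M10, biwheel 6}. G \<simeq> H) \<or> (\<exists>H \<in> Q_family. G \<simeq> H)"
    if "5 * card A \<le> card (edges G) + 10"
    using extremal_iso[OF assms(1) that] assms(2,3) by auto
  have n: "n\<^sub>G = real (card A)" "m\<^sub>G = real (card (edges G))" by (simp_all add: n\<^sub>G_def m\<^sub>G_def cV)
  show ?thesis
  \<comment> \<open>In the dense case \<open>G\<close> is extremal, and \<open>conv\<close> turns
    the inequality into an equality. Otherwise the bound is strict, and \<open>conv\<close> shows
    that \<open>G\<close> is not extremal.\<close>
  proof (cases "5 * card A \<le> card (edges G) + 10")
    case True
    have "card (edges G) + 10 = 5 * card A" using conv[OF ext[OF True]] cV by simp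
    then have "m\<^sub>G = 5 * n\<^sub>G - 10" unfolding n by linarith
    then show ?thesis using ext[OF True] by simp
  next
    case False
    then have "m\<^sub>G < 5 * n\<^sub>G - 10" unfolding n by linarith
    moreover have "\<not> ((\<exists>H \<in> {M10, biwheel 6}. G \<simeq> H) \<or> (\<exists>H \<in> Q_family. G \<simeq> H))"
      using conv cV False by fastforce
    ultimately show ?thesis by auto
  qed
qed

end
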